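(* Let $G$ be a finite group, suppose $\chi\in\mathrm{Irr}(G)$ is quasi-primitive, and assume $G$ is $\pi(\chi(1))$-solvable. Then for every $x\in G$, $|\chi(x)|^2$ is either zero, or is a positive integer dividing $\chi(1)^2$.
   Context: Characters are complex; $\mathrm{Irr}(G)$ is the set of irreducible characters of $G$. A character $\chi\in\mathrm{Irr}(G)$ is quasi-primitive if for every normal subgroup $N$ of $G$ the restriction $\chi|_N$ is a multiple of an irreducible character of $N$. $\pi(n)$ is the set of prime divisors of $n$, and $G$ is $\pi(n)$-solvable if it is $p$-solvable for each prime $p\in\pi(n)$. *)

theory Defs
  imports
    "HOL-Algebra.Coset"
    "HOL-Computational_Algebra.Primes"
    "Jordan_Normal_Form.VS_Connect"
begin

definition GL :: "nat \<Rightarrow> complex mat monoid" where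
  "GL n = units_of (ring_mat TYPE(complex) n ())"

definition mat_trace :: "complex mat \<Rightarrow> complex" where
  "mat_trace A = (\<Sum>i<dim_row A. A $$ (i, i))"

definition irreducible_rep ::
    "('g, 'r) monoid_scheme \<Rightarrow> nat \<Rightarrow> ('g \<Rightarrow> complex mat) \<Rightarrow> bool" where
  "irreducible_rep G n \<rho> \<longleftrightarrow>
     \<rho> \<in> hom G (GL n) \<and> n > 0 \<and>
     (\<forall>W. subspace class_ring W (module_vec TYPE(complex) n) \<longrightarrow>
          (\<forall>g \<in> carrier G. \<forall>w \<in> W. \<rho> g *\<^sub>v w \<in> W) \<longrightarrow>
          W = {0\<^sub>v n} \<or> W = carrier_vec n)"

text \<open>
  Characters are extensional functions on the carrier, so that equality in the function type is
  equality of functions on the group.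
\<close>

definition Irr :: "('g, 'r) monoid_scheme \<Rightarrow> ('g \<Rightarrow> complex) set" where
  "Irr G = {\<lambda>g \<in> carrier G. mat_trace (\<rho> g) | n \<rho>. irreducible_rep G n \<rho>}"

definition char_degree :: "('g, 'r) monoid_scheme \<Rightarrow> ('g \<Rightarrow> complex) \<Rightarrow> nat" where
  "char_degree G \<chi> = (THE d. \<chi> \<one>\<^bsub>G\<^esub> = of_nat d)"

lemma char_degree_eq:
  assumes "group G" and "\<chi> \<in> Irr G"
  shows "\<chi> \<one>\<^bsub>G\<^esub> = of_nat (char_degree G \<chi>)"
proof -
  obtain n \<rho> where chi: "\<chi> = (\<lambda>g \<in> carrier G. mat_trace (\<rho> g))" and irr: "irreducible_rep G n \<rho>"
    using assms(2) by (auto simp: Irr_def)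
  interpret M: semiring "ring_mat TYPE(complex) n ()" by (rule semiring_mat)
  have "group (GL n)"
    unfolding GL_def by (rule M.units_group)
  moreover have "\<rho> \<in> hom G (GL n)"
    using irr by (simp add: irreducible_rep_def)
  ultimately have "\<rho> \<one>\<^bsub>G\<^esub> = \<one>\<^bsub>GL n\<^esub>"
    using assms(1) by (meson hom_one)
  then have "\<rho> \<one>\<^bsub>G\<^esub> = 1\<^sub>m n"
    by (simp add: GL_def units_of_def ring_mat_def)
  then have "\<chi> \<one>\<^bsub>G\<^esub> = of_nat n"
    using assms(1) by (simp add: chi mat_trace_def group.is_monoid monoid.one_closed)
  then show ?thesis
    by (simp add: char_degree_def)
qed

definition quasi_primitive :: "('g, 'r) monoid_scheme \<Rightarrow> ('g \<Rightarrow> complex) \<Rightarrow> bool" where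
  "quasi_primitive G \<chi> \<longleftrightarrow>
     (\<forall>N. N \<lhd> G \<longrightarrow>
        (\<exists>\<theta> \<in> Irr (G\<lparr>carrier := N\<rparr>). \<exists>e::nat. restrict \<chi> N = (\<lambda>x \<in> N. of_nat e * \<theta> x)))"

text \<open>
  A normal series each of whose factors is a \<open>p\<close>-group or a group of order prime to \<open>p\<close>.
\<close>

definition p_solvable :: "nat \<Rightarrow> ('g, 'r) monoid_scheme \<Rightarrow> bool" where
  "p_solvable p G \<longleftrightarrow>
     (\<exists>(N :: nat \<Rightarrow> 'g set) m.
        N 0 = {\<one>\<^bsub>G\<^esub>} \<and> N m = carrier G \<and> (\<forall>i \<le> m. N i \<lhd> G) \<and>
        (\<forall>i < m. N i \<subseteq> N (Suc i) \<and>
           ((\<exists>k. Coset.order (G\<lparr>carrier := N (Suc i)\<rparr> Mod N i) = p ^ k) \<or>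
            \<not> p dvd Coset.order (G\<lparr>carrier := N (Suc i)\<rparr> Mod N i))))"

definition pi_solvable :: "nat set \<Rightarrow> ('g, 'r) monoid_scheme \<Rightarrow> bool" where
  "pi_solvable \<pi> G \<longleftrightarrow> (\<forall>p \<in> \<pi>. p_solvable p G)"

end

theory Submission
  imports Defs
    "Jordan_Normal_Form.Spectral_Radius"
    "Jordan_Normal_Form.Schur_Decomposition"
    "HOL-Algebra.SndIsomorphismGrp"
    "HOL-Algebra.Group_Action"
begin

text \<open>
  Let \<open>n\<close> be the degree of the representation \<open>r\<close> that affords \<open>\<chi>\<close>, and let \<open>t = tr / n\<close>. For a normal
  subgroup \<open>N\<close> of \<open>G\<close> let \<open>A\<^sub>N\<close> be the algebra spanned by \<open>r N\<close>. Quasi-primitivity makes \<open>r\<close> restricted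
  to \<open>N\<close> a multiple of one irreducible representation, so that \<open>A\<^sub>N\<close> is a full matrix algebra and its centre
  consists of the scalars. Conjugation by \<open>g \<in> G\<close> acts on \<open>A\<^sub>N\<close>. Its trace on \<open>A\<^sub>N\<close>, divided by
  \<open>dim A\<^sub>N\<close>, is the mean of \<open>t\<close> over the commutators \<open>[g, m]\<close>, \<open>m \<in> N\<close>, and \<open>1 / dim A\<^sub>N\<close> is the
  mean of \<open>\<bar>t\<bar>\<^sup>2\<close> over \<open>N\<close>. The claim is that this trace is zero or a positive divisor of
  \<open>dim A\<^sub>N\<close>, for every \<open>g\<close>. For \<open>N = 1\<close> both numbers are 1. For \<open>N = G\<close> the algebra is the algebra of
  all matrices, its dimension is \<open>\<chi>(1)\<^sup>2\<close>, the trace is \<open>\<bar>\<chi>(g)\<bar>\<^sup>2\<close>, and the claim is the theorem.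

  The claim climbs from \<open>1\<close> to \<open>G\<close>. It does not notice the elements of \<open>G\<close> that \<open>r\<close> maps into \<open>A\<^sub>N\<close>
  (\<open>divisible_means_extend_span\<close>), so take \<open>N \<noteq> G\<close> that contains them all, and a minimal normal
  subgroup \<open>M / N\<close> of \<open>G / N\<close>. As \<open>A\<^sub>N\<close> has only inner automorphisms, \<open>r s = d b\<close> for every \<open>s \<in> G\<close>,
  where \<open>d\<close> centralizes \<open>N\<close> and \<open>b \<in> A\<^sub>N\<close>; the factor \<open>d\<close> is determined up to a scalar
  (\<open>tensor_line_unitary\<close>, \<open>tensor_line_multiple\<close>). These factors form a projective representation of
  \<open>M / N\<close>. By solvability at the primes dividing \<open>n\<close>, either \<open>\<bar>M / N\<bar>\<close> is prime to \<open>n\<close> or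
  \<open>M / N\<close> is abelian (\<open>chief_factor_coprime_or_abelian\<close>).

  If \<open>\<bar>M / N\<bar>\<close> is prime to \<open>n\<close>, consider the mean \<open>q\<close> of \<open>\<bar>t(d)\<bar>\<^sup>2\<close> over \<open>M / N\<close>, the inverse of the
  dimension of the span of the factors. The trace of a projection shows that \<open>n\<^sup>2 q\<close> is an integer, and class sums
  show that \<open>\<bar>M / N\<bar>\<^sup>3 q\<close> is an integer, too. Hence \<open>q\<close> is an integer, so that \<open>q = 1\<close>, all factors are scalars and \<open>r M\<close>
  lies in \<open>A\<^sub>N\<close>, which was excluded (\<open>coprime_factor_spanned\<close>). If \<open>M / N\<close> is abelian, two factors commute up to a
  scalar, and for each \<open>s \<in> M - N\<close> some such scalar is not 1; therefore \<open>t\<close> vanishes on \<open>M - N\<close>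
  and \<open>dim A\<^sub>M = \<bar>M / N\<bar> dim A\<^sub>N\<close> (\<open>ramified_t_zero\<close>). In the mean over \<open>[g, s]\<close> only the \<open>s\<close> whose
  class in \<open>M / N\<close> is fixed by \<open>g\<close> survive, and they contribute the values of a linear character of the group of these
  classes. The sum of these values is 0 or the order of that group, which divides \<open>\<bar>M / N\<bar>\<close>
  (\<open>divisible_means_extend_ramified\<close>).
\<close>

section \<open>Finitely supported complex matrices\<close>

text \<open>
  The degree of a representation is a term, so that the matrices of that size are a set and not a type.
  Matrices with finitely many nonzero entries, over an arbitrary index type, form a ring without unit in which sums
  over finite sets, the trace and the conjugate transpose are total. The matrices of size \<open>n\<close> are a corner of
  the ring indexed by the natural numbers. Another index type, pairs, is needed for operators on matrices.
\<close>

definition fin_supp :: "('i \<Rightarrow> 'i \<Rightarrow> complex) \<Rightarrow> bool" where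
  "fin_supp f \<longleftrightarrow> (\<exists>S. finite S \<and> (\<forall>i j. f i j \<noteq> 0 \<longrightarrow> i \<in> S \<and> j \<in> S))"

typedef 'i fmat = "{f :: 'i \<Rightarrow> 'i \<Rightarrow> complex. fin_supp f}"
  morphisms entry of_entries
  by (rule exI[of _ "\<lambda>_ _. 0"]) (auto simp: fin_supp_def)

lemma fin_supp_entry: "\<exists>S. finite S \<and> (\<forall>i j. entry x i j \<noteq> 0 \<longrightarrow> i \<in> S \<and> j \<in> S)"
  using entry[of x] by (simp add: fin_supp_def)

text \<open>
  The row and column indices together, so that one finite set serves as the range of every summation.
\<close>

definition supp :: "'i fmat \<Rightarrow> 'i set" where
  "supp x = {i. \<exists>j. entry x i j \<noteq> 0 \<or> entry x j i \<noteq> 0}"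

lemma finite_supp [simp]: "finite (supp x)"
proof -
  obtain S where S: "finite S" "\<And>i j. entry x i j \<noteq> 0 \<Longrightarrow> i \<in> S \<and> j \<in> S"
    using fin_supp_entry[of x] by metis
  have "supp x \<subseteq> S"
    using S(2) by (auto simp: supp_def)
  then show ?thesis
    using S(1) by (rule finite_subset)
qed

lemma entry_nonzero_supp: "entry x i j \<noteq> 0 \<Longrightarrow> i \<in> supp x \<and> j \<in> supp x"
  by (auto simp: supp_def)

lemma entry_outside_supp:
  "i \<notin> supp x \<Longrightarrow> entry x i j = 0" "j \<notin> supp x \<Longrightarrow> entry x i j = 0"
  by (auto simp: supp_def)

lemma entry_of_entries:
  assumes "finite S" and "\<And>i j. f i j \<noteq> 0 \<Longrightarrow> i \<in> S \<and> j \<in> S"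
  shows "entry (of_entries f) = f"
  using assms by (intro of_entries_inverse) (auto simp: fin_supp_def)

lemma fmat_eqI: "(\<And>i j. entry x i j = entry y i j) \<Longrightarrow> x = y"
  by (metis entry_inject ext)

instantiation fmat :: (type) ring
begin

definition "0 = of_entries (\<lambda>_ _. 0)"
definition "x + y = of_entries (\<lambda>i j. entry x i j + entry y i j)"
definition "- x = of_entries (\<lambda>i j. - entry x i j)"
definition "x - y = of_entries (\<lambda>i j. entry x i j - entry y i j)"
definition "x * y = of_entries (\<lambda>i j. \<Sum>k\<in>supp x. entry x i k * entry y k j)"

lemma entry_zero [simp]: "entry 0 i j = 0"
  unfolding zero_fmat_def by (subst entry_of_entries[of "{}"]) auto

lemma entry_add [simp]: "entry (x + y) i j = entry x i j + entry y i j"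
proof -
  have "i \<in> supp x \<union> supp y \<and> j \<in> supp x \<union> supp y"
    if "entry x i j + entry y i j \<noteq> 0" for i j
    using that by (metis UnCI add_0 diff_self entry_outside_supp)
  then have "entry (of_entries (\<lambda>i j. entry x i j + entry y i j)) = (\<lambda>i j. entry x i j + entry y i j)"
    by (intro entry_of_entries[of "supp x \<union> supp y"]) simp_all
  then show ?thesis
    by (simp add: plus_fmat_def)
qed

lemma entry_uminus [simp]: "entry (- x) i j = - entry x i j"
  unfolding uminus_fmat_def
  by (subst entry_of_entries[of "supp x"]) (auto dest: entry_nonzero_supp)

lemma entry_diff [simp]: "entry (x - y) i j = entry x i j - entry y i j"
proof -
  have "i \<in> supp x \<union> supp y \<and> j \<in> supp x \<union> supp y"
    if "entry x i j - entry y i j \<noteq> 0" for i j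
    using that by (metis UnCI add_0 diff_self entry_outside_supp)
  then have "entry (of_entries (\<lambda>i j. entry x i j - entry y i j)) = (\<lambda>i j. entry x i j - entry y i j)"
    by (intro entry_of_entries[of "supp x \<union> supp y"]) simp_all
  then show ?thesis
    by (simp add: minus_fmat_def)
qed

lemma entry_mult_supp: "entry (x * y) i j = (\<Sum>k\<in>supp x. entry x i k * entry y k j)"
proof -
  have "i \<in> supp x \<union> supp y \<and> j \<in> supp x \<union> supp y"
    if nz: "(\<Sum>k\<in>supp x. entry x i k * entry y k j) \<noteq> 0" for i j
  proof -
    obtain k where "entry x i k * entry y k j \<noteq> 0"
      using nz by (elim sum.not_neutral_contains_not_neutral)
    then have "entry x i k \<noteq> 0" "entry y k j \<noteq> 0" by simp_all
    then show ?thesis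
      using entry_nonzero_supp[of x i k] entry_nonzero_supp[of y k j] by simp
  qed
  then have "entry (of_entries (\<lambda>i j. \<Sum>k\<in>supp x. entry x i k * entry y k j))
      = (\<lambda>i j. \<Sum>k\<in>supp x. entry x i k * entry y k j)"
    by (intro entry_of_entries[of "supp x \<union> supp y"]) simp_all
  then show ?thesis
    by (simp add: times_fmat_def)
qed

lemma entry_mult:
  assumes "finite S" and "supp x \<subseteq> S"
  shows "entry (x * y) i j = (\<Sum>k\<in>S. entry x i k * entry y k j)"
  unfolding entry_mult_supp
  using assms by (intro sum.mono_neutral_left) (auto dest: entry_nonzero_supp)

instance
proof
  fix x y z :: "'a fmat"
  let ?S = "supp x \<union> supp y \<union> supp z \<union> supp (x * y) \<union> supp (x + y)"
  have S: "finite ?S" by simp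
  show "x * y * z = x * (y * z)"
  proof (rule fmat_eqI)
    fix i j
    have "entry (x * y * z) i j = (\<Sum>k\<in>?S. (\<Sum>l\<in>?S. entry x i l * entry y l k) * entry z k j)"
      by (subst entry_mult[OF S], blast, subst entry_mult[OF S], blast, rule refl)
    also have "\<dots> = (\<Sum>l\<in>?S. entry x i l * (\<Sum>k\<in>?S. entry y l k * entry z k j))"
      by (simp only: sum_distrib_left sum_distrib_right mult.assoc) (rule sum.swap)
    also have "\<dots> = entry (x * (y * z)) i j"
      by (subst entry_mult[OF S], blast, subst entry_mult[OF S], blast, rule refl)
    finally show "entry (x * y * z) i j = entry (x * (y * z)) i j" .
  qed
  show "(x + y) * z = x * z + y * z"
    by (rule fmat_eqI, simp,
        subst entry_mult[OF S], blast, subst entry_mult[OF S], blast, subst entry_mult[OF S], blast)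
      (simp add: distrib_right sum.distrib)
  show "x * (y + z) = x * y + x * z"
    by (rule fmat_eqI) (simp add: entry_mult_supp distrib_left sum.distrib)
qed (auto intro: fmat_eqI)

end

lemma entry_sum [simp]: "entry (\<Sum>a\<in>A. f a) i j = (\<Sum>a\<in>A. entry (f a) i j)"
  by (induction A rule: infinite_finite_induct) auto

definition smul :: "complex \<Rightarrow> 'i fmat \<Rightarrow> 'i fmat" where
  "smul c x = of_entries (\<lambda>i j. c * entry x i j)"

lemma entry_smul [simp]: "entry (smul c x) i j = c * entry x i j"
  unfolding smul_def
  by (subst entry_of_entries[of "supp x"]) (auto dest: entry_nonzero_supp)

global_interpretation fmat: vector_space smul
  by standard (auto intro!: fmat_eqI simp: algebra_simps)

lemma supp_smul: "supp (smul c x) \<subseteq> supp x"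
  by (auto simp: supp_def)

lemma smul_mult_left [simp]: "smul c x * y = smul c (x * y)"
  using supp_smul[of c x]
  by (intro fmat_eqI, subst entry_mult[OF finite_supp]) 
    (auto simp: entry_mult_supp sum_distrib_left mult.assoc)

lemma smul_mult_right [simp]: "x * smul c y = smul c (x * y)"
  by (intro fmat_eqI) (simp add: entry_mult_supp sum_distrib_left mult.left_commute)

definition tr :: "'i fmat \<Rightarrow> complex" where
  "tr x = (\<Sum>i\<in>supp x. entry x i i)"

lemma tr_eq: "finite S \<Longrightarrow> supp x \<subseteq> S \<Longrightarrow> tr x = (\<Sum>i\<in>S. entry x i i)"
  unfolding tr_def by (intro sum.mono_neutral_left) (auto dest: entry_nonzero_supp)

lemma tr_zero [simp]: "tr 0 = 0"
  by (simp add: tr_def)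

lemma supp_add: "supp (x + y) \<subseteq> supp x \<union> supp y"
  by (auto simp: supp_def)

lemma entry_mult_nonzero: "entry (x * y) i j \<noteq> 0 \<Longrightarrow> i \<in> supp x \<and> j \<in> supp y"
  unfolding entry_mult_supp
  by (erule sum.not_neutral_contains_not_neutral)
    (metis entry_outside_supp mult_zero_left mult_zero_right)

lemma supp_mult: "supp (x * y) \<subseteq> supp x \<union> supp y"
proof
  fix i assume "i \<in> supp (x * y)"
  then obtain j where "entry (x * y) i j \<noteq> 0 \<or> entry (x * y) j i \<noteq> 0"
    by (auto simp: supp_def)
  then show "i \<in> supp x \<union> supp y"
    using entry_mult_nonzero[of x y i j] entry_mult_nonzero[of x y j i] by auto
qed

lemma tr_add [simp]: "tr (x + y) = tr x + tr y"
  using supp_add[of x y]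
  by (subst (1 2 3) tr_eq[of "supp x \<union> supp y"]) (auto simp: sum.distrib)

lemma tr_smul [simp]: "tr (smul c x) = c * tr x"
  using supp_smul[of c x]
  by (subst (1 2) tr_eq[of "supp x"]) (auto simp: sum_distrib_left)

lemma tr_sum [simp]: "tr (\<Sum>a\<in>A. f a) = (\<Sum>a\<in>A. tr (f a))"
  by (induction A rule: infinite_finite_induct) auto

lemma tr_uminus [simp]: "tr (- x) = - tr x"
  using tr_smul[of "-1" x] by simp

lemma tr_diff [simp]: "tr (x - y) = tr x - tr y"
  using tr_add[of x "- y"] by simp

lemma tr_mult:
  assumes "finite S" "supp x \<subseteq> S" "supp y \<subseteq> S"
  shows "tr (x * y) = (\<Sum>i\<in>S. \<Sum>k\<in>S. entry x i k * entry y k i)"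
  using supp_mult[of x y] assms
  by (subst tr_eq[of S]) (auto simp: entry_mult[of S])

lemma tr_commute: "tr (x * y) = tr (y * x)"
proof -
  let ?S = "supp x \<union> supp y"
  have "tr (x * y) = (\<Sum>i\<in>?S. \<Sum>k\<in>?S. entry x i k * entry y k i)"
    by (rule tr_mult) auto
  also have "\<dots> = (\<Sum>k\<in>?S. \<Sum>i\<in>?S. entry y k i * entry x i k)"
    by (subst sum.swap) (simp only: mult.commute)
  also have "\<dots> = tr (y * x)"
    by (rule tr_mult[symmetric]) auto
  finally show ?thesis .
qed

definition star :: "'i fmat \<Rightarrow> 'i fmat" where
  "star x = of_entries (\<lambda>i j. cnj (entry x j i))"

lemma entry_star [simp]: "entry (star x) i j = cnj (entry x j i)"
  unfolding star_def
  by (subst entry_of_entries[of "supp x"]) (auto dest: entry_nonzero_supp)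

lemma supp_star [simp]: "supp (star x) = supp x"
  unfolding supp_def by (auto intro!: Collect_cong)

lemma star_star [simp]: "star (star x) = x"
  by (rule fmat_eqI) simp

lemma star_zero [simp]: "star 0 = 0"
  by (rule fmat_eqI) simp

lemma star_add: "star (x + y) = star x + star y"
  by (rule fmat_eqI) simp

lemma star_sum: "star (\<Sum>a\<in>A. f a) = (\<Sum>a\<in>A. star (f a))"
  by (rule fmat_eqI) (simp add: cnj_sum)

lemma star_smul: "star (smul c x) = smul (cnj c) (star x)"
  by (rule fmat_eqI) simp

lemma star_mult: "star (x * y) = star y * star x"
  by (rule fmat_eqI, simp, subst (1 2) entry_mult[of "supp x \<union> supp y"])
    (auto simp: cnj_sum mult.commute)

text \<open>
  Every positivity argument below goes back to this sum of squares.
\<close>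

lemma tr_mult_star: "tr (x * star x) = of_real (\<Sum>i\<in>supp x. \<Sum>k\<in>supp x. (cmod (entry x i k))\<^sup>2)"
  by (subst tr_mult[of "supp x"]) (auto simp: complex_norm_square[symmetric])

lemma tr_mult_star_nonneg: "0 \<le> Re (tr (x * star x))" and tr_mult_star_real: "Im (tr (x * star x)) = 0"
  by (auto simp: tr_mult_star intro!: sum_nonneg)

lemma tr_mult_star_eq_0_iff: "tr (x * star x) = 0 \<longleftrightarrow> x = 0"
proof
  assume "tr (x * star x) = 0"
  then have "(\<Sum>i\<in>supp x. \<Sum>k\<in>supp x. (cmod (entry x i k))\<^sup>2) = 0"
    unfolding tr_mult_star by (metis of_real_eq_0_iff)
  then have "\<forall>i\<in>supp x. \<forall>k\<in>supp x. (cmod (entry x i k))\<^sup>2 = 0"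
    by (simp add: sum_nonneg_eq_0_iff sum_nonneg)
  then show "x = 0"
    by (intro fmat_eqI) (metis entry_zero entry_nonzero_supp power2_eq_square mult_eq_0_iff norm_eq_zero)
qed simp

text \<open>
  The Kronecker product. Its index type is a product, and \<open>kron x (cj x)\<close>, with \<open>cj\<close> the entrywise conjugate, is
  the matrix of the operator \<open>y \<mapsto> x * y * star x\<close> with respect to the matrix units.
\<close>

definition kron :: "'i fmat \<Rightarrow> 'j fmat \<Rightarrow> ('i \<times> 'j) fmat" where
  "kron x y = of_entries (\<lambda>p q. entry x (fst p) (fst q) * entry y (snd p) (snd q))"

lemma entry_kron [simp]: "entry (kron x y) p q = entry x (fst p) (fst q) * entry y (snd p) (snd q)"
  unfolding kron_def
  by (subst entry_of_entries[of "supp x \<times> supp y"]) (auto simp: mem_Times_iff dest: entry_nonzero_supp)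

lemma supp_kron: "supp (kron x y) \<subseteq> supp x \<times> supp y"
  by (auto simp: supp_def)

lemma kron_mult: "kron x y * kron x' y' = kron (x * x') (y * y')"
  by (rule fmat_eqI, subst entry_mult[OF _ supp_kron])
    (auto simp: entry_mult_supp sum_product sum.cartesian_product ac_simps split_beta)

lemma tr_kron: "tr (kron x y) = tr x * tr y"
  by (subst tr_eq[OF _ supp_kron])
    (auto simp: tr_def sum_product sum.cartesian_product split_beta)

lemma kron_smul: "kron (smul c x) y = smul c (kron x y)" "kron x (smul c y) = smul c (kron x y)"
  by (auto intro!: fmat_eqI)

definition cj :: "'i fmat \<Rightarrow> 'i fmat" where
  "cj x = of_entries (\<lambda>i j. cnj (entry x i j))"

lemma entry_cj [simp]: "entry (cj x) i j = cnj (entry x i j)"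
  unfolding cj_def
  by (subst entry_of_entries[of "supp x"]) (auto dest: entry_nonzero_supp)

lemma supp_cj [simp]: "supp (cj x) = supp x"
  by (simp add: supp_def)

lemma cj_mult: "cj (x * y) = cj x * cj y"
  by (rule fmat_eqI) (simp add: entry_mult_supp cnj_sum)

lemma cj_smul: "cj (smul c x) = smul (cnj c) (cj x)"
  by (rule fmat_eqI) simp

lemma tr_cj: "tr (cj x) = cnj (tr x)"
  by (simp add: tr_def cnj_sum)

section \<open>Integrality of traces and eigenvalues\<close>

text \<open>
  The Schur form of an idempotent is triangular and idempotent, so that each of its diagonal entries is
  idempotent, that is, 0 or 1.
\<close>

lemma idempotent_mat_trace_nat:
  fixes A :: "complex mat"
  assumes A: "A \<in> carrier_mat n n" and idem: "A * A = A"
  shows "(\<Sum>i<n. A $$ (i, i)) \<in> \<nat>"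
proof -
  obtain as where "char_poly A = (\<Prod>a\<leftarrow>as. [:- a, 1:])"
    using char_poly_factorized[OF A] by blast
  then obtain B where B: "B \<in> carrier_mat n n" "upper_triangular B" "similar_mat A B"
    using schur_decomposition_exists[OF A] by blast
  then obtain P Q where PQ: "similar_mat_wit A B P Q"
    by (auto simp: similar_mat_def)
  note w = similar_mat_witD2[OF A PQ]
  have P: "P \<in> carrier_mat n n" and Q: "Q \<in> carrier_mat n n"
    and PQ1: "P * Q = 1\<^sub>m n" and QP1: "Q * P = 1\<^sub>m n" and AB: "A = P * B * Q"
    using w by auto
  have B_eq: "B = Q * A * P"
  proof -
    have "Q * A * P = Q * (P * B * Q) * P" using AB by simp
    also have "\<dots> = (Q * P) * B * (Q * P)"
      using P Q B(1) by (simp add: assoc_mult_mat[of _ n n _ n _ n])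
    finally show ?thesis using QP1 B(1) by simp
  qed
  have BB: "B * B = B"
  proof -
    have "B * B = (Q * A * P) * (Q * A * P)" using B_eq by simp
    also have "\<dots> = Q * (A * (P * Q) * A) * P"
      using P Q A by (simp add: assoc_mult_mat[of _ n n _ n _ n])
    also have "\<dots> = Q * A * P" using PQ1 A idem by simp
    finally show ?thesis using B_eq by simp
  qed
  have diag: "B $$ (i, i) = 0 \<or> B $$ (i, i) = 1" if i: "i < n" for i
  proof -
    have "B $$ (i, i) = (B * B) $$ (i, i)" using BB by simp
    also have "\<dots> = (\<Sum>k<n. B $$ (i, k) * B $$ (k, i))"
      using B(1) i by (simp add: scalar_prod_def atLeast0LessThan)
    also have "\<dots> = (\<Sum>k\<in>{i}. B $$ (i, k) * B $$ (k, i))"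
    proof (rule sum.mono_neutral_right)
      show "\<forall>k\<in>{..<n} - {i}. B $$ (i, k) * B $$ (k, i) = 0"
      proof
        fix k assume "k \<in> {..<n} - {i}"
        then consider "k < i" "k < n" | "i < k" "k < n" by force
        then show "B $$ (i, k) * B $$ (k, i) = 0"
          using B(1,2) i by cases (auto simp: upper_triangular_def)
      qed
    qed (use i in auto)
    finally have "B $$ (i, i) = B $$ (i, i) * B $$ (i, i)" by simp
    then show ?thesis by auto
  qed
  have tr: "(\<Sum>i<n. (X * Y) $$ (i, i)) = (\<Sum>i<n. (Y * X) $$ (i, i))"
    if X: "X \<in> carrier_mat n n" and Y: "Y \<in> carrier_mat n n" for X Y :: "complex mat"
  proof -
    have "(\<Sum>i<n. (X * Y) $$ (i, i)) = (\<Sum>i<n. \<Sum>k<n. X $$ (i, k) * Y $$ (k, i))"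
      using X Y by (simp add: scalar_prod_def atLeast0LessThan)
    also have "\<dots> = (\<Sum>k<n. \<Sum>i<n. Y $$ (k, i) * X $$ (i, k))"
      by (subst sum.swap) (simp only: mult.commute)
    also have "\<dots> = (\<Sum>i<n. (Y * X) $$ (i, i))"
      using X Y by (simp add: scalar_prod_def atLeast0LessThan)
    finally show ?thesis .
  qed
  have "(\<Sum>i<n. A $$ (i, i)) = (\<Sum>i<n. (P * (B * Q)) $$ (i, i))"
    using AB P B(1) Q by (simp add: assoc_mult_mat[of _ n n _ n _ n])
  also have "\<dots> = (\<Sum>i<n. (B * Q * P) $$ (i, i))"
    using P B(1) Q by (intro tr) auto
  also have "\<dots> = (\<Sum>i<n. B $$ (i, i))"
    using P B(1) Q QP1 by (simp add: assoc_mult_mat[of _ n n _ n _ n])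
  also have "\<dots> = of_nat (card {i \<in> {..<n}. B $$ (i, i) = 1})"
  proof -
    have "(\<Sum>i<n. B $$ (i, i)) = (\<Sum>i<n. if B $$ (i, i) = 1 then 1 else 0)"
      using diag by (intro sum.cong) auto
    also have "\<dots> = of_nat (card {i \<in> {..<n}. B $$ (i, i) = 1})"
      by (simp add: sum.If_cases Int_def)
    finally show ?thesis .
  qed
  also have "\<dots> \<in> \<nat>" by simp
  finally show ?thesis .
qed

lemma idempotent_tr_nat:
  assumes "x * x = (x :: 'i fmat)"
  shows "tr x \<in> \<nat>"
proof -
  define n where "n = card (supp x)"
  obtain f where f: "bij_betw f {..<n} (supp x)"
    unfolding n_def using ex_bij_betw_nat_finite[OF finite_supp, of x] by (auto simp: atLeast0LessThan)
  define A where "A = mat n n (\<lambda>(i, j). entry x (f i) (f j))"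
  have A: "A \<in> carrier_mat n n" by (simp add: A_def)
  have "A * A = A"
  proof (rule eq_matI)
    fix i j assume "i < dim_row A" "j < dim_col A"
    then have ij: "i < n" "j < n" by (auto simp: A_def)
    have "(A * A) $$ (i, j) = (\<Sum>k<n. entry x (f i) (f k) * entry x (f k) (f j))"
      using ij by (simp add: A_def scalar_prod_def atLeast0LessThan)
    also have "\<dots> = (\<Sum>k\<in>supp x. entry x (f i) k * entry x k (f j))"
      by (rule sum.reindex_bij_betw[OF f])
    also have "\<dots> = entry (x * x) (f i) (f j)"
      by (simp add: entry_mult_supp)
    finally show "(A * A) $$ (i, j) = A $$ (i, j)"
      using ij assms by (simp add: A_def)
  qed (auto simp: A_def)
  then have "(\<Sum>i<n. A $$ (i, i)) \<in> \<nat>"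
    by (rule idempotent_mat_trace_nat[OF A])
  also have "(\<Sum>i<n. A $$ (i, i)) = (\<Sum>i<n. entry x (f i) (f i))"
    by (simp add: A_def)
  also have "\<dots> = tr x"
    unfolding tr_def by (rule sum.reindex_bij_betw[OF f])
  finally show ?thesis .
qed

text \<open>
  This is how integrality enters: a number that multiplies finitely many vectors into their own integral span is an
  eigenvalue of an integer matrix, and hence a root of a monic integer polynomial.
\<close>

lemma algebraic_int_eigenvalue:
  fixes v :: "'a \<Rightarrow> complex" and F :: "'a \<Rightarrow> 'a \<Rightarrow> int"
  assumes fin: "finite \<Gamma>" and ex: "\<exists>\<gamma>\<in>\<Gamma>. v \<gamma> \<noteq> 0"
    and eig: "\<And>\<gamma>. \<gamma> \<in> \<Gamma> \<Longrightarrow> (\<Sum>\<delta>\<in>\<Gamma>. of_int (F \<gamma> \<delta>) * v \<delta>) = c * v \<gamma>"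
  shows "algebraic_int c"
proof -
  define n where "n = card \<Gamma>"
  obtain f where f: "bij_betw f {..<n} \<Gamma>"
    unfolding n_def using ex_bij_betw_nat_finite[OF fin] by (auto simp: atLeast0LessThan)
  define A where "A = mat n n (\<lambda>(i, j). F (f i) (f j))"
  define w where "w = vec n (\<lambda>i. v (f i))"
  let ?A = "map_mat (of_int :: int \<Rightarrow> complex) A"
  have A: "A \<in> carrier_mat n n" "?A \<in> carrier_mat n n" by (simp_all add: A_def)
  have fG: "f i \<in> \<Gamma>" if "i < n" for i
    using f that by (auto simp: bij_betw_def)
  have "?A *\<^sub>v w = c \<cdot>\<^sub>v w"
  proof (rule eq_vecI)
    fix i assume "i < dim_vec (c \<cdot>\<^sub>v w)"
    then have i: "i < n" by (simp add: w_def)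
    have "(?A *\<^sub>v w) $ i = (\<Sum>k<n. of_int (F (f i) (f k)) * v (f k))"
      using i by (simp add: A_def w_def scalar_prod_def atLeast0LessThan)
    also have "\<dots> = (\<Sum>\<delta>\<in>\<Gamma>. of_int (F (f i) \<delta>) * v \<delta>)"
      by (rule sum.reindex_bij_betw[OF f])
    also have "\<dots> = (c \<cdot>\<^sub>v w) $ i"
      using i eig[OF fG[OF i]] by (simp add: w_def)
    finally show "(?A *\<^sub>v w) $ i = (c \<cdot>\<^sub>v w) $ i" .
  qed (simp add: A_def w_def)
  moreover have "w \<noteq> 0\<^sub>v n"
  proof
    assume w0: "w = 0\<^sub>v n"
    obtain \<gamma> where g: "\<gamma> \<in> \<Gamma>" "v \<gamma> \<noteq> 0" using ex by blast
    then obtain i where i: "i < n" "f i = \<gamma>"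
      using f by (auto simp: bij_betw_def)
    have "w $ i = 0" using w0 i by simp
    then show False using i g by (simp add: w_def)
  qed
  ultimately have "eigenvalue ?A c"
    unfolding eigenvalue_def eigenvector_def using A(2) by (intro exI[of _ w]) (auto simp: w_def)
  then have "poly (char_poly ?A) c = 0"
    using eigenvalue_root_char_poly[OF A(2)] by simp
  then have "poly (map_poly of_int (char_poly A)) c = 0"
    by (simp add: of_int_hom.char_poly_hom[OF A(1)])
  moreover have "lead_coeff (char_poly A) = 1"
    using degree_monic_char_poly[OF A(1)] by simp
  ultimately show ?thesis
    unfolding algebraic_int_altdef_ipoly by blast
qed

section \<open>Square matrices and Schur's lemma\<close>

text \<open>
  The matrices of size \<open>n\<close> are the elements supported in \<open>{..<n}\<close>; their unit \<open>unit_mat n\<close> is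
  an idempotent of the ring. The functions \<open>embed\<close> and \<open>mat_of\<close> pass between them and matrices with
  explicit dimensions, for the sake of determinants and eigenvectors.
\<close>

definition embed :: "nat \<Rightarrow> complex mat \<Rightarrow> nat fmat" where
  "embed n A = of_entries (\<lambda>i j. if i < n \<and> j < n then A $$ (i, j) else 0)"

definition corner :: "nat \<Rightarrow> nat fmat set" where
  "corner n = {x. supp x \<subseteq> {..<n}}"

definition unit_mat :: "nat \<Rightarrow> nat fmat" where
  "unit_mat n = embed n (1\<^sub>m n)"

definition mat_of :: "nat \<Rightarrow> nat fmat \<Rightarrow> complex mat" where
  "mat_of n x = mat n n (\<lambda>(i, j). entry x i j)"

lemma entry_embed: "entry (embed n A) i j = (if i < n \<and> j < n then A $$ (i, j) else 0)"
  unfolding embed_def by (subst entry_of_entries[of "{..<n}"]) (auto split: if_splits)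

lemma entry_unit_mat: "entry (unit_mat n) i j = (if i < n \<and> i = j then 1 else 0)"
  by (auto simp: unit_mat_def entry_embed)

lemma embed_corner [simp]: "embed n A \<in> corner n"
  by (auto simp: corner_def supp_def entry_embed split: if_splits)

lemma unit_mat_corner [simp]: "unit_mat n \<in> corner n"
  by (simp add: unit_mat_def)

lemma corner_entry: "x \<in> corner n \<Longrightarrow> \<not> (i < n \<and> j < n) \<Longrightarrow> entry x i j = 0"
  by (auto simp: corner_def subset_iff dest: entry_nonzero_supp)

lemma mat_of_carrier [simp]: "mat_of n x \<in> carrier_mat n n"
  by (simp add: mat_of_def)

lemma embed_mat_of [simp]: "x \<in> corner n \<Longrightarrow> embed n (mat_of n x) = x"
  by (rule fmat_eqI) (auto simp: entry_embed mat_of_def corner_entry)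

lemma mat_of_embed [simp]: "A \<in> carrier_mat n n \<Longrightarrow> mat_of n (embed n A) = A"
  by (rule eq_matI) (auto simp: entry_embed mat_of_def)

lemma entry_mult_corner:
  assumes "x \<in> corner n"
  shows "entry (x * y) i j = (\<Sum>k<n. entry x i k * entry y k j)"
  using assms by (intro entry_mult) (auto simp: corner_def)

lemma embed_mult:
  assumes "A \<in> carrier_mat n n" "B \<in> carrier_mat n n"
  shows "embed n (A * B) = embed n A * embed n B"
  by (rule fmat_eqI, subst entry_mult_corner[of _ n])
    (use assms in \<open>auto simp: entry_embed scalar_prod_def atLeast0LessThan\<close>)

lemma mat_of_mult:
  assumes "x \<in> corner n" "y \<in> corner n"
  shows "mat_of n (x * y) = mat_of n x * mat_of n y"
  by (metis assms embed_mat_of embed_mult mat_of_carrier mat_of_embed mult_carrier_mat)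

lemma mat_of_smul: "mat_of n (smul c x) = c \<cdot>\<^sub>m mat_of n x"
  by (rule eq_matI) (auto simp: mat_of_def)

lemma mat_of_unit [simp]: "mat_of n (unit_mat n) = 1\<^sub>m n"
  by (simp add: unit_mat_def)

lemma unit_mat_left [simp]:
  assumes "x \<in> corner n"
  shows "unit_mat n * x = x"
proof (rule fmat_eqI)
  fix i j
  have "entry (unit_mat n * x) i j = (\<Sum>k<n. if k = i then entry x i j else 0)"
    by (subst entry_mult_corner[of _ n], simp, rule sum.cong) (auto simp: entry_unit_mat)
  then show "entry (unit_mat n * x) i j = entry x i j"
    using assms by (auto simp: corner_entry)
qed

lemma unit_mat_right [simp]:
  assumes "x \<in> corner n"
  shows "x * unit_mat n = x"
proof (rule fmat_eqI)
  fix i j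
  have "entry (x * unit_mat n) i j = (\<Sum>k<n. if k = j then entry x i j else 0)"
    by (subst entry_mult_corner[OF assms], rule sum.cong) (auto simp: entry_unit_mat)
  then show "entry (x * unit_mat n) i j = entry x i j"
    using assms by (auto simp: corner_entry)
qed

lemma corner_closed:
  assumes "x \<in> corner n"
  shows "y \<in> corner n \<Longrightarrow> x * y \<in> corner n" "y \<in> corner n \<Longrightarrow> x + y \<in> corner n"
    "smul c x \<in> corner n" "star x \<in> corner n"
  using assms supp_mult[of x y] supp_add[of x y] supp_smul[of c x] by (auto simp: corner_def)

lemma corner_zero [simp]: "0 \<in> corner n"
  by (simp add: corner_def supp_def)

lemma corner_sum: "(\<And>a. a \<in> A \<Longrightarrow> f a \<in> corner n) \<Longrightarrow> (\<Sum>a\<in>A. f a) \<in> corner n"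
  by (induction A rule: infinite_finite_induct) (auto intro: corner_closed)

lemma tr_embed:
  assumes "A \<in> carrier_mat n n"
  shows "tr (embed n A) = mat_trace A"
  using assms embed_corner[of n A]
  by (subst tr_eq[of "{..<n}"]) (auto simp: corner_def mat_trace_def entry_embed)

lemma tr_unit_mat [simp]: "tr (unit_mat n) = of_nat n"
  unfolding unit_mat_def by (subst tr_embed) (auto simp: mat_trace_def)

lemma star_unit_mat [simp]: "star (unit_mat n) = unit_mat n"
  by (rule fmat_eqI) (auto simp: entry_unit_mat)

lemma corner_invertible:
  assumes x: "x \<in> corner n" and inj: "\<And>y. y \<in> corner n \<Longrightarrow> x * y = 0 \<Longrightarrow> y = 0"
  obtains z where "z \<in> corner n" "x * z = unit_mat n" "z * x = unit_mat n"
proof -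
  let ?A = "mat_of n x"
  have "det ?A \<noteq> 0"
  proof
    assume "det ?A = 0"
    then obtain v where v: "v \<in> carrier_vec n" "v \<noteq> 0\<^sub>v n" "?A *\<^sub>v v = 0\<^sub>v n"
      using det_0_iff_vec_prod_zero[of ?A n] by auto
    \<comment> \<open>The kernel vector is repeated in every column, since the hypothesis is about matrices.\<close>
    define V where "V = mat n n (\<lambda>(i, j). v $ i)"
    have V: "V \<in> carrier_mat n n" by (simp add: V_def)
    have "?A * V = 0\<^sub>m n n"
    proof (rule eq_matI)
      fix i j assume "i < dim_row (0\<^sub>m n n)" "j < dim_col (0\<^sub>m n n)"
      then have ij: "i < n" "j < n" by auto
      then have "col V j = v" using v(1) by (intro eq_vecI) (auto simp: V_def)
      then have "(?A * V) $$ (i, j) = (?A *\<^sub>v v) $ i"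
        using ij V by (simp add: mat_of_def)
      then show "(?A * V) $$ (i, j) = 0\<^sub>m n n $$ (i, j)"
        using v(3) ij by simp
    qed (auto simp: V_def mat_of_def)
    then have "x * embed n V = embed n (0\<^sub>m n n)"
      using embed_mult[of ?A n V] x V by simp
    also have "\<dots> = 0" by (rule fmat_eqI) (simp add: entry_embed)
    finally have "embed n V = 0" using inj by simp
    then have "V = mat_of n 0" using mat_of_embed[OF V] by simp
    then have V0: "V $$ (i, i) = 0" if "i < n" for i
      using that by (simp add: mat_of_def)
    have "v = 0\<^sub>v n"
    proof (rule eq_vecI)
      fix i assume "i < dim_vec (0\<^sub>v n)"
      then show "v $ i = 0\<^sub>v n $ i" using V0[of i] by (simp add: V_def)
    qed (use v in simp)
    then show False using v(2) by simp
  qed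
  then have "?A \<in> Units (ring_mat TYPE(complex) n ())"
    by (intro det_non_zero_imp_unit) auto
  then obtain B where B: "B \<in> carrier_mat n n" "B * ?A = 1\<^sub>m n" "?A * B = 1\<^sub>m n"
    by (auto simp: Units_def ring_mat_def)
  show ?thesis
  proof (rule that[of "embed n B"])
    show "x * embed n B = unit_mat n" "embed n B * x = unit_mat n"
      using embed_mult[of ?A n B] embed_mult[of B n ?A] B x by (simp_all add: unit_mat_def)
  qed simp
qed

definition cdet :: "nat \<Rightarrow> nat fmat \<Rightarrow> complex" where
  "cdet n x = det (mat_of n x)"

lemma cdet_mult: "x \<in> corner n \<Longrightarrow> y \<in> corner n \<Longrightarrow> cdet n (x * y) = cdet n x * cdet n y"
  by (simp add: cdet_def mat_of_mult det_mult[of _ n])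

lemma cdet_smul: "cdet n (smul c x) = c ^ n * cdet n x"
  by (simp add: cdet_def mat_of_smul carrier_matD[OF mat_of_carrier])

lemma cdet_unit [simp]: "cdet n (unit_mat n) = 1"
  by (simp add: cdet_def)

lemma cdet_star: "cdet n (star x) = cnj (cdet n x)"
proof -
  interpret cnj_hom: comm_ring_hom cnj by standard auto
  have "mat_of n (star x) = (map_mat cnj (mat_of n x))\<^sup>T"
    by (rule eq_matI) (auto simp: mat_of_def)
  then show ?thesis
    by (simp add: cdet_def det_transpose[of _ n] cnj_hom.hom_det)
qed

lemma GL_carrier: "A \<in> carrier (GL n) \<Longrightarrow> A \<in> carrier_mat n n"
  by (auto simp: GL_def units_of_def Units_def ring_mat_def)

text \<open>
  Schur's lemma. An eigenspace of a commuting matrix is invariant and not zero, so that it is the whole space.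
\<close>

lemma irreducible_rep_commuting_scalar:
  assumes irr: "irreducible_rep G n \<rho>" and z: "z \<in> corner n"
    and comm: "\<And>g. g \<in> carrier G \<Longrightarrow> embed n (\<rho> g) * z = z * embed n (\<rho> g)"
  shows "\<exists>c. z = smul c (unit_mat n)"
proof -
  define Z where "Z = mat_of n z"
  have Z: "Z \<in> carrier_mat n n" by (simp add: Z_def)
  have n: "n > 0" and \<rho>: "\<And>g. g \<in> carrier G \<Longrightarrow> \<rho> g \<in> carrier_mat n n"
    using irr by (auto simp: irreducible_rep_def hom_def intro!: GL_carrier)
  obtain c where "eigenvalue Z c"
    using spectrum_non_empty[OF Z n] by (auto simp: spectrum_def)
  then obtain v where v: "v \<in> carrier_vec n" "v \<noteq> 0\<^sub>v n" "Z *\<^sub>v v = c \<cdot>\<^sub>v v"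
    using Z by (auto simp: eigenvalue_def eigenvector_def)
  define W where "W = {v \<in> carrier_vec n. Z *\<^sub>v v = c \<cdot>\<^sub>v v}"
  have "VectorSpace.subspace class_ring W (module_vec TYPE(complex) n)"
  proof (unfold VectorSpace.subspace_def, intro conjI)
    show "vectorspace class_ring (module_vec TYPE(complex) n)"
      by (rule vec_vs)
    interpret vec_space "TYPE(complex)" n .
    show "LinearCombinations.submodule class_ring W (module_vec TYPE(complex) n)"
    proof (unfold_locales)
      show "W \<subseteq> carrier (module_vec TYPE(complex) n)"
        by (auto simp: W_def)
      show "\<zero>\<^bsub>module_vec TYPE(complex) n\<^esub> \<in> W"
        using Z by (auto simp: W_def module_vec_simps)
      show "v \<oplus>\<^bsub>module_vec TYPE(complex) n\<^esub> w \<in> W" if "v \<in> W" "w \<in> W" for v w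
        using that Z by (auto simp: W_def module_vec_simps mult_add_distrib_mat_vec smult_add_distrib_vec)
      show "a \<odot>\<^bsub>module_vec TYPE(complex) n\<^esub> v \<in> W" if "a \<in> carrier class_ring" "v \<in> W" for a v
        using that Z by (auto simp: W_def module_vec_simps mult_mat_vec smult_smult_assoc mult.commute)
    qed
  qed
  moreover have "\<forall>g\<in>carrier G. \<forall>w\<in>W. \<rho> g *\<^sub>v w \<in> W"
  proof (intro ballI)
    fix g w assume g: "g \<in> carrier G" and w: "w \<in> W"
    have "mat_of n (embed n (\<rho> g) * z) = mat_of n (z * embed n (\<rho> g))"
      using comm[OF g] by simp
    then have eq: "\<rho> g * Z = Z * \<rho> g"
      using \<rho>[OF g] z by (simp add: mat_of_mult Z_def)
    have "Z *\<^sub>v (\<rho> g *\<^sub>v w) = (Z * \<rho> g) *\<^sub>v w"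
      using Z \<rho>[OF g] w by (simp add: W_def assoc_mult_mat_vec[of _ n n _ n])
    also have "\<dots> = \<rho> g *\<^sub>v (Z *\<^sub>v w)"
      using Z \<rho>[OF g] w by (simp add: W_def assoc_mult_mat_vec[of _ n n _ n] flip: eq)
    also have "\<dots> = c \<cdot>\<^sub>v (\<rho> g *\<^sub>v w)"
      using \<rho>[OF g] w by (auto simp: W_def mult_mat_vec[of _ n n])
    finally show "\<rho> g *\<^sub>v w \<in> W"
      using \<rho>[OF g] w by (auto simp: W_def)
  qed
  ultimately have "W = {0\<^sub>v n} \<or> W = carrier_vec n"
    using irr by (auto simp: irreducible_rep_def)
  moreover have "v \<in> W" using v by (simp add: W_def)
  ultimately have W: "W = carrier_vec n" using v(2) by auto
  have "Z = c \<cdot>\<^sub>m 1\<^sub>m n"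
  proof (rule eq_matI)
    fix i j assume "i < dim_row (c \<cdot>\<^sub>m 1\<^sub>m n)" "j < dim_col (c \<cdot>\<^sub>m (1\<^sub>m n :: complex mat))"
    then have ij: "i < n" "j < n" by auto
    have "unit_vec n j \<in> W" using W by simp
    then have "(Z *\<^sub>v unit_vec n j) $ i = (c \<cdot>\<^sub>v unit_vec n j) $ i"
      by (simp add: W_def)
    then show "Z $$ (i, j) = (c \<cdot>\<^sub>m 1\<^sub>m n) $$ (i, j)"
      using ij Z by (simp add: mult_mat_vec_def)
  qed (use Z in auto)
  then have "embed n Z = smul c (unit_mat n)"
    by (intro fmat_eqI) (auto simp: entry_embed entry_unit_mat)
  then show ?thesis using z by (auto simp: Z_def)
qed

section \<open>Chief factors of finite groups\<close>

context group
begin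

lemma inv_cancel:
  assumes "x \<in> carrier G" "y \<in> carrier G"
  shows "x \<otimes> (inv x \<otimes> y) = y" "inv x \<otimes> (x \<otimes> y) = y"
  using assms by (simp_all flip: m_assoc)

lemma conj_inv_cancel:
  assumes "x \<in> carrier G" "y \<in> carrier G"
  shows "x \<otimes> (inv x \<otimes> y \<otimes> x) \<otimes> inv x = y" "inv x \<otimes> (x \<otimes> y \<otimes> inv x) \<otimes> x = y"
  using assms by (simp_all add: m_assoc inv_cancel)

end

text \<open>
  A set of representatives for the cosets of \<open>N\<close> in \<open>M\<close>, together with what it is used for: sums of
  functions that are constant on cosets. Dividing by \<open>card N\<close> would destroy the integrality of such a sum, whereas
  summing over representatives does not.
\<close>

lemma (in group) sum_transversal:
  assumes N: "subgroup N G" and M: "subgroup M G" and NM: "N \<subseteq> M" and fin: "finite M"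
  shows "\<exists>R\<subseteq>M. card M = card N * card R \<and>
    (\<forall>F :: 'a \<Rightarrow> complex. (\<forall>m\<in>M. \<forall>k\<in>N. F (m \<otimes> k) = F m) \<longrightarrow> sum F M = of_nat (card N) * sum F R)"
proof -
  define rep where "rep m = (SOME x. x \<in> M \<and> inv m \<otimes> x \<in> N)" for m
  have Mc: "m \<in> carrier G" if "m \<in> M" for m using M that by (rule subgroup.mem_carrier)
  have Nc: "m \<in> carrier G" if "m \<in> N" for m using N that by (rule subgroup.mem_carrier)
  note Mm = subgroup.m_closed[OF M] and Nm = subgroup.m_closed[OF N]
  note Mi = subgroup.m_inv_closed[OF M] and Ni = subgroup.m_inv_closed[OF N]
  have rep: "rep m \<in> M" "inv m \<otimes> rep m \<in> N" if "m \<in> M" for m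
  proof -
    have "m \<in> M \<and> inv m \<otimes> m \<in> N" using that Mc[OF that] subgroup.one_closed[OF N] by simp
    then have "rep m \<in> M \<and> inv m \<otimes> rep m \<in> N"
      unfolding rep_def by (rule someI)
    then show "rep m \<in> M" "inv m \<otimes> rep m \<in> N" by simp_all
  qed
  have rep_eq: "rep m = rep m'" if m: "m \<in> M" "m' \<in> M" "inv m \<otimes> m' \<in> N" for m m'
  proof -
    have "inv m \<otimes> x \<in> N \<longleftrightarrow> inv m' \<otimes> x \<in> N" if x: "x \<in> M" for x
    proof -
      note c = Mc[OF m(1)] Mc[OF m(2)] Mc[OF x]
      have "inv m \<otimes> x = (inv m \<otimes> m') \<otimes> (inv m' \<otimes> x)"
        using c by (simp add: m_assoc inv_cancel)
      moreover have "inv m' \<otimes> x = inv (inv m \<otimes> m') \<otimes> (inv m \<otimes> x)"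
        using c by (simp add: inv_mult_group m_assoc inv_cancel)
      ultimately show ?thesis
        using m(3) Nm Ni by metis
    qed
    then show ?thesis unfolding rep_def by metis
  qed
  define R where "R = rep ` M"
  have RM: "R \<subseteq> M" using rep by (auto simp: R_def)
  have rep_R: "rep x = x" if xR: "x \<in> R" for x
  proof -
    obtain m where m: "m \<in> M" "x = rep m" using xR by (auto simp: R_def)
    show ?thesis using rep_eq[OF m(1) rep[OF m(1)]] m(2) by simp
  qed
  have bij: "bij_betw (\<lambda>(x, k). x \<otimes> k) (R \<times> N) M"
  proof (rule bij_betwI[where g = "\<lambda>m. (rep m, inv (rep m) \<otimes> m)"])
    show "(\<lambda>(x, k). x \<otimes> k) \<in> R \<times> N \<rightarrow> M"
      using RM NM Mm by auto
    show "(\<lambda>m. (rep m, inv (rep m) \<otimes> m)) \<in> M \<rightarrow> R \<times> N"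
    proof
      fix m assume m: "m \<in> M"
      have "inv (inv m \<otimes> rep m) \<in> N" using rep[OF m] Ni by blast
      then show "(rep m, inv (rep m) \<otimes> m) \<in> R \<times> N"
        using m rep[OF m] Mc by (auto simp: R_def inv_mult_group)
    qed
    show "(\<lambda>m. (rep m, inv (rep m) \<otimes> m)) ((\<lambda>(x, k). x \<otimes> k) p) = p" if pR: "p \<in> R \<times> N" for p
    proof -
      obtain x k where p: "p = (x, k)" "x \<in> R" "k \<in> N" using pR by auto
      have x: "x \<in> M" using p RM by auto
      have "rep (x \<otimes> k) = rep x"
        by (rule rep_eq[symmetric]) (use x p Mc[OF x] Nc NM Mm in \<open>auto simp: inv_cancel\<close>)
      then show ?thesis using p rep_R[OF p(2)] Mc[OF x] Nc[OF p(3)] by (simp add: inv_cancel)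
    qed
    show "(\<lambda>(x, k). x \<otimes> k) (rep m, inv (rep m) \<otimes> m) = m" if "m \<in> M" for m
      using rep[OF that] Mc that by (simp add: inv_cancel)
  qed
  have "card M = card (R \<times> N)" using bij_betw_same_card[OF bij] by simp
  then have "card M = card N * card R" by (simp add: card_cartesian_product)
  moreover have "sum F M = of_nat (card N) * sum F R"
    if F: "\<forall>m\<in>M. \<forall>k\<in>N. F (m \<otimes> k) = F m" for F :: "'a \<Rightarrow> complex"
  proof -
    have "sum F M = (\<Sum>p\<in>R \<times> N. F ((\<lambda>(x, k). x \<otimes> k) p))"
      by (rule sum.reindex_bij_betw[OF bij, symmetric])
    also have "\<dots> = (\<Sum>x\<in>R. \<Sum>k\<in>N. F (x \<otimes> k))"
      by (simp add: sum.cartesian_product split_beta)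
    also have "\<dots> = (\<Sum>x\<in>R. \<Sum>k\<in>N. F x)"
      using F RM by (intro sum.cong refl) auto
    finally show ?thesis by (simp add: sum_distrib_left)
  qed
  ultimately show ?thesis using RM by blast
qed

text \<open>
  The class equation: outside the centre the conjugacy classes have order divisible by \<open>q\<close>, and so has the
  group; therefore the identity cannot be the only central element.
\<close>

lemma (in group) prime_power_order_center:
  assumes q: "prime q" and ord: "Coset.order G = q ^ Suc l"
  shows "\<exists>z\<in>carrier G. z \<noteq> \<one> \<and> (\<forall>x\<in>carrier G. z \<otimes> x = x \<otimes> z)"
proof (rule ccontr)
  assume contr: "\<not> ?thesis"
  define \<phi> where "\<phi> = (\<lambda>g. \<lambda>h\<in>carrier G. g \<otimes> h \<otimes> inv g)"
  interpret A: group_action G "carrier G" \<phi>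
    unfolding \<phi>_def by (rule action_by_conjugation)
  let ?O = "orbits G (carrier G) \<phi>"
  have "Coset.order G > 0" using q by (simp add: ord prime_gt_0_nat)
  then have fin: "finite (carrier G)" by (simp add: order_gt_0_iff_finite)
  interpret P: partition "carrier G" ?O by (rule A.orbit_partition)
  have orb_self: "x \<in> orbit G \<phi> x" if "x \<in> carrier G" for x
    using A.orbit_refl[OF that] .
  have UO: "\<Union> ?O = carrier G"
    using P.unique_class P.incl by blast
  have finO: "finite ?O" using fin UO by (simp add: finite_UnionD)
  have "card (\<Union> ?O) = sum card ?O"
  proof (rule card_Union_disjoint)
    show "pairwise disjnt ?O"
    proof (rule pairwiseI)
      fix a b assume ab: "a \<in> ?O" "b \<in> ?O" "a \<noteq> b"
      have "x \<notin> b" if "x \<in> a" for x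
        using P.unique_class[of x] P.incl[OF ab(1)] that ab by blast
      then show "disjnt a b" by (auto simp: disjnt_def)
    qed
    show "finite a" if "a \<in> ?O" for a using P.incl[OF that] fin by (rule finite_subset)
  qed
  then have cardG: "sum card ?O = Coset.order G" by (simp add: UO Coset.order_def)
  have orb1: "orbit G \<phi> \<one> = {\<one>}"
  proof
    show "orbit G \<phi> \<one> \<subseteq> {\<one>}" by (auto simp: orbit_def \<phi>_def)
    show "{\<one>} \<subseteq> orbit G \<phi> \<one>" using orb_self[OF one_closed] by simp
  qed
  have one_O: "{\<one>} \<in> ?O" unfolding orbits_def using orb1 by auto
  have "q dvd card a" if a: "a \<in> ?O - {{\<one>}}" for a
  proof -
    obtain x where x: "x \<in> carrier G" "a = orbit G \<phi> x" using a by (auto simp: orbits_def)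
    have x1: "x \<noteq> \<one>" using a x orb1 by auto
    have "card a dvd q ^ Suc l"
      using A.orbit_stabilizer_theorem[OF x(1)] by (metis dvd_triv_left ord x(2))
    then obtain j where j: "card a = q ^ j" using divides_primepow_nat[OF q] by blast
    have "j \<noteq> 0"
    proof
      assume "j = 0"
      then have "card a = 1" using j by simp
      then obtain y where "a = {y}" by (auto simp: card_1_singleton_iff)
      then have ax: "a = {x}" using orb_self[OF x(1)] x by auto
      have "x \<otimes> g = g \<otimes> x" if g: "g \<in> carrier G" for g
      proof -
        have "\<phi> g x \<in> a" using g x by (auto simp: orbit_def)
        then have "g \<otimes> x \<otimes> inv g = x" using ax x by (simp add: \<phi>_def)
        then have "g \<otimes> x \<otimes> inv g \<otimes> g = x \<otimes> g" by simp
        then show ?thesis using g x by (simp add: m_assoc)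
      qed
      then show False using contr x(1) x1 by blast
    qed
    then show ?thesis using j by (cases j) auto
  qed
  then have "q dvd sum card (?O - {{\<one>}})" by (rule dvd_sum)
  moreover have "sum card ?O = 1 + sum card (?O - {{\<one>}})"
    using sum.remove[OF finO one_O, of card] by simp
  then have "1 + sum card (?O - {{\<one>}}) = q ^ Suc l" using cardG ord by simp
  ultimately have "q dvd 1" by (metis dvd_add_left_iff dvd_triv_left power_Suc)
  then show False using q by (simp add: prime_nat_iff)
qed

lemma (in group) order_Mod:
  assumes N: "N \<lhd> G" and M: "subgroup M G" and NM: "N \<subseteq> M"
  shows "Coset.order (G\<lparr>carrier := M\<rparr> Mod N) * card N = card M"
    and "group (G\<lparr>carrier := M\<rparr> Mod N)"
proof -
  have gM: "group (G\<lparr>carrier := M\<rparr>)" by (rule subgroup_imp_group[OF M])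
  have NnM: "N \<lhd> G\<lparr>carrier := M\<rparr>"
    using normal_restrict_supergroup[OF M N NM] .
  show "group (G\<lparr>carrier := M\<rparr> Mod N)" by (rule normal.factorgroup_is_group[OF NnM])
  have "card (rcosets\<^bsub>G\<lparr>carrier := M\<rparr>\<^esub> N) * card N = Coset.order (G\<lparr>carrier := M\<rparr>)"
    by (rule group.lagrange[OF gM normal_imp_subgroup[OF NnM]])
  then show "Coset.order (G\<lparr>carrier := M\<rparr> Mod N) * card N = card M"
    by (simp add: Coset.order_def FactGroup_def)
qed

lemma (in group) order_Mod_set_mult:
  assumes H: "H \<lhd> G" and S: "subgroup S G"
  shows "Coset.order (G\<lparr>carrier := S\<rparr> Mod (H \<inter> S)) = Coset.order (G\<lparr>carrier := H <#> S\<rparr> Mod H)"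
proof -
  interpret second_isomorphism_grp H G S
    using H S by (simp add: second_isomorphism_grp_def second_isomorphism_grp_axioms_def)
  show ?thesis
    using normal_intersection_quotient_isom by (metis iso_same_card is_isoI Coset.order_def)
qed

text \<open>
  The preimage in \<open>M\<close> of the centre of the \<open>q\<close>-group \<open>M / N\<close> is normal in \<open>G\<close> and larger than \<open>N\<close>. By
  minimality it is \<open>M\<close>.
\<close>

lemma (in group) abelian_quotient_of_minimal:
  assumes N: "N \<lhd> G" and M: "M \<lhd> G" and NM: "N \<subset> M" and fin: "finite (carrier G)"
    and min: "\<And>L. L \<lhd> G \<Longrightarrow> N \<subseteq> L \<Longrightarrow> L \<subseteq> M \<Longrightarrow> L = N \<or> L = M"
    and q: "prime q" and ord: "Coset.order (G\<lparr>carrier := M\<rparr> Mod N) = q ^ k"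
    and ab: "a \<in> M" "b \<in> M"
  shows "a \<otimes> b \<otimes> inv a \<otimes> inv b \<in> N"
proof -
  note sN = normal_imp_subgroup[OF N] and sM = normal_imp_subgroup[OF M]
  have Mc: "x \<in> carrier G" if "x \<in> M" for x by (rule subgroup.mem_carrier[OF sM that])
  have Nc: "x \<in> carrier G" if "x \<in> N" for x by (rule subgroup.mem_carrier[OF sN that])
  let ?Q = "G\<lparr>carrier := M\<rparr> Mod N"
  note Q = order_Mod[OF N sM psubset_imp_subset[OF NM]]
  have finM: "finite M" using fin Mc by (meson finite_subset subsetI)
  have "k \<noteq> 0"
  proof
    assume "k = 0"
    then have "card N = card M" using Q(1) ord by simp
    then show False using NM finM by (metis card_subset_eq psubset_eq)
  qed
  then obtain l where l: "Coset.order ?Q = q ^ Suc l" using ord by (cases k) auto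
  have coset_mult: "(N #>\<^bsub>G\<lparr>carrier := M\<rparr>\<^esub> x) \<otimes>\<^bsub>?Q\<^esub> (N #>\<^bsub>G\<lparr>carrier := M\<rparr>\<^esub> y) = N #> (x \<otimes> y)"
    if "x \<in> M" "y \<in> M" for x y
    using normal.rcos_sum[OF N Mc[OF that(1)] Mc[OF that(2)]]
    by (simp add: FactGroup_def r_coset_def set_mult_def)
  have coset_comm: "x \<otimes> y \<otimes> inv x \<otimes> inv y \<in> N"
    if "x \<in> M" "y \<in> M" "N #> (x \<otimes> y) = N #> (y \<otimes> x)" for x y
  proof -
    note c = Mc[OF that(1)] Mc[OF that(2)]
    have "x \<otimes> y \<in> N #> (y \<otimes> x)"
      using rcos_self[OF _ sN, of "x \<otimes> y"] c that(3) by simp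
    then obtain h where h: "h \<in> N" "x \<otimes> y = h \<otimes> (y \<otimes> x)" by (auto simp: r_coset_def)
    have "x \<otimes> y \<otimes> inv x \<otimes> inv y = h"
      using c Nc[OF h(1)] by (simp add: h(2)) (simp add: m_assoc inv_cancel)
    then show ?thesis using h by simp
  qed
  obtain Z where Z: "Z \<in> carrier ?Q" "Z \<noteq> \<one>\<^bsub>?Q\<^esub>"
    and Zc: "\<And>X. X \<in> carrier ?Q \<Longrightarrow> Z \<otimes>\<^bsub>?Q\<^esub> X = X \<otimes>\<^bsub>?Q\<^esub> Z"
    using group.prime_power_order_center[OF Q(2) q l] by blast
  obtain z where z: "z \<in> M" "Z = N #>\<^bsub>G\<lparr>carrier := M\<rparr>\<^esub> z"
    using Z(1) by (auto simp: FactGroup_def RCOSETS_def)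
  have zN: "z \<notin> N"
  proof
    assume "z \<in> N"
    then have "N #> z = N" using coset_join2[OF Mc[OF z(1)] sN] by simp
    then show False using Z(2) z(2) by (simp add: FactGroup_def r_coset_def)
  qed
  \<comment> \<open>The preimage of the centre, described by commutators so that no coset occurs in what follows.\<close>
  define L where "L = {x \<in> M. \<forall>y\<in>M. x \<otimes> y \<otimes> inv x \<otimes> inv y \<in> N}"
  have LM: "L \<subseteq> M" by (auto simp: L_def)
  have LD: "x \<otimes> y \<otimes> inv x \<otimes> inv y \<in> N" if "x \<in> L" "y \<in> M" for x y
    using that by (simp add: L_def)
  note Nm = subgroup.m_closed[OF sN] and Ni = subgroup.m_inv_closed[OF sN]
  note Mm = subgroup.m_closed[OF sM] and Mi = subgroup.m_inv_closed[OF sM]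
  note Nconj = normal.inv_op_closed2[OF N] and Nconj' = normal.inv_op_closed1[OF N]
  note Mconj = normal.inv_op_closed2[OF M] and Mconj' = normal.inv_op_closed1[OF M]
  have zL: "z \<in> L"
  proof -
    have "z \<otimes> y \<otimes> inv z \<otimes> inv y \<in> N" if y: "y \<in> M" for y
    proof (rule coset_comm[OF z(1) y])
      have "N #>\<^bsub>G\<lparr>carrier := M\<rparr>\<^esub> y \<in> carrier ?Q"
        using y by (auto simp: FactGroup_def RCOSETS_def)
      from Zc[OF this] show "N #> (z \<otimes> y) = N #> (y \<otimes> z)"
        unfolding z(2) coset_mult[OF z(1) y] coset_mult[OF y z(1)] .
    qed
    then show ?thesis using z by (simp add: L_def)
  qed
  have NL: "N \<subseteq> L"
  proof
    fix x assume x: "x \<in> N"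
    have xM: "x \<in> M" using x NM by blast
    have "x \<otimes> y \<otimes> inv x \<otimes> inv y \<in> N" if y: "y \<in> M" for y
    proof -
      have "x \<otimes> (y \<otimes> inv x \<otimes> inv y) \<in> N" using Nm[OF x Nconj[OF Mc[OF y] Ni[OF x]]] .
      then show ?thesis using Mc[OF xM] Mc[OF y] by (simp add: m_assoc)
    qed
    then show "x \<in> L" using xM by (simp add: L_def)
  qed
  have "L \<lhd> G"
  proof (rule normal_invI)
    show "subgroup L G"
    proof (rule subgroupI)
      show "L \<subseteq> carrier G" using LM Mc by blast
      show "L \<noteq> {}" using zL by blast
      fix x assume x: "x \<in> L"
      have xM: "x \<in> M" using x LM by blast
      show "inv x \<in> L"
      proof -
        have "inv x \<otimes> y \<otimes> inv (inv x) \<otimes> inv y \<in> N" if y: "y \<in> M" for y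
        proof -
          have "inv x \<otimes> inv (x \<otimes> y \<otimes> inv x \<otimes> inv y) \<otimes> x \<in> N"
            by (rule Nconj'[OF Mc[OF xM] Ni[OF LD[OF x y]]])
          moreover have "inv x \<otimes> y \<otimes> inv (inv x) \<otimes> inv y = inv x \<otimes> inv (x \<otimes> y \<otimes> inv x \<otimes> inv y) \<otimes> x"
            using Mc[OF xM] Mc[OF y] by (simp add: inv_mult_group m_assoc inv_cancel)
          ultimately show ?thesis by simp
        qed
        then show ?thesis using Mi[OF xM] by (simp add: L_def)
      qed
      fix x' assume x': "x' \<in> L"
      have xM': "x' \<in> M" using x' LM by blast
      show "x \<otimes> x' \<in> L"
      proof -
        have "x \<otimes> x' \<otimes> y \<otimes> inv (x \<otimes> x') \<otimes> inv y \<in> N" if y: "y \<in> M" for y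
        proof -
          have "(x \<otimes> (x' \<otimes> y \<otimes> inv x' \<otimes> inv y) \<otimes> inv x) \<otimes> (x \<otimes> y \<otimes> inv x \<otimes> inv y) \<in> N"
            by (rule Nm[OF Nconj[OF Mc[OF xM] LD[OF x' y]] LD[OF x y]])
          moreover have "x \<otimes> x' \<otimes> y \<otimes> inv (x \<otimes> x') \<otimes> inv y
              = (x \<otimes> (x' \<otimes> y \<otimes> inv x' \<otimes> inv y) \<otimes> inv x) \<otimes> (x \<otimes> y \<otimes> inv x \<otimes> inv y)"
            using Mc[OF xM] Mc[OF xM'] Mc[OF y] by (simp add: inv_mult_group m_assoc inv_cancel)
          ultimately show ?thesis by simp
        qed
        then show ?thesis using Mm[OF xM xM'] by (simp add: L_def)
      qed
    qed
    fix g x assume g: "g \<in> carrier G" and x: "x \<in> L"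
    have xM: "x \<in> M" using x LM by blast
    have "g \<otimes> x \<otimes> inv g \<otimes> y \<otimes> inv (g \<otimes> x \<otimes> inv g) \<otimes> inv y \<in> N" if y: "y \<in> M" for y
    proof -
      define y' where "y' = inv g \<otimes> y \<otimes> g"
      have y': "y' \<in> M" unfolding y'_def by (rule Mconj'[OF g y])
      have "g \<otimes> (x \<otimes> y' \<otimes> inv x \<otimes> inv y') \<otimes> inv g \<in> N"
        by (rule Nconj[OF g LD[OF x y']])
      moreover have "g \<otimes> x \<otimes> inv g \<otimes> y \<otimes> inv (g \<otimes> x \<otimes> inv g) \<otimes> inv y
          = g \<otimes> (x \<otimes> y' \<otimes> inv x \<otimes> inv y') \<otimes> inv g"
        using g Mc[OF xM] Mc[OF y] by (simp add: y'_def inv_mult_group m_assoc inv_cancel)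
      ultimately show ?thesis by simp
    qed
    then show "g \<otimes> x \<otimes> inv g \<in> L" using Mconj[OF g xM] by (simp add: L_def)
  qed
  then have "L = M" using min NL LM zL zN by blast
  then show ?thesis using ab by (auto simp: L_def)
qed

text \<open>
  A chief factor is a section of a factor of any normal series. With \<open>X = B \<inter> M\<close>, minimality gives
  \<open>M = N X\<close>, so that \<open>M / N\<close> is isomorphic to \<open>X / (N \<inter> X)\<close>. This is a quotient of \<open>X / (A \<inter> X)\<close>, which
  is isomorphic to the subgroup \<open>A X / A\<close> of \<open>B / A\<close>.
\<close>

lemma (in group) chief_factor_order_dvd:
  assumes fin: "finite (carrier G)" and N: "N \<lhd> G" and M: "M \<lhd> G" and NM: "N \<subset> M"
    and min: "\<And>L. L \<lhd> G \<Longrightarrow> N \<subseteq> L \<Longrightarrow> L \<subseteq> M \<Longrightarrow> L = N \<or> L = M"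
    and A: "A \<lhd> G" and B: "B \<lhd> G" and AB: "A \<subseteq> B"
    and AN: "A \<inter> M \<subseteq> N" and BN: "\<not> B \<inter> M \<subseteq> N"
  shows "Coset.order (G\<lparr>carrier := M\<rparr> Mod N) dvd Coset.order (G\<lparr>carrier := B\<rparr> Mod A)"
proof -
  define X where "X = B \<inter> M"
  have X: "X \<lhd> G" unfolding X_def by (rule normal_subgroup_intersect[OF B M])
  note sub = normal_imp_subgroup
  have pos: "card H > 0" if "subgroup H G" for H
    using that fin by (metis card_gt_0_iff finite_subset subgroup.subset subgroup_nonempty)
  have NX: "N <#> X = M"
  proof -
    have n: "N <#> X \<lhd> G" by (rule normal_subgroup_set_mult_closed[OF N X])
    have "x \<in> N <#> X" if "x \<in> N" for x
      using that subgroup.one_closed[OF sub[OF X]] subgroup.mem_carrier[OF sub[OF N] that]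
      unfolding set_mult_def by force
    moreover have XNX: "x \<in> N <#> X" if "x \<in> X" for x
      using that subgroup.one_closed[OF sub[OF N]] subgroup.mem_carrier[OF sub[OF X] that]
      unfolding set_mult_def by force
    moreover have "N <#> X \<subseteq> M"
      using NM subgroup.m_closed[OF sub[OF M]] by (auto simp: set_mult_def X_def)
    ultimately have "N <#> X = N \<or> N <#> X = M" using min[OF n] by blast
    then show ?thesis using XNX BN by (auto simp: X_def)
  qed
  have AX: "subgroup (A <#> X) G" by (rule sub[OF normal_subgroup_set_mult_closed[OF A X]])
  have A_AX: "A \<subseteq> A <#> X"
  proof
    fix x assume "x \<in> A"
    then show "x \<in> A <#> X"
      using subgroup.one_closed[OF sub[OF X]] subgroup.mem_carrier[OF sub[OF A]]
      unfolding set_mult_def by force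
  qed
  have AX_B: "A <#> X \<subseteq> B"
    using AB subgroup.m_closed[OF sub[OF B]] by (auto simp: set_mult_def X_def)
  have NX': "N \<inter> X \<lhd> G" and AX': "A \<inter> X \<lhd> G"
    by (simp_all add: normal_subgroup_intersect N A X)
  have AN': "A \<inter> X \<subseteq> N \<inter> X" using AN by (auto simp: X_def)
  let ?u = "Coset.order (G\<lparr>carrier := M\<rparr> Mod N)"
  let ?v = "Coset.order (G\<lparr>carrier := A <#> X\<rparr> Mod A)"
  have u: "?u * card (N \<inter> X) = card X"
    using order_Mod(1)[OF NX' sub[OF X]] order_Mod_set_mult[OF N sub[OF X]] NX by simp
  have v: "?v * card (A \<inter> X) = card X"
    using order_Mod(1)[OF AX' sub[OF X]] order_Mod_set_mult[OF A sub[OF X]] by simp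
  obtain w where w: "card (N \<inter> X) = w * card (A \<inter> X)"
    using order_Mod(1)[OF AX' sub[OF NX'] AN'] by metis
  have "?u * w * card (A \<inter> X) = ?v * card (A \<inter> X)" using u v w by simp
  then have "?u * w = ?v" using pos[OF sub[OF AX']] by simp
  moreover have "?v dvd Coset.order (G\<lparr>carrier := B\<rparr> Mod A)"
  proof -
    have "card (A <#> X) dvd card B"
      using sum_transversal[OF AX sub[OF B] AX_B finite_subset[OF subgroup.subset[OF sub[OF B]] fin]]
      by (metis dvd_triv_left)
    then have "?v * card A dvd Coset.order (G\<lparr>carrier := B\<rparr> Mod A) * card A"
      using order_Mod(1)[OF A AX A_AX] order_Mod(1)[OF A sub[OF B] AB] by simp
    then show ?thesis using pos[OF sub[OF A]] by simp
  qed
  ultimately show ?thesis by (metis dvd_mult_left)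
qed

text \<open>
  If a prime \<open>q\<close> divides both \<open>n\<close> and the order of a chief factor, that order divides the order of a factor
  of the \<open>q\<close>-solvable series, and that factor can only be a \<open>q\<close>-group.
\<close>

lemma (in group) chief_factor_coprime_or_abelian:
  assumes fin: "finite (carrier G)" and N: "N \<lhd> G" and NG: "N \<noteq> carrier G" and n: "n > 0"
    and solv: "\<And>p. p \<in> prime_factors n \<Longrightarrow> p_solvable p G"
  shows "\<exists>M. M \<lhd> G \<and> N \<subset> M \<and>
    (coprime (card M div card N) n \<or> (\<forall>a\<in>M. \<forall>b\<in>M. a \<otimes> b \<otimes> inv a \<otimes> inv b \<in> N))"
proof -
  note sub = normal_imp_subgroup
  have G: "carrier G \<lhd> G" by (rule normal_invI[OF subgroup_self]) simp
  define P where "P M \<longleftrightarrow> M \<lhd> G \<and> N \<subset> M" for M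
  have "P (carrier G)" using G N NG subgroup.subset[OF sub[OF N]] by (auto simp: P_def)
  then obtain M where PM: "P M" and least: "\<And>L. P L \<Longrightarrow> card M \<le> card L"
    using arg_min_nat_lemma[of P "carrier G" card] by blast
  have M: "M \<lhd> G" and NM: "N \<subset> M" using PM by (auto simp: P_def)
  have finM: "finite M" using fin subgroup.subset[OF sub[OF M]] finite_subset by blast
  have min: "L = N \<or> L = M" if L: "L \<lhd> G" "N \<subseteq> L" "L \<subseteq> M" for L
  proof (cases "L = N")
    case False
    then have "card M \<le> card L" using L by (intro least) (auto simp: P_def)
    then show ?thesis using L(3) finM by (metis card_seteq)
  qed simp
  have "card N > 0"
    using finM NM subgroup.one_closed[OF sub[OF N]] by (metis card_gt_0_iff empty_iff finite_subset psubset_imp_subset)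
  then have ord: "card M div card N = Coset.order (G\<lparr>carrier := M\<rparr> Mod N)"
    using order_Mod(1)[OF N sub[OF M] psubset_imp_subset[OF NM]] by (metis nonzero_mult_div_cancel_right less_irrefl)
  show ?thesis
  proof (cases "coprime (card M div card N) n")
    case True
    then show ?thesis using M NM by blast
  next
    case False
    then have "gcd (card M div card N) n \<noteq> 1" by (simp add: coprime_iff_gcd_eq_1)
    then obtain q where "prime q" "q dvd gcd (card M div card N) n"
      using prime_factor_nat by blast
    then have q: "prime q" "q dvd Coset.order (G\<lparr>carrier := M\<rparr> Mod N)" "q dvd n"
      by (simp_all add: ord)
    have "p_solvable q G" using n q by (intro solv) (simp add: prime_factors_dvd)
    then obtain L m where L: "L 0 = {\<one>}" "L m = carrier G" "\<forall>i\<le>m. L i \<lhd> G"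
      and Li: "\<And>i. i < m \<Longrightarrow> L i \<subseteq> L (Suc i) \<and>
        ((\<exists>k. Coset.order (G\<lparr>carrier := L (Suc i)\<rparr> Mod L i) = q ^ k) \<or>
         \<not> q dvd Coset.order (G\<lparr>carrier := L (Suc i)\<rparr> Mod L i))"
      unfolding p_solvable_def by blast
    \<comment> \<open>The first term of the series that meets \<open>M\<close> outside \<open>N\<close>; the factor below it covers \<open>M / N\<close>.\<close>
    define i where "i = (LEAST i. \<not> L i \<inter> M \<subseteq> N)"
    have Lm: "\<not> L m \<inter> M \<subseteq> N"
      using NM subgroup.subset[OF sub[OF M]] L(2) by auto
    then have i: "\<not> L i \<inter> M \<subseteq> N" unfolding i_def by (rule LeastI)
    have im: "i \<le> m" unfolding i_def using Lm by (rule Least_le)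
    have "i \<noteq> 0"
      using i L(1) subgroup.one_closed[OF sub[OF N]] by (metis Int_lower1 empty_subsetI insert_subset order_trans)
    then obtain j where j: "i = Suc j" by (cases i) auto
    have Lj: "L j \<inter> M \<subseteq> N"
      using not_less_Least[of j "\<lambda>i. \<not> L i \<inter> M \<subseteq> N"] j by (simp add: i_def)
    have jm: "j < m" using im j by simp
    have dvd: "Coset.order (G\<lparr>carrier := M\<rparr> Mod N) dvd Coset.order (G\<lparr>carrier := L (Suc j)\<rparr> Mod L j)"
    proof (rule chief_factor_order_dvd[OF fin N M NM min])
      show "L j \<lhd> G" "L (Suc j) \<lhd> G" using L(3) jm by auto
      show "L j \<subseteq> L (Suc j)" using Li[OF jm] by blast
      show "L j \<inter> M \<subseteq> N" by (rule Lj)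
      show "\<not> L (Suc j) \<inter> M \<subseteq> N" using i j by simp
    qed
    then have "q dvd Coset.order (G\<lparr>carrier := L (Suc j)\<rparr> Mod L j)" using q dvd_trans by blast
    then obtain k where "Coset.order (G\<lparr>carrier := L (Suc j)\<rparr> Mod L j) = q ^ k" using Li[OF jm] by blast
    then obtain l where "Coset.order (G\<lparr>carrier := M\<rparr> Mod N) = q ^ l"
      using dvd divides_primepow_nat[OF q(1)] by metis
    then show ?thesis
      using abelian_quotient_of_minimal[OF N M NM fin min q(1)] M NM by blast
  qed
qed

section \<open>Representations and the adjoint\<close>

text \<open>
  A representation by matrices of size \<open>n\<close>, as elements of the corner.
\<close>

locale fin_rep = group G for G :: "('g, 'b) monoid_scheme" (structure) +
  fixes n :: nat and r :: "'g \<Rightarrow> nat fmat"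
  assumes fin: "finite (carrier G)" and n_pos: "n > 0"
    and r_corner [simp]: "g \<in> carrier G \<Longrightarrow> r g \<in> corner n"
    and r_mult: "g \<in> carrier G \<Longrightarrow> h \<in> carrier G \<Longrightarrow> r (g \<otimes> h) = r g * r h"
    and r_one [simp]: "r \<one> = unit_mat n"
begin

abbreviation e where "e \<equiv> unit_mat n"

definition t where "t x = tr x / of_nat n"

lemma t_add: "t (x + y) = t x + t y" by (simp add: t_def add_divide_distrib)
lemma t_diff: "t (x - y) = t x - t y" by (simp add: t_def diff_divide_distrib)
lemma t_smul [simp]: "t (smul c x) = c * t x" by (simp add: t_def)
lemma t_sum: "t (\<Sum>a\<in>A. f a) = (\<Sum>a\<in>A. t (f a))" by (simp add: t_def sum_divide_distrib)
lemma t_e [simp]: "t e = 1" using n_pos by (simp add: t_def)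
lemma t_commute: "t (x * y) = t (y * x)" by (simp add: t_def tr_commute)

lemma r_inv [simp]:
  assumes "g \<in> carrier G"
  shows "r g * r (inv g) = e" "r (inv g) * r g = e"
  using assms r_mult[of g "inv g"] r_mult[of "inv g" g] by simp_all

lemma r_inv_cancel [simp]:
  assumes "g \<in> carrier G" "x \<in> corner n"
  shows "r g * (r (inv g) * x) = x" "r (inv g) * (r g * x) = x"
  using assms by (simp_all flip: mult.assoc)

lemma e_neq_0: "e \<noteq> 0"
  using n_pos by (metis entry_unit_mat entry_zero zero_neq_one)

text \<open>
  The Gram matrix of an inner product that is invariant under \<open>G\<close>. With respect to it every \<open>r g\<close> is
  unitary, and \<open>dag\<close> is the adjoint.
\<close>

definition gram where "gram = (\<Sum>g\<in>carrier G. star (r g) * r g)"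

lemma gram_corner [simp]: "gram \<in> corner n"
  unfolding gram_def by (rule corner_sum) (simp add: corner_closed)

lemma star_gram [simp]: "star gram = gram"
  by (simp add: gram_def star_sum star_mult)

text \<open>
  An element that it annihilates has norm 0 for the invariant inner product, to which the summand of \<open>\<one>\<close> already contributes
  the square of its ordinary norm.
\<close>

lemma gram_invertible: "\<exists>K\<in>corner n. gram * K = e \<and> K * gram = e"
proof -
  have "x = 0" if x: "x \<in> corner n" and Hx: "gram * x = 0" for x
  proof -
    have "0 = tr (star x * (gram * x))" by (simp add: Hx)
    also have "\<dots> = tr (\<Sum>g\<in>carrier G. star x * (star (r g) * r g) * x)"
      by (simp add: gram_def sum_distrib_left sum_distrib_right mult.assoc)
    also have "\<dots> = (\<Sum>g\<in>carrier G. tr ((r g * x) * star (r g * x)))"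
      unfolding tr_sum
    proof (rule sum.cong[OF refl])
      fix g assume "g \<in> carrier G"
      have "star x * (star (r g) * r g) * x = star (r g * x) * (r g * x)"
        by (simp add: star_mult mult.assoc)
      then show "tr (star x * (star (r g) * r g) * x) = tr ((r g * x) * star (r g * x))"
        by (metis tr_commute)
    qed
    finally have "(\<Sum>g\<in>carrier G. Re (tr ((r g * x) * star (r g * x)))) = 0"
      by (metis Re_sum zero_complex.sel(1))
    then have "\<forall>g\<in>carrier G. Re (tr ((r g * x) * star (r g * x))) = 0"
      using fin by (subst (asm) sum_nonneg_eq_0_iff) (auto simp: tr_mult_star_nonneg)
    then have "Re (tr ((r \<one> * x) * star (r \<one> * x))) = 0" by blast
    then have "tr (x * star x) = 0"
      using x by (simp add: complex_eq_iff tr_mult_star_real)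
    then show "x = 0" by (simp add: tr_mult_star_eq_0_iff)
  qed
  then show ?thesis
    by (metis corner_invertible gram_corner)
qed

definition gram_inv where "gram_inv = (SOME K. K \<in> corner n \<and> gram * K = e \<and> K * gram = e)"

lemma gram_inv: "gram_inv \<in> corner n" "gram * gram_inv = e" "gram_inv * gram = e"
  using someI_ex[of "\<lambda>K. K \<in> corner n \<and> gram * K = e \<and> K * gram = e"] gram_invertible
  by (auto simp: gram_inv_def)

declare gram_inv [simp]

lemma gram_cancel [simp]: "x \<in> corner n \<Longrightarrow> gram * (gram_inv * x) = x" "x \<in> corner n \<Longrightarrow> gram_inv * (gram * x) = x"
  by (simp_all flip: mult.assoc)

lemma star_gram_inv [simp]: "star gram_inv = gram_inv"
proof -
  have "star gram_inv = star gram_inv * (gram * gram_inv)" by (simp add: corner_closed)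
  also have "\<dots> = star (gram * gram_inv) * gram_inv" by (simp only: star_mult star_gram mult.assoc)
  also have "\<dots> = gram_inv" by simp
  finally show ?thesis .
qed

definition dag where "dag x = gram_inv * star x * gram"

lemma dag_corner [simp]: "x \<in> corner n \<Longrightarrow> dag x \<in> corner n"
  by (simp add: dag_def corner_closed)

lemma dag_mult: "x \<in> corner n \<Longrightarrow> y \<in> corner n \<Longrightarrow> dag (x * y) = dag y * dag x"
  by (simp add: dag_def star_mult mult.assoc corner_closed)

lemma dag_add: "dag (x + y) = dag x + dag y"
  by (simp add: dag_def star_add distrib_left distrib_right)

lemma dag_zero [simp]: "dag 0 = 0"
  by (simp add: dag_def)

lemma dag_smul: "dag (smul c x) = smul (cnj c) (dag x)"
  by (simp add: dag_def star_smul)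

lemma dag_dag [simp]: "x \<in> corner n \<Longrightarrow> dag (dag x) = x"
  by (simp add: dag_def star_mult mult.assoc corner_closed)

lemma dag_e [simp]: "dag e = e"
  by (simp add: dag_def)

lemma t_dag: "x \<in> corner n \<Longrightarrow> t (dag x) = cnj (t x)"
proof -
  assume x: "x \<in> corner n"
  have "tr (dag x) = tr (star x * gram * gram_inv)"
    unfolding dag_def by (metis mult.assoc tr_commute)
  also have "\<dots> = tr (star x)" using x by (simp add: mult.assoc corner_closed)
  also have "\<dots> = cnj (tr x)" by (simp add: tr_def cnj_sum)
  finally show ?thesis by (simp add: t_def)
qed

lemma dag_r [simp]:
  assumes g: "g \<in> carrier G"
  shows "dag (r g) = r (inv g)"
proof -
  have "star (r g) * gram * r g = (\<Sum>h\<in>carrier G. star (r (h \<otimes> g)) * r (h \<otimes> g))"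
    using g by (simp add: gram_def sum_distrib_left sum_distrib_right r_mult star_mult mult.assoc)
  also have "\<dots> = gram"
    unfolding gram_def
    by (rule sum.reindex_bij_witness[of _ "\<lambda>h. h \<otimes> inv g" "\<lambda>h. h \<otimes> g"])
      (use g in \<open>auto simp: m_assoc\<close>)
  finally have *: "star (r g) * gram * r g = gram" .
  have "star (r g) * gram = star (r g) * gram * r g * r (inv g)"
    using g by (simp add: mult.assoc corner_closed)
  also have "\<dots> = gram * r (inv g)" by (simp add: *)
  finally show ?thesis
    using g by (simp add: dag_def mult.assoc)
qed

text \<open>
  The inverse of the Gram matrix is again a sum of terms \<open>star u * u\<close>. This turns the trace into a sum of
  traces of the form \<open>tr (y * star y)\<close>, one of which has \<open>y = x * gram_inv\<close>.
\<close>

lemma dag_pos: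
  assumes x: "x \<in> corner n"
  shows "Im (t (x * dag x)) = 0" "Re (t (x * dag x)) \<ge> 0" "t (x * dag x) = 0 \<Longrightarrow> x = 0"
proof -
  define u where "u g = r g * gram_inv" for g
  define y where "y g h = r h * x * star (u g)" for g h
  have Kdec: "gram_inv = (\<Sum>g\<in>carrier G. star (u g) * u g)"
  proof -
    have "gram_inv = gram_inv * gram * gram_inv" by simp
    also have "\<dots> = (\<Sum>g\<in>carrier G. star (u g) * u g)"
      unfolding gram_def u_def by (simp add: sum_distrib_left sum_distrib_right star_mult mult.assoc)
    finally show ?thesis .
  qed
  have "tr (x * dag x) = (\<Sum>h\<in>carrier G. \<Sum>g\<in>carrier G. tr (y g h * star (y g h)))"
  proof -
    have "x * dag x = x * (\<Sum>g\<in>carrier G. star (u g) * u g) * star x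
        * (\<Sum>h\<in>carrier G. star (r h) * r h)"
      by (simp add: dag_def mult.assoc flip: Kdec gram_def)
    also have "\<dots> = (\<Sum>h\<in>carrier G. \<Sum>g\<in>carrier G. x * (star (u g) * u g) * star x * (star (r h) * r h))"
      by (simp only: sum_distrib_left sum_distrib_right)
    finally have "tr (x * dag x) = (\<Sum>h\<in>carrier G. \<Sum>g\<in>carrier G.
        tr (x * (star (u g) * u g) * star x * (star (r h) * r h)))"
      by simp
    moreover have "tr (x * (star (u g) * u g) * star x * (star (r h) * r h)) = tr (y g h * star (y g h))" for g h
    proof -
      have "x * (star (u g) * u g) * star x * (star (r h) * r h) = (x * star (u g) * star (y g h)) * r h"
        by (simp add: y_def star_mult mult.assoc)
      moreover have "y g h * star (y g h) = r h * (x * star (u g) * star (y g h))"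
        by (simp add: y_def mult.assoc)
      ultimately show ?thesis by (metis tr_commute)
    qed
    ultimately show ?thesis by simp
  qed
  note tr_eq = this
  show "Im (t (x * dag x)) = 0"
    unfolding t_def tr_eq by (simp add: tr_mult_star_real)
  show "Re (t (x * dag x)) \<ge> 0"
    unfolding t_def tr_eq by (simp add: sum_nonneg tr_mult_star_nonneg)
  show "x = 0" if "t (x * dag x) = 0"
  proof -
    have "Re (tr (x * dag x)) = 0" using that n_pos by (simp add: t_def)
    then have "(\<Sum>h\<in>carrier G. \<Sum>g\<in>carrier G. Re (tr (y g h * star (y g h)))) = 0"
      unfolding tr_eq by simp
    then have "\<forall>h\<in>carrier G. \<forall>g\<in>carrier G. Re (tr (y g h * star (y g h))) = 0"
      using fin by (simp add: sum_nonneg_eq_0_iff tr_mult_star_nonneg sum_nonneg)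
    then have "Re (tr (y \<one> \<one> * star (y \<one> \<one>))) = 0" by blast
    then have "y \<one> \<one> = 0"
      using tr_mult_star_eq_0_iff[of "y \<one> \<one>"] by (simp add: complex_eq_iff tr_mult_star_real)
    then have "x * gram_inv = 0" using x by (simp add: y_def u_def star_mult)
    then have "x * gram_inv * gram = 0" by simp
    then show "x = 0" using x by (simp add: mult.assoc)
  qed
qed

lemma cdet_dag: "x \<in> corner n \<Longrightarrow> cdet n (dag x) = cnj (cdet n x)"
proof -
  assume x: "x \<in> corner n"
  have "cdet n gram_inv * cdet n gram = 1" using cdet_mult[of gram_inv n gram] by simp
  moreover have "cdet n (dag x) = cdet n gram_inv * cdet n (star x) * cdet n gram"
    using x by (simp add: dag_def cdet_mult corner_closed)
  ultimately show ?thesis by (simp add: cdet_star)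
qed

lemma norm_t_inv: "g \<in> carrier G \<Longrightarrow> t (r (inv g)) = cnj (t (r g))"
  using t_dag[of "r g"] by simp

end

lemma irreducible_rep_fin_rep:
  assumes H: "group H" and fin: "finite (carrier H)" and irr: "irreducible_rep H k \<sigma>"
  shows "fin_rep H k (\<lambda>h. embed k (\<sigma> h))"
proof -
  interpret H: group H by (rule H)
  interpret M: semiring "ring_mat TYPE(complex) k ()" by (rule semiring_mat)
  have hom: "\<sigma> \<in> hom H (GL k)" and k: "k > 0" using irr by (auto simp: irreducible_rep_def)
  have \<sigma>c: "\<sigma> h \<in> carrier_mat k k" if "h \<in> carrier H" for h
    using hom that by (auto simp: hom_def intro!: GL_carrier)
  have "group (GL k)" unfolding GL_def by (rule M.units_group)
  then have "\<sigma> \<one>\<^bsub>H\<^esub> = \<one>\<^bsub>GL k\<^esub>" using hom H by (meson hom_one)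
  then have one: "\<sigma> \<one>\<^bsub>H\<^esub> = 1\<^sub>m k" by (simp add: GL_def units_of_def ring_mat_def)
  have mult: "\<sigma> (g \<otimes>\<^bsub>H\<^esub> h) = \<sigma> g * \<sigma> h" if "g \<in> carrier H" "h \<in> carrier H" for g h
    using hom_mult[OF hom that] by (simp add: GL_def units_of_def ring_mat_def)
  show ?thesis
    by unfold_locales (auto simp: fin k one mult \<sigma>c embed_mult unit_mat_def)
qed

text \<open>
  The average commutes with the group, so Schur's lemma makes it a scalar, and the scalar is read off from the
  trace.
\<close>

lemma schur_average:
  assumes H: "group H" and fin: "finite (carrier H)" and irr: "irreducible_rep H k \<sigma>"
    and x: "x \<in> corner k"
  shows "(\<Sum>h\<in>carrier H. embed k (\<sigma> h) * x * embed k (\<sigma> (inv\<^bsub>H\<^esub> h)))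
    = smul (of_nat (card (carrier H)) * tr x / of_nat k) (unit_mat k)"
proof -
  define s where "s h = embed k (\<sigma> h)" for h
  interpret fin_rep H k s unfolding s_def by (rule irreducible_rep_fin_rep[OF H fin irr])
  define z where "z = (\<Sum>h\<in>carrier H. s h * x * s (inv\<^bsub>H\<^esub> h))"
  have zc: "z \<in> corner k"
    unfolding z_def using x by (intro corner_sum corner_closed) auto
  have "s g * z = z * s g" if g: "g \<in> carrier H" for g
  proof -
    have "s g * z * s (inv\<^bsub>H\<^esub> g) = (\<Sum>h\<in>carrier H. s (g \<otimes>\<^bsub>H\<^esub> h) * x * s (inv\<^bsub>H\<^esub> (g \<otimes>\<^bsub>H\<^esub> h)))"
      using g by (simp add: z_def sum_distrib_left sum_distrib_right r_mult inv_mult_group mult.assoc)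
    also have "\<dots> = z"
      unfolding z_def
      by (rule sum.reindex_bij_witness[of _ "\<lambda>h. inv\<^bsub>H\<^esub> g \<otimes>\<^bsub>H\<^esub> h" "\<lambda>h. g \<otimes>\<^bsub>H\<^esub> h"])
        (use g in \<open>auto simp: inv_cancel\<close>)
    finally have "s g * z * s (inv\<^bsub>H\<^esub> g) * s g = z * s g" by simp
    then show ?thesis using g zc by (simp add: mult.assoc)
  qed
  then obtain c where c: "z = smul c (unit_mat k)"
    using irreducible_rep_commuting_scalar[OF irr zc] by (auto simp: s_def)
  have "tr z = of_nat (card (carrier H)) * tr x"
  proof -
    have "tr (s h * x * s (inv\<^bsub>H\<^esub> h)) = tr x" if h: "h \<in> carrier H" for h
      using h x tr_commute[of "s h * x" "s (inv\<^bsub>H\<^esub> h)"] by simp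
    then show ?thesis by (simp add: z_def)
  qed
  then have "c = of_nat (card (carrier H)) * tr x / of_nat k"
    using n_pos by (simp add: c field_simps)
  then show ?thesis using c by (simp add: z_def s_def)
qed

text \<open>
  The first orthogonality relation of an irreducible character with itself, read off entrywise from the averages of
  the matrix units.
\<close>

lemma irreducible_rep_orthogonality:
  assumes H: "group H" and fin: "finite (carrier H)" and irr: "irreducible_rep H k \<sigma>"
  shows "(\<Sum>h\<in>carrier H. tr (embed k (\<sigma> h)) * tr (embed k (\<sigma> (inv\<^bsub>H\<^esub> h)))) = of_nat (card (carrier H))"
proof -
  have k: "k > 0" using irr by (simp add: irreducible_rep_def)
  let ?s = "\<lambda>h. embed k (\<sigma> h)"
  have tr_sum_diag: "tr x = (\<Sum>a<k. entry x a a)" if "x \<in> corner k" for x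
    using that by (intro tr_eq) (auto simp: corner_def)
  have ent: "(\<Sum>h\<in>carrier H. entry (?s h) a a * entry (?s (inv\<^bsub>H\<^esub> h)) b b)
      = (if a = b then of_nat (card (carrier H)) / of_nat k else 0)" if ab: "a < k" "b < k" for a b
  proof -
    define E where "E = (of_entries (\<lambda>i j. if i = a \<and> j = b then 1 else 0) :: nat fmat)"
    have E_entry: "entry E i j = (if i = a \<and> j = b then 1 else 0)" for i j
      unfolding E_def by (subst entry_of_entries[of "{a, b}"]) (auto split: if_splits)
    have Ec: "E \<in> corner k"
      using ab by (auto simp: corner_def supp_def E_entry split: if_splits)
    have trE: "tr E = (if a = b then 1 else 0)"
    proof (cases "a = b")
      case True
      have "tr E = (\<Sum>i<k. if i = a then 1 else 0)"
        unfolding tr_sum_diag[OF Ec] by (intro sum.cong) (auto simp: E_entry True)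
      then show ?thesis using ab True by simp
    next
      case False
      then show ?thesis unfolding tr_sum_diag[OF Ec] by (auto simp: E_entry intro!: sum.neutral)
    qed
    have prod_entry: "entry (x * E * y) a b = entry x a a * entry y b b"
      if x: "x \<in> corner k" for x y
    proof -
      have xE: "entry (x * E) a j = (if j = b then entry x a a else 0)" for j
      proof -
        have "entry (x * E) a j = (\<Sum>i<k. if i = a then (if j = b then entry x a a else 0) else 0)"
          unfolding entry_mult_corner[OF x] by (intro sum.cong) (auto simp: E_entry)
        then show ?thesis using ab by simp
      qed
      have "entry (x * E * y) a b = (\<Sum>j<k. if j = b then entry x a a * entry y b b else 0)"
        unfolding entry_mult_corner[OF corner_closed(1)[OF x Ec]] by (intro sum.cong) (auto simp: xE)
      then show ?thesis using ab by simp
    qed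
    have "(\<Sum>h\<in>carrier H. entry (?s h) a a * entry (?s (inv\<^bsub>H\<^esub> h)) b b)
        = entry (\<Sum>h\<in>carrier H. ?s h * E * ?s (inv\<^bsub>H\<^esub> h)) a b"
      by (simp add: prod_entry)
    also have "\<dots> = (if a = b then of_nat (card (carrier H)) / of_nat k else 0)"
      unfolding schur_average[OF H fin irr Ec] using ab by (simp add: trE entry_unit_mat)
    finally show ?thesis .
  qed
  have "(\<Sum>h\<in>carrier H. tr (?s h) * tr (?s (inv\<^bsub>H\<^esub> h)))
      = (\<Sum>h\<in>carrier H. \<Sum>a<k. \<Sum>b<k. entry (?s h) a a * entry (?s (inv\<^bsub>H\<^esub> h)) b b)"
    by (simp add: tr_sum_diag sum_product)
  also have "\<dots> = (\<Sum>a<k. \<Sum>b<k. \<Sum>h\<in>carrier H. entry (?s h) a a * entry (?s (inv\<^bsub>H\<^esub> h)) b b)"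
    by (subst sum.swap) (intro sum.cong refl sum.swap)
  also have "\<dots> = (\<Sum>a<k. \<Sum>b<k. if a = b then of_nat (card (carrier H)) / of_nat k else 0)"
    by (intro sum.cong refl) (simp add: ent)
  also have "\<dots> = of_nat (card (carrier H))" using k by simp
  finally show ?thesis .
qed

context fin_rep
begin

text \<open>
  All that is used of quasi-primitivity. In the irreducible constituent \<open>\<sigma>\<close> the class sum of \<open>y\<close> is a scalar by
  Schur's lemma. Hence the difference \<open>w\<close> of the two sides is orthogonal to every \<open>r x\<close>, \<open>x \<in> N\<close>, for the trace
  form, as this can be checked with the character. But \<open>dag w\<close> is a combination of these \<open>r x\<close>, so that
  \<open>tr (w * dag w) = 0\<close> and \<open>w = 0\<close>.
\<close>

lemma class_sum_scalar:
  assumes N: "N \<lhd> G" and y: "y \<in> N"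
    and irr: "irreducible_rep (G\<lparr>carrier := N\<rparr>) k \<sigma>"
    and mult: "\<And>x. x \<in> N \<Longrightarrow> tr (r x) = of_nat m * tr (embed k (\<sigma> x))"
  shows "(\<Sum>j\<in>N. r (j \<otimes> y \<otimes> inv j)) = smul (of_nat (card N) * t (r y)) e"
proof -
  let ?H = "G\<lparr>carrier := N\<rparr>"
  note sN = normal_imp_subgroup[OF N]
  have Nc: "x \<in> carrier G" if "x \<in> N" for x by (rule subgroup.mem_carrier[OF sN that])
  note Nm = subgroup.m_closed[OF sN] and Ni = subgroup.m_inv_closed[OF sN]
  have finN: "finite N" using fin Nc by (meson finite_subset subsetI)
  have gH: "group ?H" by (rule subgroup_imp_group[OF sN])
  define s where "s h = embed k (\<sigma> h)" for h
  interpret S: fin_rep ?H k s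
    unfolding s_def by (rule irreducible_rep_fin_rep[OF gH _ irr]) (simp add: finN)
  have s_mult: "s (g \<otimes> h) = s g * s h" if "g \<in> N" "h \<in> N" for g h
    using S.r_mult[of g h] that by simp
  have s_c: "s g \<in> corner k" if "g \<in> N" for g using S.r_corner[of g] that by simp
  have invH: "inv\<^bsub>?H\<^esub> g = inv g" if "g \<in> N" for g
    by (rule m_inv_consistent[OF sN that])
  have tr_r: "tr (r x) = of_nat m * tr (s x)" if "x \<in> N" for x
    using mult[OF that] by (simp add: s_def)
  have nmk: "n = m * k"
  proof -
    have "(of_nat n :: complex) = of_nat (m * k)"
      using tr_r[OF subgroup.one_closed[OF sN]] S.r_one by simp
    then show ?thesis by (simp only: of_nat_eq_iff)
  qed
  define a where "a = of_nat (card N) * t (r y)"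
  have a_eq: "a = of_nat (card N) * tr (s y) / of_nat k"
  proof -
    have nc: "(of_nat n :: complex) = of_nat m * of_nat k" by (simp only: nmk of_nat_mult)
    have "m \<noteq> 0" using n_pos nmk by auto
    then show ?thesis unfolding a_def t_def nc tr_r[OF y] by simp
  qed
  define w where "w = (\<Sum>j\<in>N. r (j \<otimes> y \<otimes> inv j)) + smul (- a) (r \<one>)"
  have conj: "j \<otimes> y \<otimes> inv j \<in> N" if "j \<in> N" for j
    using that y Nm Ni by blast
  have wc: "w \<in> corner n"
    unfolding w_def
    by (intro corner_closed(2) corner_closed(3) corner_sum r_corner one_closed Nc conj)
  have w_orth: "tr (w * r x) = 0" if x: "x \<in> N" for x
  proof -
    have "(\<Sum>j\<in>N. s j * s y * s (inv j)) = smul (of_nat (card N) * tr (s y) / of_nat k) (unit_mat k)"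
      using schur_average[OF gH _ irr s_c[OF y]] finN invH by (simp add: s_def)
    then have "tr ((\<Sum>j\<in>N. s j * s y * s (inv j)) * s x) = of_nat (card N) * tr (s y) / of_nat k * tr (s x)"
      using s_c[OF x] by simp
    also have "(\<Sum>j\<in>N. s j * s y * s (inv j)) * s x = (\<Sum>j\<in>N. s (j \<otimes> y \<otimes> inv j \<otimes> x))"
      unfolding sum_distrib_right using x y Nm Ni by (intro sum.cong refl) (simp add: s_mult)
    finally have *: "(\<Sum>j\<in>N. tr (s (j \<otimes> y \<otimes> inv j \<otimes> x))) = of_nat (card N) * tr (s y) / of_nat k * tr (s x)"
      by simp
    have "tr (w * r x) = (\<Sum>j\<in>N. tr (r (j \<otimes> y \<otimes> inv j) * r x)) - a * tr (r x)"
      using Nc[OF x] by (simp add: w_def distrib_right sum_distrib_right left_diff_distrib)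
    also have "(\<Sum>j\<in>N. tr (r (j \<otimes> y \<otimes> inv j) * r x)) = (\<Sum>j\<in>N. of_nat m * tr (s (j \<otimes> y \<otimes> inv j \<otimes> x)))"
    proof (rule sum.cong[OF refl])
      fix j assume j: "j \<in> N"
      have "r (j \<otimes> y \<otimes> inv j) * r x = r (j \<otimes> y \<otimes> inv j \<otimes> x)"
        using Nc[OF conj[OF j]] Nc[OF x] by (simp add: r_mult)
      then show "tr (r (j \<otimes> y \<otimes> inv j) * r x) = of_nat m * tr (s (j \<otimes> y \<otimes> inv j \<otimes> x))"
        using tr_r[OF Nm[OF conj[OF j] x]] by simp
    qed
    also have "\<dots> = a * tr (r x)"
      using * by (simp add: a_eq tr_r[OF x] flip: sum_distrib_left)
    finally show ?thesis by simp
  qed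
  have "dag w = (\<Sum>j\<in>N. r (inv (j \<otimes> y \<otimes> inv j))) + smul (- cnj a) (r \<one>)"
  proof -
    have "dag (\<Sum>j\<in>A. r (f j)) = (\<Sum>j\<in>A. r (inv (f j)))" if "\<And>j. j \<in> A \<Longrightarrow> f j \<in> carrier G" for A :: "'a set" and f
      using that by (induction A rule: infinite_finite_induct) (auto simp: dag_add)
    from this[of N "\<lambda>j. j \<otimes> y \<otimes> inv j"] show ?thesis
      unfolding w_def dag_add dag_smul using Nc[OF conj] by simp
  qed
  then have "tr (w * dag w) = (\<Sum>j\<in>N. tr (w * r (inv (j \<otimes> y \<otimes> inv j)))) + (- cnj a) * tr (w * r \<one>)"
    by (simp only: distrib_left sum_distrib_left tr_add tr_sum smul_mult_right tr_smul)
  also have "\<dots> = 0"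
    using w_orth[OF Ni[OF conj]] w_orth[OF subgroup.one_closed[OF sN]] by simp
  finally have "w = 0" using dag_pos(3)[OF wc] by (simp add: t_def)
  then show ?thesis by (simp add: w_def a_def)
qed

end

section \<open>The centralizing part of a group element\<close>

text \<open>
  The representation of a quasi-primitive irreducible character, seen through two consequences: the class sums of every normal subgroup are scalars, and the character has norm 1.
\<close>

locale qp_rep = fin_rep +
  assumes QP: "N \<lhd> G \<Longrightarrow> y \<in> N \<Longrightarrow>
      (\<Sum>m\<in>N. r (m \<otimes> y \<otimes> inv m)) = smul (of_nat (card N) * t (r y)) e"
    and orth: "(\<Sum>g\<in>carrier G. t (r g) * t (r (inv g))) = of_nat (card (carrier G)) / (of_nat n)\<^sup>2"
begin

text \<open>
  In tensor notation the space is \<open>U \<otimes> W\<close> with \<open>N\<close> irreducible on \<open>U\<close> and trivial on \<open>W\<close>; then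
  \<open>spanned N\<close> is \<open>End U \<otimes> 1\<close> and \<open>centralizer N\<close> is \<open>1 \<otimes> End W\<close>. An element \<open>s\<close> of \<open>G\<close> acts as
  \<open>b \<otimes> d\<close>, and \<open>tensor_line N s\<close> consists of the multiples of \<open>1 \<otimes> d\<close>. Working with these subspaces avoids
  choosing bases for \<open>U\<close> and \<open>W\<close>.
\<close>

definition spanned where "spanned N = fmat.span (r ` N)"

definition centralizer where "centralizer N = {x \<in> corner n. \<forall>m\<in>N. r m * x = x * r m}"

definition tensor_line where "tensor_line N s = {x \<in> centralizer N. \<exists>b\<in>spanned N. x = r s * b}"

lemma normal_carrier [simp]: "N \<lhd> G \<Longrightarrow> m \<in> N \<Longrightarrow> m \<in> carrier G"
  by (rule subgroup.mem_carrier[OF normal_imp_subgroup])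

lemma normal_mult: "N \<lhd> G \<Longrightarrow> k \<in> N \<Longrightarrow> m \<in> N \<Longrightarrow> k \<otimes> m \<in> N"
  by (rule subgroup.m_closed[OF normal_imp_subgroup])

lemma normal_inv: "N \<lhd> G \<Longrightarrow> m \<in> N \<Longrightarrow> inv m \<in> N"
  by (rule subgroup.m_inv_closed[OF normal_imp_subgroup])

lemma normal_one: "N \<lhd> G \<Longrightarrow> \<one> \<in> N"
  by (rule subgroup.one_closed[OF normal_imp_subgroup])

lemma normal_conj: "N \<lhd> G \<Longrightarrow> g \<in> carrier G \<Longrightarrow> m \<in> N \<Longrightarrow> g \<otimes> m \<otimes> inv g \<in> N"
  by (rule normal.inv_op_closed2)

lemma normal_conj': "N \<lhd> G \<Longrightarrow> g \<in> carrier G \<Longrightarrow> m \<in> N \<Longrightarrow> inv g \<otimes> m \<otimes> g \<in> N"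
  by (rule normal.inv_op_closed1)

lemma normal_finite: "N \<lhd> G \<Longrightarrow> finite N"
  using fin finite_subset subgroup.subset[OF normal_imp_subgroup] by blast

lemma normal_card_pos: "N \<lhd> G \<Longrightarrow> card N > 0"
  using normal_one[of N] normal_finite[of N] by (auto simp: card_gt_0_iff)

lemma r_spanned: "m \<in> N \<Longrightarrow> r m \<in> spanned N"
  by (simp add: spanned_def fmat.span_base)

lemma spanned_add: "x \<in> spanned N \<Longrightarrow> y \<in> spanned N \<Longrightarrow> x + y \<in> spanned N"
  by (simp add: spanned_def fmat.span_add)

lemma spanned_smul: "x \<in> spanned N \<Longrightarrow> smul c x \<in> spanned N"
  by (simp add: spanned_def fmat.span_scale)

lemma spanned_zero: "0 \<in> spanned N"
  by (simp add: spanned_def fmat.span_zero)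

lemma spanned_sum: "(\<And>a. a \<in> A \<Longrightarrow> f a \<in> spanned N) \<Longrightarrow> (\<Sum>a\<in>A. f a) \<in> spanned N"
  by (simp add: spanned_def fmat.span_sum)

lemma spanned_mono: "N \<subseteq> M \<Longrightarrow> spanned N \<subseteq> spanned M"
  by (simp add: spanned_def fmat.span_mono image_mono)

lemma spanned_induct [consumes 2, case_names zero add]:
  assumes "N \<lhd> G" "x \<in> spanned N" "P 0"
    and "\<And>c m x. m \<in> N \<Longrightarrow> x \<in> spanned N \<Longrightarrow> P x \<Longrightarrow> P (smul c (r m) + x)"
  shows "P x"
proof -
  have "x \<in> spanned N \<and> P x"
    using assms(2)[unfolded spanned_def]
  proof (induction rule: fmat.span_induct_alt)
    case base
    show ?case using assms(3) by (simp add: spanned_zero)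
  next
    case (step c x y)
    then show ?case
      using assms(4) by (auto intro!: spanned_add spanned_smul r_spanned)
  qed
  then show ?thesis ..
qed

lemma spanned_corner:
  assumes N: "N \<lhd> G" and "x \<in> spanned N"
  shows "x \<in> corner n"
  using N assms(2)
  by (induction rule: spanned_induct) (auto intro!: corner_closed r_corner normal_carrier[OF N])

lemma e_spanned: "N \<lhd> G \<Longrightarrow> e \<in> spanned N"
  using r_spanned[OF normal_one] by simp

lemma spanned_mult:
  assumes N: "N \<lhd> G" and "x \<in> spanned N" "y \<in> spanned N"
  shows "x * y \<in> spanned N"
  using N assms(2)
proof (induction rule: spanned_induct)
  case (add c m x)
  have "r m * y \<in> spanned N"
    using N assms(3)
  proof (induction rule: spanned_induct)
    case (add c k y)
    then show ?case
      using N add.hyps \<open>m \<in> N\<close>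
      by (auto simp: distrib_left normal_mult simp flip: r_mult intro!: spanned_add spanned_smul r_spanned)
  qed (simp add: spanned_zero)
  then show ?case
    using add by (simp add: distrib_right spanned_add spanned_smul)
qed (simp add: spanned_zero)

lemma spanned_conj:
  assumes N: "N \<lhd> G" and "x \<in> spanned N" and g: "g \<in> carrier G"
  shows "r g * x * r (inv g) \<in> spanned N"
  using N assms(2)
proof (induction rule: spanned_induct)
  case (add c m x)
  have "r g * r m * r (inv g) = r (g \<otimes> m \<otimes> inv g)"
    using N add g by (simp add: r_mult)
  then have "r g * r m * r (inv g) \<in> spanned N"
    using N add g by (simp add: r_spanned normal_conj)
  then show ?case
    using add by (simp add: distrib_right distrib_left spanned_add spanned_smul)
qed (simp add: spanned_zero)

lemma spanned_dag:
  assumes N: "N \<lhd> G" and "x \<in> spanned N"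
  shows "dag x \<in> spanned N"
  using N assms(2)
  by (induction rule: spanned_induct)
    (auto simp: spanned_zero dag_add dag_smul normal_inv[OF N] dag_r[OF normal_carrier[OF N]]
      intro!: spanned_add spanned_smul r_spanned)

lemma average_spanned:
  assumes N: "N \<lhd> G" and "x \<in> spanned N"
  shows "(\<Sum>m\<in>N. r m * x * r (inv m)) = smul (of_nat (card N) * t x) e"
  using N assms(2)
proof (induction rule: spanned_induct)
  case zero
  then show ?case by (simp add: t_def)
next
  case (add c k x)
  have "(\<Sum>m\<in>N. r m * r k * r (inv m)) = (\<Sum>m\<in>N. r (m \<otimes> k \<otimes> inv m))"
    using N add by (intro sum.cong) (auto simp: r_mult)
  also have "\<dots> = smul (of_nat (card N) * t (r k)) e"
    using N add by (simp add: QP)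
  finally show ?case
    using add
    by (simp add: distrib_left distrib_right sum.distrib t_add fmat.scale_left_distrib mult.left_commute
        flip: fmat.scale_sum_right)
qed

lemma centralizer_corner: "x \<in> centralizer N \<Longrightarrow> x \<in> corner n"
  by (simp add: centralizer_def)

lemma centralizer_spanned_commute:
  assumes N: "N \<lhd> G" and x: "x \<in> centralizer N" and "b \<in> spanned N"
  shows "x * b = b * x"
  using N assms(3)
  by (induction rule: spanned_induct) (use x in \<open>auto simp: distrib_left distrib_right centralizer_def\<close>)

lemma e_centralizer: "N \<lhd> G \<Longrightarrow> e \<in> centralizer N"
  using r_corner[OF normal_carrier, of N] by (auto simp: centralizer_def)

lemma centralizer_mult: "x \<in> centralizer N \<Longrightarrow> y \<in> centralizer N \<Longrightarrow> x * y \<in> centralizer N"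
  by (auto simp: centralizer_def corner_closed) (metis mult.assoc)

lemma centralizer_smul: "x \<in> centralizer N \<Longrightarrow> smul c x \<in> centralizer N"
  by (auto simp: centralizer_def corner_closed)

lemma centralizer_conj_fixed:
  assumes "N \<lhd> G" "x \<in> centralizer N" "m \<in> N"
  shows "r m * x * r (inv m) = x"
  using assms by (auto simp: centralizer_def mult.assoc)

lemma centralizer_dag:
  assumes N: "N \<lhd> G" and x: "x \<in> centralizer N"
  shows "dag x \<in> centralizer N"
proof -
  have "r m * dag x = dag x * r m" if m: "m \<in> N" for m
  proof -
    have "r (inv m) * x = x * r (inv m)" using N x m by (auto simp: centralizer_def normal_inv)
    then have "dag (r (inv m) * x) = dag (x * r (inv m))" by simp
    then show ?thesis using N x m by (simp add: dag_mult centralizer_def)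
  qed
  then show ?thesis using x by (auto simp: centralizer_def)
qed

lemma centralizer_conj:
  assumes N: "N \<lhd> G" and x: "x \<in> centralizer N" and g: "g \<in> carrier G"
  shows "r g * x * r (inv g) \<in> centralizer N"
proof -
  have xc: "x \<in> corner n" using x by (rule centralizer_corner)
  have "r m * (r g * x * r (inv g)) = r g * x * r (inv g) * r m" if m: "m \<in> N" for m
  proof -
    define k where "k = inv g \<otimes> m \<otimes> g"
    have k: "k \<in> N" using N m g by (simp add: k_def normal_conj')
    have mg: "r m * r g = r g * r k" and gm: "r (inv g) * r m = r k * r (inv g)"
      using N m g by (simp_all add: k_def m_assoc[symmetric] inv_solve_right' flip: r_mult)
        (simp_all add: m_assoc)
    have "r m * (r g * x * r (inv g)) = r g * (r k * x) * r (inv g)"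
      by (simp add: mg flip: mult.assoc)
    also have "\<dots> = r g * x * (r k * r (inv g))"
      using x k by (simp add: centralizer_def mult.assoc)
    finally show ?thesis by (simp add: gm mult.assoc)
  qed
  then show ?thesis using xc g by (auto simp: centralizer_def intro!: corner_closed)
qed

text \<open>
  Averaging over \<open>N\<close> fixes such an element, and it makes every element of the span a scalar.
\<close>

lemma spanned_centralizer_scalar:
  assumes N: "N \<lhd> G" and x: "x \<in> centralizer N" "x \<in> spanned N"
  shows "x = smul (t x) e"
proof -
  have "smul (of_nat (card N)) x = (\<Sum>m\<in>N. x)"
    by (rule fmat_eqI) simp
  also have "\<dots> = (\<Sum>m\<in>N. r m * x * r (inv m))"
    using N x(1) by (simp add: centralizer_conj_fixed)
  also have "\<dots> = smul (of_nat (card N)) (smul (t x) e)"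
    using N x(2) by (simp add: average_spanned)
  finally have "smul (inverse (of_nat (card N))) (smul (of_nat (card N)) x)
      = smul (inverse (of_nat (card N))) (smul (of_nat (card N)) (smul (t x) e))" by simp
  then show ?thesis using normal_card_pos[OF N] by (simp flip: mult.assoc)
qed

lemma tensor_line_cent: "x \<in> tensor_line N s \<Longrightarrow> x \<in> centralizer N"
  by (simp add: tensor_line_def)

lemma tensor_line_corner: "x \<in> tensor_line N s \<Longrightarrow> x \<in> corner n"
  by (simp add: tensor_line_def centralizer_def)

lemma tensor_lineI: "x \<in> centralizer N \<Longrightarrow> x = r s * b \<Longrightarrow> b \<in> spanned N \<Longrightarrow> x \<in> tensor_line N s"
  unfolding tensor_line_def by blast

lemma tensor_line_smul: "x \<in> tensor_line N s \<Longrightarrow> smul c x \<in> tensor_line N s"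
  by (auto simp: tensor_line_def centralizer_smul intro!: bexI[of _ "smul c _"] spanned_smul)

lemma tensor_line_memI:
  assumes "N \<lhd> G" "s \<in> carrier G" "x \<in> centralizer N" "r (inv s) * x \<in> spanned N"
  shows "x \<in> tensor_line N s"
proof -
  have "x = r s * (r (inv s) * x)"
    using assms(2) centralizer_corner[OF assms(3)] by simp
  then show ?thesis
    unfolding tensor_line_def using assms(3,4) by blast
qed

lemma tensor_line_memD:
  assumes "N \<lhd> G" "s \<in> carrier G" "x \<in> tensor_line N s"
  shows "r (inv s) * x \<in> spanned N"
proof -
  obtain b where b: "b \<in> spanned N" "x = r s * b"
    using assms(3) by (auto simp: tensor_line_def)
  then show ?thesis
    using assms(2) spanned_corner[OF assms(1) b(1)] by simp
qed

lemma tensor_line_mult: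
  assumes N: "N \<lhd> G" and s: "s \<in> carrier G" "s' \<in> carrier G" and x: "x \<in> tensor_line N s" "y \<in> tensor_line N s'"
  shows "x * y \<in> tensor_line N (s \<otimes> s')"
proof -
  obtain b c where b: "b \<in> spanned N" "x = r s * b" and c: "c \<in> spanned N" "y = r s' * c"
    using x by (auto simp: tensor_line_def)
  note [simp] = spanned_corner[OF N b(1)] spanned_corner[OF N c(1)]
  have "x * y = r (s \<otimes> s') * (r (inv s') * b * r (inv (inv s')) * c)"
    using s by (simp add: b c r_mult mult.assoc corner_closed)
  moreover have "r (inv s') * b * r (inv (inv s')) * c \<in> spanned N"
    by (intro spanned_mult spanned_conj N b c) (use s in simp)
  ultimately show ?thesis
    by (rule tensor_lineI[OF centralizer_mult[OF tensor_line_cent[OF x(1)] tensor_line_cent[OF x(2)]]])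
qed

lemma tensor_line_dag:
  assumes N: "N \<lhd> G" and s: "s \<in> carrier G" and x: "x \<in> tensor_line N s"
  shows "dag x \<in> tensor_line N (inv s)"
proof -
  obtain b where b: "b \<in> spanned N" "x = r s * b"
    using x by (auto simp: tensor_line_def)
  note [simp] = spanned_corner[OF N b(1)]
  have "dag x = r (inv s) * (r s * dag b * r (inv s))"
    using s by (simp add: b dag_mult mult.assoc corner_closed)
  moreover have "r s * dag b * r (inv s) \<in> spanned N"
    by (intro spanned_conj spanned_dag N b s)
  ultimately show ?thesis
    by (rule tensor_lineI[OF centralizer_dag[OF N tensor_line_cent[OF x]]])
qed

lemma tensor_line_conj:
  assumes N: "N \<lhd> G" and g: "g \<in> carrier G" and s: "s \<in> carrier G" and x: "x \<in> tensor_line N s"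
  shows "r g * x * r (inv g) \<in> tensor_line N (g \<otimes> s \<otimes> inv g)"
proof -
  obtain b where b: "b \<in> spanned N" "x = r s * b"
    using x by (auto simp: tensor_line_def)
  note [simp] = spanned_corner[OF N b(1)]
  have "r g * x * r (inv g) = r (g \<otimes> s \<otimes> inv g) * (r g * b * r (inv g))"
    using g s by (simp add: b r_mult mult.assoc corner_closed)
  moreover have "r g * b * r (inv g) \<in> spanned N"
    by (intro spanned_conj N b g)
  ultimately show ?thesis
    by (rule tensor_lineI[OF centralizer_conj[OF N tensor_line_cent[OF x] g]])
qed

lemma tensor_line_coset:
  assumes N: "N \<lhd> G" and s: "s \<in> carrier G" and m: "m \<in> N" and x: "x \<in> tensor_line N s"
  shows "x \<in> tensor_line N (s \<otimes> m)"
proof -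
  obtain b where b: "b \<in> spanned N" "x = r s * b"
    using x by (auto simp: tensor_line_def)
  note [simp] = spanned_corner[OF N b(1)]
  have "x = r (s \<otimes> m) * (r (inv m) * b)"
    using N s m by (simp add: b r_mult mult.assoc)
  moreover have "r (inv m) * b \<in> spanned N"
    using N m b by (intro spanned_mult r_spanned) (auto simp: normal_inv)
  ultimately show ?thesis by (rule tensor_lineI[OF tensor_line_cent[OF x]])
qed

lemma tensor_line_coset':
  assumes N: "N \<lhd> G" and s: "s \<in> carrier G" "s' \<in> carrier G" and m: "inv s \<otimes> s' \<in> N" and x: "x \<in> tensor_line N s"
  shows "x \<in> tensor_line N s'"
proof -
  have "s \<otimes> (inv s \<otimes> s') = s'" using s by (simp flip: m_assoc)
  then show ?thesis using tensor_line_coset[OF N s(1) m x] by simp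
qed

lemma tensor_line_scalar_imp_spanned:
  assumes N: "N \<lhd> G" and s: "s \<in> carrier G" and x: "smul c e \<in> tensor_line N s" "c \<noteq> 0"
  shows "r s \<in> spanned N"
proof -
  have "r (inv s) \<in> spanned N"
    using spanned_smul[OF tensor_line_memD[OF N s x(1)], of "inverse c"] x(2) s by simp
  from spanned_dag[OF N this] show ?thesis using s by simp
qed

text \<open>
  This replaces the Skolem-Noether theorem. The averages over \<open>N\<close> of the elements \<open>r s * r m\<close> lie in the line. If
  all of them vanished, a weighted sum would give \<open>\<Sum>k\<in>N. t (r (inv k)) * r k = 0\<close>, whose trace is a sum of squares
  with the term 1.
\<close>

lemma tensor_line_nonzero:
  assumes N: "N \<lhd> G" and s: "s \<in> carrier G"
  shows "\<exists>d\<in>tensor_line N s. d \<noteq> 0"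
proof (rule ccontr)
  assume contr: "\<not> ?thesis"
  define x where "x m = (\<Sum>k\<in>N. r k * (r s * r m) * r (inv k))" for m
  have x_D: "x m \<in> tensor_line N s" if m: "m \<in> N" for m
  proof (rule tensor_line_memI[OF N s])
    have "r j * x m * r (inv j) = x m" if j: "j \<in> N" for j
    proof -
      have "r j * x m * r (inv j) = (\<Sum>k\<in>N. r (j \<otimes> k) * (r s * r m) * r (inv (j \<otimes> k)))"
        using N m s j
        by (auto simp: x_def sum_distrib_left sum_distrib_right r_mult inv_mult_group mult.assoc intro!: sum.cong)
      also have "\<dots> = x m"
        unfolding x_def
        by (rule sum.reindex_bij_witness[of _ "\<lambda>k. inv j \<otimes> k" "\<lambda>k. j \<otimes> k"])
          (use N j in \<open>auto simp: normal_mult normal_inv simp flip: m_assoc\<close>)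
      finally show ?thesis .
    qed
    then have "r j * x m * r (inv j) * r j = x m * r j" if "j \<in> N" for j using that by simp
    moreover have xc: "x m \<in> corner n"
      unfolding x_def using N m s by (intro corner_sum corner_closed) auto
    ultimately show "x m \<in> centralizer N"
      using N by (auto simp: centralizer_def mult.assoc)
    have "r (inv s) * x m = (\<Sum>k\<in>N. r (inv s \<otimes> k \<otimes> s) * r m * r (inv k))"
      using N m s by (auto simp: x_def sum_distrib_left r_mult mult.assoc intro!: sum.cong)
    also have "\<dots> \<in> spanned N"
      using N m s by (intro spanned_sum spanned_mult r_spanned) (auto simp: normal_conj' normal_inv)
    finally show "r (inv s) * x m \<in> spanned N" .
  qed
  have "x m = 0" if "m \<in> N" for m
    using x_D[OF that] contr by blast
  then have "0 = (\<Sum>m\<in>N. x m * r (inv m))" by simp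
  also have "\<dots> = (\<Sum>k\<in>N. r k * r s * (\<Sum>m\<in>N. r m * r (inv k) * r (inv m)))"
    unfolding x_def sum_distrib_left sum_distrib_right
    by (subst sum.swap) (simp add: mult.assoc)
  also have "\<dots> = (\<Sum>k\<in>N. r k * r s * smul (of_nat (card N) * t (r (inv k))) e)"
    using N by (intro sum.cong refl) (simp add: average_spanned r_spanned normal_inv)
  also have "\<dots> = smul (of_nat (card N)) ((\<Sum>k\<in>N. smul (t (r (inv k))) (r k)) * r s)"
    using N s by (simp add: sum_distrib_right fmat.scale_sum_right corner_closed mult.assoc)
  finally have "smul (of_nat (card N)) ((\<Sum>k\<in>N. smul (t (r (inv k))) (r k)) * r s) = 0" by simp
  then have "(\<Sum>k\<in>N. smul (t (r (inv k))) (r k)) * r s = 0"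
    using normal_card_pos[OF N] by (metis fmat.scale_eq_0_iff of_nat_eq_0_iff less_irrefl)
  then have "(\<Sum>k\<in>N. smul (t (r (inv k))) (r k)) * r s * r (inv s) = 0" by simp
  then have "(\<Sum>k\<in>N. smul (t (r (inv k))) (r k)) = 0"
    using N s by (simp add: mult.assoc corner_sum corner_closed)
  then have "t (\<Sum>k\<in>N. smul (t (r (inv k))) (r k)) = 0" by (simp add: t_def)
  then have "(\<Sum>k\<in>N. t (r (inv k)) * t (r k)) = 0" by (simp add: t_sum)
  also have "(\<Sum>k\<in>N. t (r (inv k)) * t (r k)) = of_real (\<Sum>k\<in>N. (cmod (t (r k)))\<^sup>2)"
    using N by (simp add: norm_t_inv complex_norm_square mult.commute del: of_real_power)
  finally have "(\<Sum>k\<in>N. (cmod (t (r k)))\<^sup>2) = 0" by (metis of_real_eq_0_iff)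
  then have "(cmod (t (r \<one>)))\<^sup>2 = 0"
    using normal_finite[OF N] normal_one[OF N] by (subst (asm) sum_nonneg_eq_0_iff) auto
  then show False by simp
qed

text \<open>
  For any nonzero \<open>d\<close> in the line, \<open>d * dag d\<close> commutes with \<open>N\<close> and lies in its span, so that it is a positive
  scalar; thus \<open>d\<close> can be made unitary. The determinant is normalised as well, because then products of such elements
  differ from each other by \<open>n\<close>-th roots of unity only.
\<close>

lemma tensor_line_unitary:
  assumes N: "N \<lhd> G" and s: "s \<in> carrier G"
  shows "\<exists>d\<in>tensor_line N s. d * dag d = e \<and> dag d * d = e \<and> cdet n d = 1"
proof -
  obtain d0 where d0: "d0 \<in> tensor_line N s" "d0 \<noteq> 0" using tensor_line_nonzero[OF N s] by blast
  have d0c [simp]: "d0 \<in> corner n" using d0(1) by (rule tensor_line_corner)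
  define c where "c = Re (t (d0 * dag d0))"
  have t_eq: "t (d0 * dag d0) = of_real c"
    using dag_pos(1)[OF d0c] by (simp add: c_def complex_eq_iff)
  have "c \<ge> 0" using dag_pos(2)[OF d0c] by (simp add: c_def)
  moreover have "c \<noteq> 0" using dag_pos(3)[OF d0c] d0(2) t_eq by (metis of_real_0)
  ultimately have c_pos: "c > 0" by simp
  have scal: "x = smul (t x) e" if "x \<in> tensor_line N \<one>" for x
    using spanned_centralizer_scalar[OF N tensor_line_cent[OF that]]
      tensor_line_memD[OF N one_closed that] tensor_line_corner[OF that] by simp
  have "d0 * dag d0 \<in> tensor_line N (s \<otimes> inv s)" "dag d0 * d0 \<in> tensor_line N (inv s \<otimes> s)"
    by (rule tensor_line_mult[OF N s inv_closed[OF s] d0(1) tensor_line_dag[OF N s d0(1)]],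
        rule tensor_line_mult[OF N inv_closed[OF s] s tensor_line_dag[OF N s d0(1)] d0(1)])
  then have dd: "d0 * dag d0 = smul (of_real c) e" "dag d0 * d0 = smul (of_real c) e"
    using s scal[of "d0 * dag d0"] scal[of "dag d0 * d0"] t_eq t_commute[of d0 "dag d0"] by auto
  define d1 where "d1 = smul (of_real (1 / sqrt c)) d0"
  have d1: "d1 \<in> tensor_line N s" by (simp add: d1_def d0 tensor_line_smul)
  have sq: "complex_of_real (1 / sqrt c) * (complex_of_real (1 / sqrt c) * complex_of_real c) = 1"
    using c_pos by (simp flip: of_real_mult)
  have d1u: "d1 * dag d1 = e" "dag d1 * d1 = e"
    using sq by (simp_all add: d1_def dag_smul dd)
  have d1c [simp]: "d1 \<in> corner n" using d1 by (rule tensor_line_corner)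
  define \<delta> where "\<delta> = cdet n d1"
  have "\<delta> * cnj \<delta> = 1"
    using cdet_mult[of d1 n "dag d1"] by (simp add: cdet_dag d1u \<delta>_def)
  then have "(cmod \<delta>)\<^sup>2 = 1"
    by (metis complex_norm_square of_real_eq_1_iff of_real_power)
  then have "cmod \<delta> = 1"
    by (simp add: power2_eq_1_iff) (use norm_ge_zero[of \<delta>] in linarith)
  then have \<theta>: "\<delta> = cis (Arg \<delta>)"
    by (metis cis_Arg norm_zero zero_neq_one sgn_eq div_by_1 of_real_1)
  define \<theta> where "\<theta> = Arg \<delta>"
  \<comment> \<open>An \<open>n\<close>-th root of the inverse determinant, itself of modulus 1, so that unitarity is kept.\<close>
  define w where "w = cis (- \<theta> / of_nat n)"
  have wn: "w ^ n = cis (- \<theta>)" using n_pos by (simp add: w_def DeMoivre)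
  have ww: "w * cnj w = 1" by (simp add: w_def cis_cnj cis_mult)
  show ?thesis
  proof (intro bexI[of _ "smul w d1"] conjI)
    show "smul w d1 * dag (smul w d1) = e" "dag (smul w d1) * smul w d1 = e"
      using ww by (simp_all add: dag_smul d1u mult.commute)
    show "cdet n (smul w d1) = 1"
      by (simp add: cdet_smul wn cis_mult \<theta>[folded \<theta>_def] flip: \<delta>_def)
    show "smul w d1 \<in> tensor_line N s" using d1 by (rule tensor_line_smul)
  qed
qed

definition tensor_part where
  "tensor_part N s = (SOME d. d \<in> tensor_line N s \<and> d * dag d = e \<and> dag d * d = e \<and> cdet n d = 1)"

lemma tensor_part:
  assumes "N \<lhd> G" "s \<in> carrier G"
  shows "tensor_part N s \<in> tensor_line N s" "tensor_part N s * dag (tensor_part N s) = e"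
    "dag (tensor_part N s) * tensor_part N s = e" "cdet n (tensor_part N s) = 1"
  using someI_ex[of "\<lambda>d. d \<in> tensor_line N s \<and> d * dag d = e \<and> dag d * d = e \<and> cdet n d = 1"]
    tensor_line_unitary[OF assms]
  by (auto simp: tensor_part_def)

lemma tensor_line_multiple:
  assumes N: "N \<lhd> G" and s: "s \<in> carrier G" and x: "x \<in> tensor_line N s"
  shows "\<exists>c. x = smul c (tensor_part N s)"
proof -
  let ?d = "tensor_part N s"
  have "x * dag ?d \<in> tensor_line N (s \<otimes> inv s)"
    by (rule tensor_line_mult[OF N s inv_closed[OF s] x tensor_line_dag[OF N s tensor_part(1)[OF N s]]])
  have xc: "x \<in> corner n" and dc: "?d \<in> corner n"
    using tensor_line_corner[OF x] tensor_line_corner[OF tensor_part(1)[OF N s]] by auto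
  have xd: "x * dag ?d \<in> tensor_line N \<one>"
    using \<open>x * dag ?d \<in> tensor_line N (s \<otimes> inv s)\<close> s by simp
  have "x * dag ?d = smul (t (x * dag ?d)) e"
    using spanned_centralizer_scalar[OF N tensor_line_cent[OF xd]] tensor_line_memD[OF N one_closed xd] tensor_line_corner[OF xd] by simp
  then have "x * dag ?d * ?d = smul (t (x * dag ?d)) e * ?d" by simp
  then have "x = smul (t (x * dag ?d)) ?d"
    using tensor_part[OF N s] xc dc by (simp add: mult.assoc)
  then show ?thesis ..
qed

end

section \<open>Factors of order prime to the degree\<close>

context qp_rep
begin

lemma tensor_part_corner [simp]: "N \<lhd> G \<Longrightarrow> s \<in> carrier G \<Longrightarrow> tensor_part N s \<in> corner n"
  using tensor_line_corner tensor_part(1) by blast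

lemma tensor_line_unitary_line:
  assumes N: "N \<lhd> G" and s: "s \<in> carrier G" and x: "x \<in> tensor_line N s" "x * dag x = e"
  shows "\<exists>c. x = smul c (tensor_part N s) \<and> c * cnj c = 1"
proof -
  obtain c where c: "x = smul c (tensor_part N s)" using tensor_line_multiple[OF N s x(1)] by blast
  have "smul (c * cnj c) e = e"
    using x(2) tensor_part[OF N s] by (simp add: c dag_smul mult.commute)
  then have "c * cnj c * t e = t e" by (metis t_smul)
  then show ?thesis using c by auto
qed

text \<open>
  The operators \<open>y \<mapsto> d * y * dag d\<close>, for \<open>d\<close> the part of \<open>m \<in> M\<close>, do not depend on the scalar in \<open>d\<close> and
  so represent \<open>M\<close>. Their mean is idempotent, and its trace is the number in question.
\<close>

lemma projection_tr_nat:
  assumes N: "N \<lhd> G" and M: "M \<lhd> G"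
  shows "(of_nat n)\<^sup>2 * (\<Sum>m\<in>M. of_real ((cmod (t (tensor_part N m)))\<^sup>2)) / of_nat (card M) \<in> (\<nat> :: complex set)"
proof -
  define k where "k m = kron (tensor_part N m) (cj (tensor_part N m))" for m
  have kk: "k m * k m' = k (m \<otimes> m')" if m: "m \<in> M" "m' \<in> M" for m m'
  proof -
    have mc: "m \<in> carrier G" "m' \<in> carrier G" using M m by simp_all
    let ?x = "tensor_part N m * tensor_part N m'"
    have "?x \<in> tensor_line N (m \<otimes> m')" using N mc by (simp add: tensor_line_mult tensor_part)
    moreover have "?x * dag ?x = e"
    proof -
      have "?x * dag ?x = tensor_part N m * (tensor_part N m' * dag (tensor_part N m')) * dag (tensor_part N m)"
        using N mc by (simp add: dag_mult mult.assoc)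
      then show ?thesis using N mc by (simp add: tensor_part)
    qed
    ultimately obtain c where c: "?x = smul c (tensor_part N (m \<otimes> m'))" "c * cnj c = 1"
      using tensor_line_unitary_line[OF N m_closed[OF mc]] by blast
    then show ?thesis
      by (simp add: k_def kron_mult cj_smul kron_smul mult.commute[of "cnj c"] flip: cj_mult)
  qed
  define E where "E = smul (1 / of_nat (card M)) (\<Sum>m\<in>M. k m)"
  have "(\<Sum>m\<in>M. k m) * (\<Sum>m\<in>M. k m) = (\<Sum>m\<in>M. \<Sum>m'\<in>M. k (m \<otimes> m'))"
    by (simp add: sum_product kk)
  also have "\<dots> = (\<Sum>m\<in>M. \<Sum>m'\<in>M. k m')"
  proof (rule sum.cong[OF refl])
    fix m assume m: "m \<in> M"
    show "(\<Sum>m'\<in>M. k (m \<otimes> m')) = (\<Sum>m'\<in>M. k m')"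
      by (rule sum.reindex_bij_witness[of _ "\<lambda>j. inv m \<otimes> j" "\<lambda>j. m \<otimes> j"])
        (use M m in \<open>auto simp: normal_mult normal_inv simp flip: m_assoc\<close>)
  qed
  also have "\<dots> = smul (of_nat (card M)) (\<Sum>m\<in>M. k m)"
    by (rule fmat_eqI) simp
  finally have "E * E = E"
    using normal_card_pos[OF M] by (simp add: E_def)
  then have "tr E \<in> \<nat>" by (rule idempotent_tr_nat)
  also have "tr E = (\<Sum>m\<in>M. of_real ((cmod (tr (tensor_part N m)))\<^sup>2)) / of_nat (card M)"
    by (simp add: E_def k_def tr_kron tr_cj complex_norm_square del: of_real_power)
  also have "(\<Sum>m\<in>M. complex_of_real ((cmod (tr (tensor_part N m)))\<^sup>2))
      = (of_nat n)\<^sup>2 * (\<Sum>m\<in>M. of_real ((cmod (t (tensor_part N m)))\<^sup>2))"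
    using n_pos by (simp add: t_def norm_divide power_divide sum_divide_distrib[symmetric])
  finally show ?thesis .
qed

text \<open>
  Cauchy-Schwarz for the trace form applied to the part \<open>d\<close> and the unit: the square length of \<open>d - t(d)\<close> is
  \<open>1 - \<bar>t(d)\<bar>\<^sup>2\<close>. If it vanishes, then \<open>d\<close> is a scalar.
\<close>

lemma tensor_part_norm_t:
  assumes N: "N \<lhd> G" and s: "s \<in> carrier G"
  shows "cmod (t (tensor_part N s)) \<le> 1" and "cmod (t (tensor_part N s)) = 1 \<Longrightarrow> r s \<in> spanned N"
proof -
  let ?d = "tensor_part N s"
  define y where "y = ?d + smul (- t ?d) e"
  have y: "y \<in> corner n"
    unfolding y_def by (intro corner_closed(2) corner_closed(3) tensor_part_corner N s unit_mat_corner)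
  have "y * dag y = e + smul (- cnj (t ?d)) ?d + smul (- t ?d) (dag ?d) + smul (t ?d * cnj (t ?d)) e"
    unfolding y_def dag_add dag_smul distrib_left distrib_right
    using N s tensor_part[OF N s] by (simp add: mult.commute)
  then have ty: "t (y * dag y) = 1 - of_real ((cmod (t ?d))\<^sup>2)"
    using N s by (simp add: t_add t_diff t_dag complex_norm_square mult.commute del: of_real_power)
  have "0 \<le> 1 - (cmod (t ?d))\<^sup>2"
    using dag_pos(2)[OF y] unfolding ty by simp
  then show "cmod (t ?d) \<le> 1"
    by (metis abs_norm_cancel diff_ge_0_iff_ge abs_square_le_1)
  assume "cmod (t ?d) = 1"
  then have "y = 0" using dag_pos(3)[OF y] unfolding ty by simp
  then have "?d = smul (t ?d) e" by (simp add: y_def add_eq_0_iff2)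
  moreover have "t ?d \<noteq> 0" using \<open>cmod (t ?d) = 1\<close> by auto
  ultimately show "r s \<in> spanned N"
    using tensor_line_scalar_imp_spanned[OF N s, of "t ?d"] tensor_part(1)[OF N s] by simp
qed

lemma tensor_part_coset_norm:
  assumes N: "N \<lhd> G" and s: "s \<in> carrier G" and k: "k \<in> N"
  shows "cmod (t (tensor_part N (s \<otimes> k))) = cmod (t (tensor_part N s))"
proof -
  have sk: "s \<otimes> k \<in> carrier G" using N s k by simp
  have "tensor_part N s \<in> tensor_line N (s \<otimes> k)" by (rule tensor_line_coset[OF N s k tensor_part(1)[OF N s]])
  then obtain c where c: "tensor_part N s = smul c (tensor_part N (s \<otimes> k))" "c * cnj c = 1"
    using tensor_line_unitary_line[OF N sk] tensor_part(2)[OF N s] by blast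
  have "(cmod c)\<^sup>2 = 1" using c(2) by (metis complex_norm_square of_real_eq_1_iff of_real_power)
  then have "cmod c = 1" by (simp add: power2_eq_1_iff) (use norm_ge_zero[of c] in linarith)
  then show ?thesis using c(1) by (simp add: norm_mult)
qed

text \<open>
  Summing the conjugates of \<open>d\<close> under \<open>R\<close> gives the scalar \<open>card R * t(d)\<close>, and likewise for \<open>dag d\<close>.
  Multiplying the two and summing over \<open>R\<close> expresses the number as a sum of elements of the set \<open>\<Gamma>\<close> of all
  unitary elements of determinant 1 in the lines of \<open>M\<close>. This set is closed under products, and it is finite, since
  each line contains at most \<open>n\<close> of them. Multiplication by the number therefore maps \<open>\<Gamma>\<close> into its integral span.
\<close>

lemma algebraic_int_sum_norm:
  assumes N: "N \<lhd> G" and M: "M \<lhd> G" and NM: "N \<subseteq> M" and RM: "R \<subseteq> M"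
    and card: "card M = card N * card R"
    and transv: "\<And>F :: 'a \<Rightarrow> complex. \<forall>m\<in>M. \<forall>k\<in>N. F (m \<otimes> k) = F m \<Longrightarrow> sum F M = of_nat (card N) * sum F R"
  shows "algebraic_int (of_nat (card R) ^ 2 * (\<Sum>s\<in>R. complex_of_real ((cmod (t (tensor_part N s)))\<^sup>2)))"
proof -
  have Rc: "s \<in> carrier G" if "s \<in> R" for s using that RM M by auto
  have finR: "finite R" using RM normal_finite[OF M] by (rule finite_subset)
  have avg: "(\<Sum>x\<in>R. r x * y * r (inv x)) = smul (of_nat (card R) * t y) e"
    if y: "y \<in> centralizer N" "y \<in> spanned M" for y
  proof -
    have "of_nat (card N) * entry (\<Sum>x\<in>R. r x * y * r (inv x)) i j
        = of_nat (card N) * entry (smul (of_nat (card R) * t y) e) i j" for i j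
    proof -
      have "of_nat (card N) * (\<Sum>x\<in>R. entry (r x * y * r (inv x)) i j)
          = (\<Sum>x\<in>M. entry (r x * y * r (inv x)) i j)"
      proof (rule transv[symmetric], intro ballI)
        fix m k assume mk: "m \<in> M" "k \<in> N"
        have c: "m \<in> carrier G" "k \<in> carrier G" using mk M N by simp_all
        have "r (m \<otimes> k) * y * r (inv (m \<otimes> k)) = r m * (r k * y * r (inv k)) * r (inv m)"
          using c by (simp add: r_mult inv_mult_group mult.assoc)
        then show "entry (r (m \<otimes> k) * y * r (inv (m \<otimes> k))) i j = entry (r m * y * r (inv m)) i j"
          using N y mk by (simp add: centralizer_conj_fixed)
      qed
      also have "\<dots> = entry (smul (of_nat (card M) * t y) e) i j"
        using average_spanned[OF M y(2)] by (simp flip: entry_sum)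
      finally show ?thesis by (simp add: card mult.assoc)
    qed
    note eq = this
    have "complex_of_nat (card N) \<noteq> 0" using normal_card_pos[OF N] by simp
    then show ?thesis by (intro fmat_eqI mult_left_cancel[THEN iffD1, OF _ eq])
  qed
  define \<Gamma> where "\<Gamma> = {x. \<exists>m\<in>M. x \<in> tensor_line N m \<and> x * dag x = e \<and> cdet n x = 1}"
  have Gc: "x \<in> corner n" if "x \<in> \<Gamma>" for x using that by (auto simp: \<Gamma>_def dest: tensor_line_corner)
  have G_mult: "x * y \<in> \<Gamma>" if xy: "x \<in> \<Gamma>" "y \<in> \<Gamma>" for x y
  proof -
    obtain m m' where m: "m \<in> M" "x \<in> tensor_line N m" "m' \<in> M" "y \<in> tensor_line N m'" using xy by (auto simp: \<Gamma>_def)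
    have "x * y \<in> tensor_line N (m \<otimes> m')" using N M m by (intro tensor_line_mult) auto
    moreover have "x * y * dag (x * y) = x * (y * dag y) * dag x"
      using Gc xy by (simp add: dag_mult mult.assoc)
    ultimately show ?thesis
      using xy m M Gc[OF xy(1)] Gc[OF xy(2)]
      by (auto simp: \<Gamma>_def cdet_mult intro!: bexI[of _ "m \<otimes> m'"] normal_mult)
  qed
  have G_dag: "dag x \<in> \<Gamma>" if x: "x \<in> \<Gamma>" for x
  proof -
    obtain m where m: "m \<in> M" "x \<in> tensor_line N m" using x by (auto simp: \<Gamma>_def)
    have mc: "m \<in> carrier G" using M m by simp
    obtain c where c: "x = smul c (tensor_part N m)" "c * cnj c = 1"
      using tensor_line_unitary_line[OF N mc m(2)] x by (auto simp: \<Gamma>_def)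
    have "dag x * x = e" using tensor_part[OF N mc] c by (simp add: dag_smul mult.commute)
    then show ?thesis
      using x m Gc[OF x] tensor_line_dag[OF N mc m(2)] normal_inv[OF M m(1)]
      by (auto simp: \<Gamma>_def cdet_dag intro!: bexI[of _ "inv m"])
  qed
  have G_conj: "r g * x * r (inv g) \<in> \<Gamma>" if x: "x \<in> \<Gamma>" and g: "g \<in> carrier G" for x g
  proof -
    obtain m where m: "m \<in> M" "x \<in> tensor_line N m" using x by (auto simp: \<Gamma>_def)
    have "r g * x * r (inv g) \<in> tensor_line N (g \<otimes> m \<otimes> inv g)"
      using N M m g by (intro tensor_line_conj) auto
    moreover have "r g * x * r (inv g) * dag (r g * x * r (inv g)) = e"
    proof -
      have "r g * x * r (inv g) * dag (r g * x * r (inv g)) = r g * (x * dag x) * r (inv g)"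
        using g Gc[OF x] by (simp add: dag_mult corner_closed mult.assoc)
      then show ?thesis using x g by (simp add: \<Gamma>_def)
    qed
    moreover have "cdet n (r g) * cdet n (r (inv g)) = 1"
      using g by (simp flip: cdet_mult)
    then have "cdet n (r g * x * r (inv g)) = 1"
      using g Gc[OF x] x by (simp add: cdet_mult corner_closed \<Gamma>_def)
    ultimately show ?thesis
      using normal_conj[OF M g m(1)] by (auto simp: \<Gamma>_def)
  qed
  have tensor_part_G: "tensor_part N s \<in> \<Gamma>" if "s \<in> M" for s
    using tensor_part[OF N normal_carrier[OF M that]] that by (auto simp: \<Gamma>_def)
  have fin_G: "finite \<Gamma>"
  proof (rule finite_subset)
    show "\<Gamma> \<subseteq> (\<lambda>(c, m). smul c (tensor_part N m)) ` ({c. c ^ n = 1} \<times> M)"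
    proof
      fix x assume x: "x \<in> \<Gamma>"
      then obtain m where m: "m \<in> M" "x \<in> tensor_line N m" by (auto simp: \<Gamma>_def)
      have mc: "m \<in> carrier G" using M m by simp
      obtain c where c: "x = smul c (tensor_part N m)" using tensor_line_multiple[OF N mc m(2)] by blast
      have "c ^ n = 1" using x tensor_part[OF N mc] by (simp add: \<Gamma>_def c cdet_smul)
      then show "x \<in> (\<lambda>(c, m). smul c (tensor_part N m)) ` ({c. c ^ n = 1} \<times> M)"
        using c m by auto
    qed
    show "finite ((\<lambda>(c, m). smul c (tensor_part N m)) ` ({c. c ^ n = 1} \<times> M))"
      using normal_finite[OF M] n_pos finite_roots_unity[of n, where 'a = complex] by auto
  qed
  define X where "X = of_nat (card R) ^ 2 * (\<Sum>s\<in>R. complex_of_real ((cmod (t (tensor_part N s)))\<^sup>2))"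
  define w where "w = (\<lambda>(s, x, y). (r x * tensor_part N s * r (inv x)) * (r y * dag (tensor_part N s) * r (inv y)))"
  have w_G: "w p \<in> \<Gamma>" if "p \<in> R \<times> R \<times> R" for p
    using that RM Rc by (auto simp: w_def intro!: G_mult G_conj G_dag tensor_part_G)
  have "(\<Sum>p\<in>R \<times> R \<times> R. w p) = smul X e"
  proof -
    have "(\<Sum>p\<in>R \<times> R \<times> R. w p) =
        (\<Sum>s\<in>R. (\<Sum>x\<in>R. r x * tensor_part N s * r (inv x)) * (\<Sum>y\<in>R. r y * dag (tensor_part N s) * r (inv y)))"
      by (simp add: w_def sum_product sum.cartesian_product split_beta)
    also have "\<dots> = (\<Sum>s\<in>R. smul (of_nat (card R) ^ 2 * complex_of_real ((cmod (t (tensor_part N s)))\<^sup>2)) e)"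
    proof (rule sum.cong[OF refl])
      fix s assume s: "s \<in> R"
      have sc: "s \<in> carrier G" using Rc s .
      have c: "tensor_part N s \<in> centralizer N" using tensor_line_cent tensor_part(1)[OF N sc] by blast
      have b: "tensor_part N s \<in> spanned M"
      proof -
        have "r (inv s) * tensor_part N s \<in> spanned M" 
          using tensor_line_memD[OF N sc tensor_part(1)[OF N sc]] spanned_mono[OF NM] by blast
        then have "r s * (r (inv s) * tensor_part N s) \<in> spanned M"
          by (rule spanned_mult[OF M r_spanned[OF subsetD[OF RM s]]])
        then show ?thesis using N sc by simp
      qed
      show "(\<Sum>x\<in>R. r x * tensor_part N s * r (inv x)) * (\<Sum>y\<in>R. r y * dag (tensor_part N s) * r (inv y))
          = smul (of_nat (card R) ^ 2 * complex_of_real ((cmod (t (tensor_part N s)))\<^sup>2)) e"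
        using avg[OF c b] avg[OF centralizer_dag[OF N c] spanned_dag[OF M b]] N sc
        unfolding complex_norm_square power2_eq_square[of "of_nat _"]
        by (simp add: t_dag mult_ac)
    qed
    also have "\<dots> = smul X e"
      by (simp add: X_def sum_distrib_left fmat.scale_sum_left)
    finally show ?thesis .
  qed
  then have we: "(\<Sum>p\<in>R \<times> R \<times> R. w p * x) = smul X x" if "x \<in> corner n" for x
    using that by (simp flip: sum_distrib_right)
  have e_G: "e \<in> \<Gamma>"
  proof -
    have "e \<in> tensor_line N \<one>" by (rule tensor_line_memI[OF N one_closed]) (auto simp: e_centralizer e_spanned N)
    then show ?thesis using normal_one[OF M] by (auto simp: \<Gamma>_def)
  qed
  have "algebraic_int X"
  proof (rule algebraic_int_eigenvalue[OF fin_G,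
        where v = "\<lambda>x. entry x 0 0" and F = "\<lambda>x y. int (card {p \<in> R \<times> R \<times> R. w p * x = y})"])
    show "\<exists>x\<in>\<Gamma>. entry x 0 0 \<noteq> 0"
      using e_G n_pos by (intro bexI[of _ e]) (simp_all add: entry_unit_mat)
    fix x assume x: "x \<in> \<Gamma>"
    have "(\<Sum>y\<in>\<Gamma>. of_int (int (card {p \<in> R \<times> R \<times> R. w p * x = y})) * entry y 0 0)
        = (\<Sum>y\<in>\<Gamma>. \<Sum>p\<in>{p \<in> R \<times> R \<times> R. w p * x = y}. entry (w p * x) 0 0)"
      by (intro sum.cong refl) simp
    also have "\<dots> = (\<Sum>p\<in>R \<times> R \<times> R. entry (w p * x) 0 0)"
      by (rule sum.group) (use finR fin_G w_G x G_mult in auto)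
    also have "\<dots> = entry (\<Sum>p\<in>R \<times> R \<times> R. w p * x) 0 0" by simp
    also have "\<dots> = X * entry x 0 0" using we[OF Gc[OF x]] by simp
    finally show "(\<Sum>y\<in>\<Gamma>. of_int (int (card {p \<in> R \<times> R \<times> R. w p * x = y})) * entry y 0 0) = X * entry x 0 0" .
  qed
  then show ?thesis by (simp add: X_def)
qed

text \<open>
  With \<open>\<tau> = card M div card N\<close>, the mean \<open>q\<close> of \<open>\<bar>t(d)\<bar>\<^sup>2\<close> over \<open>M\<close> becomes an integer on multiplication by \<open>n\<^sup>2\<close> and
  by \<open>\<tau>\<^sup>3\<close>, and these are coprime; so it is an integer. It is positive and at most 1, so that all \<open>\<bar>t(d)\<bar>\<close> are 1 and all \<open>d\<close> are scalars.
\<close>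

theorem coprime_factor_spanned:
  assumes N: "N \<lhd> G" and M: "M \<lhd> G" and NM: "N \<subseteq> M" and cop: "coprime (card M div card N) n"
    and s: "s \<in> M"
  shows "r s \<in> spanned N"
proof -
  obtain R where R: "R \<subseteq> M" "card M = card N * card R"
    and transv: "\<And>F :: 'a \<Rightarrow> complex. \<forall>m\<in>M. \<forall>k\<in>N. F (m \<otimes> k) = F m \<Longrightarrow> sum F M = of_nat (card N) * sum F R"
    using sum_transversal[OF normal_imp_subgroup[OF N] normal_imp_subgroup[OF M] NM normal_finite[OF M]]
    by auto
  have Mc: "m \<in> carrier G" if "m \<in> M" for m using M that by simp
  have cN: "card N > 0" by (rule normal_card_pos[OF N])
  define \<tau> where "\<tau> = card R"
  have \<tau>: "\<tau> > 0" using normal_card_pos[OF M] R by (cases "card R") (auto simp: \<tau>_def)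
  have cop': "coprime \<tau> n" using cop cN by (simp add: R \<tau>_def)
  define f where "f m = (cmod (t (tensor_part N m)))\<^sup>2" for m
  define q where "q = sum f M / card M"
  have f_le: "f m \<le> 1" if "m \<in> M" for m
    using tensor_part_norm_t(1)[OF N Mc[OF that]] by (simp add: f_def power_le_one)
  have q_R: "sum f M = card N * sum f R"
  proof -
    have "(\<Sum>m\<in>M. complex_of_real (f m)) = of_nat (card N) * (\<Sum>m\<in>R. complex_of_real (f m))"
      by (rule transv) (use Mc N in \<open>auto simp: f_def tensor_part_coset_norm\<close>)
    then have "complex_of_real (sum f M) = of_real (card N * sum f R)" by simp
    then show ?thesis by (metis of_real_eq_iff)
  qed
  have q_R': "sum f R = \<tau> * q"
    using cN \<tau> q_R by (simp add: q_def R \<tau>_def)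
  obtain a where a: "real n ^ 2 * q = of_nat a"
  proof -
    have "(of_nat n)\<^sup>2 * (\<Sum>m\<in>M. of_real (f m)) / of_nat (card M) \<in> (\<nat> :: complex set)"
      using projection_tr_nat[OF N M] by (simp add: f_def)
    then obtain a where "(of_nat n)\<^sup>2 * (\<Sum>m\<in>M. of_real (f m)) / of_nat (card M) = (of_nat a :: complex)"
      by (auto elim: Nats_cases)
    then have "complex_of_real (real n ^ 2 * q) = of_real (of_nat a)"
      by (simp add: q_def)
    then show ?thesis using that by (metis of_real_eq_iff)
  qed
  \<comment> \<open>Two factors \<open>\<tau>\<close> come from the class sums, the third from replacing the mean by the sum over \<open>R\<close>.\<close>
  define X where "X = real \<tau> ^ 3 * q"
  have "algebraic_int (complex_of_real X)"
  proof -
    have "of_nat (card R) ^ 2 * (\<Sum>s\<in>R. complex_of_real ((cmod (t (tensor_part N s)))\<^sup>2)) = of_real X"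
    proof -
      have "(\<Sum>s\<in>R. complex_of_real ((cmod (t (tensor_part N s)))\<^sup>2)) = of_real (\<tau> * q)"
        by (simp only: q_R'[symmetric] f_def of_real_sum)
      then show ?thesis
        unfolding X_def \<tau>_def by (simp only:) (simp add: power3_eq_cube power2_eq_square)
    qed
    then show ?thesis using algebraic_int_sum_norm[OF N M NM R transv] by simp
  qed
  moreover have Xa: "X = real (\<tau> ^ 3 * a) / real (n ^ 2)"
    using a n_pos by (simp add: X_def field_simps)
  then have "complex_of_real X \<in> \<rat>" by simp
  ultimately have "complex_of_real X \<in> \<int>" by (rule rational_algebraic_int_is_int)
  then obtain z where z: "X = of_int z" by (auto elim!: Ints_cases)
  have "real_of_int (z * int (n ^ 2)) = real_of_int (int (\<tau> ^ 3 * a))"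
    using Xa z n_pos by (simp add: field_simps)
  then have "z * int (n ^ 2) = int (\<tau> ^ 3 * a)" by (metis of_int_eq_iff)
  then have "int (n ^ 2) dvd int (\<tau> ^ 3 * a)" by (metis dvd_triv_right)
  then have "n ^ 2 dvd \<tau> ^ 3 * a" by (simp only: int_dvd_int_iff)
  moreover have "coprime (n ^ 2) (\<tau> ^ 3)" using cop' by (simp add: coprime_commute)
  ultimately have "n ^ 2 dvd a" by (simp add: coprime_dvd_mult_right_iff)
  then obtain b where b: "a = n ^ 2 * b" by auto
  have q_b: "q = real b" using a n_pos by (simp add: b)
  have "f \<one> = 1"
  proof -
    have "e \<in> tensor_line N \<one>" by (rule tensor_line_memI[OF N one_closed]) (auto simp: e_centralizer e_spanned N)
    then obtain c where c: "e = smul c (tensor_part N \<one>)" "c * cnj c = 1"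
      using tensor_line_unitary_line[OF N one_closed, of e] by auto
    have "(cmod c)\<^sup>2 = 1" using c(2) by (metis complex_norm_square of_real_eq_1_iff of_real_power)
    moreover have "1 = c * t (tensor_part N \<one>)" using c(1) by (metis t_e t_smul)
    then have "1 = (cmod c)\<^sup>2 * f \<one>"
      unfolding f_def by (metis norm_mult norm_one power_mult_distrib power_one)
    ultimately show ?thesis by simp
  qed
  moreover have "f \<one> \<le> sum f M"
    using normal_one[OF M] normal_finite[OF M] by (intro member_le_sum) (auto simp: f_def)
  ultimately have "q > 0" using normal_card_pos[OF M] by (simp add: q_def)
  then have "q \<ge> 1" using q_b by simp
  then have "sum f M \<ge> card M" using normal_card_pos[OF M] by (simp add: q_def field_simps)
  then have "(\<Sum>m\<in>M. 1 - f m) = 0"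
    using sum_nonneg[of M "\<lambda>m. 1 - f m"] f_le by (simp add: sum_subtractf)
  then have "1 - f s = 0"
    using normal_finite[OF M] f_le s by (subst (asm) sum_nonneg_eq_0_iff) auto
  then have "cmod (t (tensor_part N s)) = 1"
    using norm_ge_zero[of "t (tensor_part N s)"] by (simp add: f_def power2_eq_1_iff)
  then show ?thesis using tensor_part_norm_t(2)[OF N Mc[OF s]] by blast
qed

end

section \<open>Means over commutators\<close>

context qp_rep
begin

definition conj_avg where
  "conj_avg N g = smul (1 / of_nat (card N)) (\<Sum>m\<in>N. r m * r (inv g) * r (inv m))"

text \<open>
  The trace of conjugation by \<open>g\<close> on \<open>spanned N\<close>, divided by the dimension of \<open>spanned N\<close>. The definition in
  terms of commutators needs neither a basis nor a projection.
\<close>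

definition mean_comm where
  "mean_comm N g = (\<Sum>m\<in>N. t (r (g \<otimes> m \<otimes> inv g \<otimes> inv m))) / of_nat (card N)"

text \<open>
  The inverse of the dimension of \<open>spanned N\<close>.
\<close>

definition mean_norm where
  "mean_norm N = (\<Sum>m\<in>N. t (r m) * t (r (inv m))) / of_nat (card N)"

text \<open>
  The witness \<open>\<kappa>\<close> is the dimension of \<open>spanned N\<close>; the claim is that the trace of conjugation by any \<open>g\<close> on
  it is 0 or a divisor of the dimension.
\<close>

definition divisible_means where
  "divisible_means N \<longleftrightarrow> (\<exists>\<kappa>::nat. \<kappa> > 0 \<and> mean_norm N = 1 / of_nat \<kappa> \<and>
     (\<forall>g\<in>carrier G. mean_comm N g = 0 \<or> (\<exists>k. k dvd \<kappa> \<and> of_nat \<kappa> * mean_comm N g = of_nat k)))"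

text \<open>
  The mean over the coset of \<open>s\<close> replaces the value at \<open>s\<close>; keeping all \<open>s \<in> M\<close> instead of representatives
  makes this an identity of sums over groups.
\<close>

lemma sum_avg_normal:
  assumes N: "N \<lhd> G" and M: "M \<lhd> G" and NM: "N \<subseteq> M"
  shows "(\<Sum>s\<in>M. F s) = (\<Sum>s\<in>M. (\<Sum>m\<in>N. F (s \<otimes> m)) / (of_nat (card N) :: complex))"
proof -
  have "(\<Sum>s\<in>M. \<Sum>m\<in>N. F (s \<otimes> m)) = (\<Sum>m\<in>N. \<Sum>s\<in>M. F (s \<otimes> m))"
    by (rule sum.swap)
  also have "\<dots> = (\<Sum>m\<in>N. \<Sum>s\<in>M. F s)"
  proof (rule sum.cong[OF refl])
    fix m assume "m \<in> N"
    then have m: "m \<in> M" using NM by blast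
    show "(\<Sum>s\<in>M. F (s \<otimes> m)) = (\<Sum>s\<in>M. F s)"
      by (rule sum.reindex_bij_witness[of _ "\<lambda>s. s \<otimes> inv m" "\<lambda>s. s \<otimes> m"])
        (use M m in \<open>auto simp: normal_mult normal_inv m_assoc\<close>)
  qed
  finally show ?thesis
    using normal_card_pos[OF N] by (simp flip: sum_divide_distrib)
qed

lemma conj_avg_corner [simp]: "N \<lhd> G \<Longrightarrow> g \<in> carrier G \<Longrightarrow> conj_avg N g \<in> corner n"
  unfolding conj_avg_def by (intro corner_closed corner_sum) auto

lemma conj_avg_cent:
  assumes N: "N \<lhd> G" and g: "g \<in> carrier G"
  shows "conj_avg N g \<in> centralizer N"
proof -
  define c where "c = (\<Sum>m\<in>N. r m * r (inv g) * r (inv m))"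
  have cc: "c \<in> corner n"
    unfolding c_def using N g by (intro corner_sum corner_closed) auto
  have "r j * c = c * r j" if j: "j \<in> N" for j
  proof -
    have jc: "j \<in> carrier G" using N j by simp
    have "r j * c * r (inv j) = (\<Sum>k\<in>N. r (j \<otimes> k) * r (inv g) * r (inv (j \<otimes> k)))"
      using N g jc
      by (auto simp: c_def sum_distrib_left sum_distrib_right r_mult inv_mult_group mult.assoc intro!: sum.cong)
    also have "\<dots> = c"
      unfolding c_def
      by (rule sum.reindex_bij_witness[of _ "\<lambda>k. inv j \<otimes> k" "\<lambda>k. j \<otimes> k"])
        (use N j in \<open>auto simp: normal_mult normal_inv simp flip: m_assoc\<close>)
    finally have "r j * c * r (inv j) * r j = c * r j" by simp
    then show ?thesis using jc cc by (simp add: mult.assoc)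
  qed
  then show ?thesis using cc by (auto simp: conj_avg_def centralizer_def corner_closed simp flip: c_def)
qed

lemma avg_commutator:
  assumes N: "N \<lhd> G" and g: "g \<in> carrier G" and s: "s \<in> carrier G"
  shows "(\<Sum>m\<in>N. t (r (g \<otimes> (s \<otimes> m) \<otimes> inv g \<otimes> inv (s \<otimes> m)))) / of_nat (card N)
    = t (r g * (r s * conj_avg N g * r (inv s)))"
proof -
  have "t (r g * (r s * conj_avg N g * r (inv s)))
      = (\<Sum>m\<in>N. t (r g * (r s * (r m * r (inv g) * r (inv m)) * r (inv s)))) / of_nat (card N)"
    by (simp add: conj_avg_def sum_distrib_left sum_distrib_right t_sum sum_divide_distrib)
  also have "(\<Sum>m\<in>N. t (r g * (r s * (r m * r (inv g) * r (inv m)) * r (inv s))))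
      = (\<Sum>m\<in>N. t (r (g \<otimes> (s \<otimes> m) \<otimes> inv g \<otimes> inv (s \<otimes> m))))"
    using N g s by (intro sum.cong refl) (simp add: r_mult inv_mult_group mult.assoc)
  finally show ?thesis ..
qed

lemma mean_comm_eq:
  assumes N: "N \<lhd> G" and g: "g \<in> carrier G"
  shows "mean_comm N g = t (r g * conj_avg N g)"
proof -
  have "(\<Sum>m\<in>N. t (r (g \<otimes> m \<otimes> inv g \<otimes> inv m))) = (\<Sum>m\<in>N. t (r (g \<otimes> (\<one> \<otimes> m) \<otimes> inv g \<otimes> inv (\<one> \<otimes> m))))"
    using N by (intro sum.cong) simp_all
  then show ?thesis
    unfolding mean_comm_def using avg_commutator[OF N g one_closed] N g by simp
qed

lemma mean_comm_extend:
  assumes N: "N \<lhd> G" and M: "M \<lhd> G" and NM: "N \<subseteq> M" and g: "g \<in> carrier G"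
  shows "mean_comm M g = (\<Sum>s\<in>M. t (r g * (r s * conj_avg N g * r (inv s)))) / of_nat (card M)"
  unfolding mean_comm_def
  by (subst sum_avg_normal[OF N M NM]) (use M g in \<open>auto simp: avg_commutator[OF N]\<close>)

text \<open>
  Up to the factor, the orthogonal projection onto \<open>spanned N\<close> for the trace form, evaluated on an element that it
  fixes. By linearity and translation the left-hand side is \<open>z * y\<close> for a fixed \<open>z\<close>, and \<open>z\<close> is central in the span,
  as \<open>t\<close> is a class function.
\<close>

lemma spanned_projection:
  assumes N: "N \<lhd> G" and y: "y \<in> spanned N"
  shows "(\<Sum>m\<in>N. smul (t (y * r m)) (r (inv m))) = smul (of_nat (card N) * mean_norm N) y"
proof -
  define z where "z = (\<Sum>m\<in>N. smul (t (r m)) (r (inv m)))"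
  have Nc: "m \<in> carrier G" if "m \<in> N" for m using N that by simp
  have zc: "z \<in> corner n"
    unfolding z_def using Nc by (intro corner_sum corner_closed) auto
  have zB: "z \<in> spanned N"
    unfolding z_def using N by (intro spanned_sum spanned_smul r_spanned normal_inv)
  have "r j * z = z * r j" if j: "j \<in> N" for j
  proof -
    have jc: "j \<in> carrier G" using Nc j .
    have "r j * z * r (inv j) = (\<Sum>m\<in>N. smul (t (r (j \<otimes> m \<otimes> inv j))) (r (inv (j \<otimes> m \<otimes> inv j))))"
      unfolding z_def sum_distrib_left sum_distrib_right
    proof (rule sum.cong[OF refl])
      fix m assume m: "m \<in> N"
      have "t (r (j \<otimes> m \<otimes> inv j)) = t (r (inv j) * (r j * r m))"
        using jc Nc[OF m] by (simp add: r_mult t_commute)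
      then show "r j * smul (t (r m)) (r (inv m)) * r (inv j) =
          smul (t (r (j \<otimes> m \<otimes> inv j))) (r (inv (j \<otimes> m \<otimes> inv j)))"
        using jc Nc[OF m] by (simp add: r_mult inv_mult_group mult.assoc)
    qed
    also have "\<dots> = z"
      unfolding z_def
      by (rule sum.reindex_bij_witness[of _ "\<lambda>m. inv j \<otimes> m \<otimes> j" "\<lambda>m. j \<otimes> m \<otimes> inv j"])
        (use N jc Nc in \<open>auto simp: normal_conj normal_conj' conj_inv_cancel\<close>)
    finally have "r j * z * r (inv j) * r j = z * r j" by simp
    then show ?thesis using jc zc by (simp add: mult.assoc)
  qed
  then have "z \<in> centralizer N" using zc by (simp add: centralizer_def)
  then have "z = smul (t z) e" by (rule spanned_centralizer_scalar[OF N _ zB])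
  also have "t z = of_nat (card N) * mean_norm N"
    using normal_card_pos[OF N] by (simp add: z_def t_sum mean_norm_def)
  finally have z: "z = smul (of_nat (card N) * mean_norm N) e" .
  have "(\<Sum>m\<in>N. smul (t (y * r m)) (r (inv m))) = z * y"
    using N y
  proof (induction rule: spanned_induct)
    case zero
    then show ?case by (simp add: t_def)
  next
    case (add c k y)
    have kc: "k \<in> carrier G" using Nc add by simp
    have "(\<Sum>m\<in>N. smul (t (r k * r m)) (r (inv m))) = (\<Sum>m\<in>N. smul (t (r m)) (r (inv m) * r k))"
      by (rule sum.reindex_bij_witness[of _ "\<lambda>m. inv k \<otimes> m" "\<lambda>m. k \<otimes> m"])
        (use N kc Nc add in \<open>auto simp: normal_mult normal_inv inv_mult_group r_mult mult.assoc simp flip: m_assoc\<close>)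
    then have "(\<Sum>m\<in>N. smul (t (r k * r m)) (r (inv m))) = z * r k"
      by (simp add: z_def sum_distrib_right)
    then show ?case
      using add
      by (simp add: distrib_right distrib_left t_add fmat.scale_left_distrib sum.distrib
          flip: fmat.scale_scale fmat.scale_sum_right)
  qed
  then show ?thesis using y spanned_corner[OF N] by (simp add: z)
qed

lemma mean_norm_extend:
  assumes N: "N \<lhd> G" and M: "M \<lhd> G" and NM: "N \<subseteq> M" and B: "\<And>s. s \<in> M \<Longrightarrow> r s \<in> spanned N"
  shows "mean_norm M = mean_norm N"
proof -
  have "(\<Sum>m\<in>N. t (r (s \<otimes> m)) * t (r (inv (s \<otimes> m)))) / of_nat (card N) = mean_norm N" if s: "s \<in> M" for s
  proof -
    have sc: "s \<in> carrier G" using M s by simp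
    have "(\<Sum>m\<in>N. t (r (s \<otimes> m)) * t (r (inv (s \<otimes> m))))
        = t ((\<Sum>m\<in>N. smul (t (r s * r m)) (r (inv m))) * r (inv s))"
      using N sc by (simp add: t_sum sum_distrib_right r_mult inv_mult_group)
    also have "\<dots> = of_nat (card N) * mean_norm N"
      using sc B[OF s] by (simp add: spanned_projection[OF N])
    finally show ?thesis using normal_card_pos[OF N] by simp
  qed
  then have "(\<Sum>s\<in>M. t (r s) * t (r (inv s))) = of_nat (card M) * mean_norm N"
    by (subst sum_avg_normal[OF N M NM]) simp
  then show ?thesis
    using normal_card_pos[OF M] by (simp add: mean_norm_def[of M])
qed

text \<open>
  As \<open>M\<close> is mapped into the span of \<open>N\<close>, both means are those of \<open>N\<close>: in \<open>mean_comm\<close> each \<open>r s\<close> commutes with the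
  average over \<open>N\<close> and cancels against \<open>r (inv s)\<close>.
\<close>

lemma divisible_means_extend_span:
  assumes N: "N \<lhd> G" and M: "M \<lhd> G" and NM: "N \<subseteq> M" and B: "\<And>s. s \<in> M \<Longrightarrow> r s \<in> spanned N"
    and good: "divisible_means N"
  shows "divisible_means M"
proof -
  have "mean_comm M g = mean_comm N g" if g: "g \<in> carrier G" for g
  proof -
    have "t (r g * (r s * conj_avg N g * r (inv s))) = mean_comm N g" if s: "s \<in> M" for s
    proof -
      have sc: "s \<in> carrier G" using M s by simp
      have "r s * conj_avg N g = conj_avg N g * r s"
        using centralizer_spanned_commute[OF N conj_avg_cent[OF N g] B[OF s]] by simp
      then show ?thesis using sc N g by (simp add: mult.assoc mean_comm_eq)
    qed
    then show ?thesis
      using normal_card_pos[OF M] by (simp add: mean_comm_extend[OF N M NM g])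
  qed
  then show ?thesis
    using good mean_norm_extend[OF N M NM B] by (simp add: divisible_means_def)
qed

lemma divisible_means_trivial: "divisible_means {\<one>}"
  unfolding divisible_means_def
proof (intro exI[of _ 1] conjI ballI)
  fix g assume "g \<in> carrier G"
  then have "mean_comm {\<one>} g = 1" by (simp add: mean_comm_def)
  then show "mean_comm {\<one>} g = 0 \<or> (\<exists>k. k dvd 1 \<and> of_nat 1 * mean_comm {\<one>} g = of_nat k)" by (intro disjI2 exI[of _ 1]) simp
qed (simp_all add: mean_norm_def)

text \<open>
  For \<open>N = G\<close> the inner average in \<open>mean_comm\<close> is the scalar \<open>t (r (inv g))\<close>, which leaves \<open>\<bar>t (r g)\<bar>\<^sup>2\<close>, and the
  orthogonality relation identifies \<open>\<kappa>\<close> with \<open>n\<^sup>2\<close>.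
\<close>

lemma divisible_means_carrier:
  assumes "divisible_means (carrier G)" and g: "g \<in> carrier G"
  shows "(cmod (tr (r g)))\<^sup>2 = 0 \<or> (\<exists>k::nat. k > 0 \<and> (cmod (tr (r g)))\<^sup>2 = of_nat k \<and> k dvd n\<^sup>2)"
proof -
  have C: "carrier G \<lhd> G" by (rule normal_invI[OF subgroup_self]) simp
  obtain \<kappa> :: nat where \<kappa>: "\<kappa> > 0" "mean_norm (carrier G) = 1 / of_nat \<kappa>"
    and Sg: "mean_comm (carrier G) g = 0 \<or> (\<exists>k. k dvd \<kappa> \<and> of_nat \<kappa> * mean_comm (carrier G) g = of_nat k)"
    using assms by (auto simp: divisible_means_def)
  have "mean_norm (carrier G) = 1 / (of_nat n)\<^sup>2"
    using normal_card_pos[OF C] by (simp add: mean_norm_def orth)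
  then have "(of_nat \<kappa> :: complex) = of_nat (n\<^sup>2)" using \<kappa> n_pos by (simp add: field_simps)
  then have \<kappa>n: "\<kappa> = n\<^sup>2" by (simp only: of_nat_eq_iff)
  have "conj_avg (carrier G) g = smul (t (r (inv g))) e"
    using average_spanned[OF C r_spanned, of "inv g"] g normal_card_pos[OF C] by (simp add: conj_avg_def)
  then have "mean_comm (carrier G) g = t (r g) * cnj (t (r g))"
    using g by (simp add: mean_comm_eq[OF C] norm_t_inv mult.commute)
  then have "of_nat \<kappa> * mean_comm (carrier G) g = tr (r g) * cnj (tr (r g))"
    using n_pos by (simp add: \<kappa>n t_def power2_eq_square)
  also have "\<dots> = of_real ((cmod (tr (r g)))\<^sup>2)" by (rule complex_norm_square[symmetric])
  finally have eq: "of_nat \<kappa> * mean_comm (carrier G) g = of_real ((cmod (tr (r g)))\<^sup>2)" .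
  from Sg show ?thesis
  proof
    assume "mean_comm (carrier G) g = 0"
    then show ?thesis using eq by simp
  next
    assume "\<exists>k. k dvd \<kappa> \<and> of_nat \<kappa> * mean_comm (carrier G) g = of_nat k"
    then obtain k where k: "k dvd \<kappa>" "of_nat \<kappa> * mean_comm (carrier G) g = of_nat k" by blast
    have "complex_of_real ((cmod (tr (r g)))\<^sup>2) = of_real (of_nat k)" using k eq by simp
    then have "(cmod (tr (r g)))\<^sup>2 = of_nat k" by (simp only: of_real_eq_iff)
    moreover have "k > 0" using k \<kappa> by (cases k) auto
    ultimately show ?thesis using k \<kappa>n by blast
  qed
qed

text \<open>
  If the part \<open>d\<close> of \<open>s\<close> commuted with all of \<open>M\<close> it would be central in the span of \<open>M\<close>, hence a scalar, and \<open>r s\<close>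
  would lie in the span of \<open>N\<close>. So some \<open>x \<in> M\<close> moves \<open>d\<close>; since \<open>M / N\<close> is abelian it only multiplies \<open>d\<close> by a
  scalar \<open>\<mu> \<noteq> 1\<close>, and \<open>t(d) = \<mu> t(d)\<close> forces \<open>t(d) = 0\<close>. Finally \<open>t(d b) = t(d) t(b)\<close> for \<open>b\<close> in the span of
  \<open>N\<close>, by averaging over \<open>N\<close>.
\<close>

lemma ramified_t_zero:
  assumes N: "N \<lhd> G" and M: "M \<lhd> G" and NM: "N \<subseteq> M"
    and ab: "\<And>a b. a \<in> M \<Longrightarrow> b \<in> M \<Longrightarrow> a \<otimes> b \<otimes> inv a \<otimes> inv b \<in> N"
    and B: "\<And>s. s \<in> M \<Longrightarrow> r s \<in> spanned N \<Longrightarrow> s \<in> N"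
    and s: "s \<in> M" "s \<notin> N"
  shows "t (r s) = 0"
proof -
  have sc: "s \<in> carrier G" using M s by simp
  let ?d = "tensor_part N s"
  note d = tensor_part[OF N sc]
  have dc: "?d \<in> corner n" using N sc by simp
  have dB: "?d \<in> spanned M"
  proof -
    have "r (inv s) * ?d \<in> spanned M" using tensor_line_memD[OF N sc d(1)] spanned_mono[OF NM] by blast
    then have "r s * (r (inv s) * ?d) \<in> spanned M" by (rule spanned_mult[OF M r_spanned[OF s(1)]])
    then show ?thesis using sc dc by simp
  qed
  have "\<exists>x\<in>M. r x * ?d * r (inv x) \<noteq> ?d"
  proof (rule ccontr)
    assume "\<not> ?thesis"
    then have fix_d: "r x * ?d * r (inv x) = ?d" if "x \<in> M" for x using that by blast
    have "r x * ?d = ?d * r x" if x: "x \<in> M" for x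
    proof -
      have "r x * ?d * r (inv x) * r x = ?d * r x" using fix_d[OF x] by simp
      then show ?thesis using M x dc by (simp add: mult.assoc)
    qed
    then have "?d \<in> centralizer M" using dc by (simp add: centralizer_def)
    then have eq: "?d = smul (t ?d) e" by (rule spanned_centralizer_scalar[OF M _ dB])
    have "?d \<noteq> 0" using d(2) e_neq_0 by auto
    then have "t ?d \<noteq> 0" using eq by (metis fmat.scale_zero_left)
    then have "r s \<in> spanned N" using tensor_line_scalar_imp_spanned[OF N sc] d(1) eq by metis
    then show False using B s by blast
  qed
  then obtain x where x: "x \<in> M" "r x * ?d * r (inv x) \<noteq> ?d" by blast
  have xc: "x \<in> carrier G" using M x by simp
  have "r x * ?d * r (inv x) \<in> tensor_line N (x \<otimes> s \<otimes> inv x)" by (rule tensor_line_conj[OF N xc sc d(1)])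
  moreover have "inv (x \<otimes> s \<otimes> inv x) \<otimes> s \<in> N"
    using ab[OF x(1) normal_inv[OF M s(1)]] xc sc by (simp add: inv_mult_group m_assoc)
  ultimately have "r x * ?d * r (inv x) \<in> tensor_line N s"
    using tensor_line_coset'[OF N, of "x \<otimes> s \<otimes> inv x" s] xc sc by simp
  then obtain \<mu> where \<mu>: "r x * ?d * r (inv x) = smul \<mu> ?d"
    using tensor_line_multiple[OF N sc] by blast
  then have "\<mu> \<noteq> 1" using x by auto
  moreover have "t ?d = \<mu> * t ?d"
  proof -
    have "t (r x * ?d * r (inv x)) = t (r (inv x) * (r x * ?d))" by (rule t_commute)
    then show ?thesis using xc dc \<mu> by simp
  qed
  ultimately have td: "t ?d = 0" by auto
  define b where "b = dag ?d * r s"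
  have b: "b \<in> spanned N"
    using spanned_dag[OF N tensor_line_memD[OF N sc d(1)]] sc dc by (simp add: b_def dag_mult)
  have rs: "r s = ?d * b" using d sc by (simp add: b_def flip: mult.assoc)
  have "of_nat (card N) * t (?d * b) = (\<Sum>m\<in>N. t (?d * (r m * b * r (inv m))))"
  proof -
    have "t (?d * (r m * b * r (inv m))) = t (?d * b)" if m: "m \<in> N" for m
    proof -
      have mc: "m \<in> carrier G" using N m by simp
      have "?d * (r m * b * r (inv m)) = r m * (?d * b * r (inv m))"
        using tensor_line_cent[OF d(1)] m by (simp add: centralizer_def flip: mult.assoc)
      then have "t (?d * (r m * b * r (inv m))) = t (?d * b * r (inv m) * r m)"
        by (simp add: t_commute)
      then show ?thesis using mc spanned_corner[OF N b] by (simp add: mult.assoc)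
    qed
    then show ?thesis by simp
  qed
  also have "\<dots> = t (?d * (\<Sum>m\<in>N. r m * b * r (inv m)))"
    by (simp add: sum_distrib_left t_sum)
  also have "\<dots> = 0" using dc td by (simp add: average_spanned[OF N b])
  finally show ?thesis using normal_card_pos[OF N] by (simp add: rs)
qed

text \<open>
  Let \<open>C\<close> be the group of those \<open>s \<in> M\<close> whose class modulo \<open>N\<close> is fixed by \<open>g\<close>. If \<open>s \<notin> C\<close>, all
  commutators of \<open>g\<close> with elements of \<open>s N\<close> lie in \<open>M - N\<close>, where \<open>t\<close> vanishes. If \<open>s \<in> C\<close>, conjugation by \<open>g\<close>
  multiplies the part of \<open>s\<close> by a scalar \<open>\<mu> s\<close>, and the coset of \<open>s\<close> contributes \<open>\<mu> s\<close> times the mean for \<open>N\<close>. As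
  \<open>\<mu>\<close> is multiplicative on \<open>C\<close>, its sum is 0 or \<open>card C\<close>.
\<close>

lemma divisible_means_extend_ramified:
  assumes N: "N \<lhd> G" and M: "M \<lhd> G" and NM: "N \<subseteq> M"
    and ab: "\<And>a b. a \<in> M \<Longrightarrow> b \<in> M \<Longrightarrow> a \<otimes> b \<otimes> inv a \<otimes> inv b \<in> N"
    and B: "\<And>s. s \<in> M \<Longrightarrow> r s \<in> spanned N \<Longrightarrow> s \<in> N"
    and good: "divisible_means N"
  shows "divisible_means M"
proof -
  obtain \<kappa> :: nat where \<kappa>: "\<kappa> > 0" "mean_norm N = 1 / of_nat \<kappa>"
    and SN: "\<And>g. g \<in> carrier G \<Longrightarrow> mean_comm N g = 0 \<or> (\<exists>k. k dvd \<kappa> \<and> of_nat \<kappa> * mean_comm N g = of_nat k)"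
    using good by (auto simp: divisible_means_def)
  note t0 = ramified_t_zero[OF N M NM ab B]
  have Mc: "s \<in> carrier G" if "s \<in> M" for s using M that by simp
  have Nc: "s \<in> carrier G" if "s \<in> N" for s using N that by simp
  have cN: "card N > 0" and cM: "card M > 0" using normal_card_pos N M by auto
  obtain u where u: "card M = card N * u"
    using sum_transversal[OF normal_imp_subgroup[OF N] normal_imp_subgroup[OF M] NM normal_finite[OF M]]
    by blast
  have u_pos: "u > 0" using cM u by (cases u) auto
  have "(\<Sum>m\<in>M. t (r m) * t (r (inv m))) = (\<Sum>m\<in>N. t (r m) * t (r (inv m)))"
    using NM t0 by (intro sum.mono_neutral_right[OF normal_finite[OF M]]) auto
  then have "of_nat (card M) * mean_norm M = of_nat (card N) * mean_norm N"
    using cN cM by (simp add: mean_norm_def)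
  then have mM: "mean_norm M = 1 / of_nat (\<kappa> * u)"
    using \<kappa> cN u_pos by (simp add: u field_simps)
  have "mean_comm M g = 0 \<or> (\<exists>k. k dvd \<kappa> * u \<and> of_nat (\<kappa> * u) * mean_comm M g = of_nat k)"
    if g: "g \<in> carrier G" for g
  proof -
    define C where "C = {s \<in> M. g \<otimes> s \<otimes> inv g \<otimes> inv s \<in> N}"
    define c where "c = conj_avg N g"
    have cc: "c \<in> corner n" and ccent: "c \<in> centralizer N"
      using N g by (simp_all add: c_def conj_avg_cent)
    define \<mu> where "\<mu> s = t (r g * tensor_part N s * r (inv g) * dag (tensor_part N s))" for s
    have outside: "t (r g * (r s * c * r (inv s))) = 0" if s: "s \<in> M" "s \<notin> C" for s
    proof -
      have "t (r (g \<otimes> (s \<otimes> m) \<otimes> inv g \<otimes> inv (s \<otimes> m))) = 0" if m: "m \<in> N" for m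
      proof (rule t0)
        have sm: "s \<otimes> m \<in> M" using normal_mult[OF M s(1)] m NM by blast
        show "g \<otimes> (s \<otimes> m) \<otimes> inv g \<otimes> inv (s \<otimes> m) \<in> M"
          using normal_mult[OF M normal_conj[OF M g sm] normal_inv[OF M sm]] .
        show "g \<otimes> (s \<otimes> m) \<otimes> inv g \<otimes> inv (s \<otimes> m) \<notin> N"
        proof
          assume a: "g \<otimes> (s \<otimes> m) \<otimes> inv g \<otimes> inv (s \<otimes> m) \<in> N"
          define v where "v = s \<otimes> ((g \<otimes> m \<otimes> inv g) \<otimes> inv m) \<otimes> inv s"
          have v: "v \<in> N"
            unfolding v_def
            by (intro normal_conj[OF N Mc[OF s(1)]] normal_mult[OF N] normal_conj[OF N g] normal_inv[OF N] m)
          have "g \<otimes> s \<otimes> inv g \<otimes> inv s = g \<otimes> (s \<otimes> m) \<otimes> inv g \<otimes> inv (s \<otimes> m) \<otimes> inv v"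
            using g Mc[OF s(1)] Nc[OF m] by (simp add: v_def inv_mult_group m_assoc inv_cancel)
          then have "g \<otimes> s \<otimes> inv g \<otimes> inv s \<in> N"
            using normal_mult[OF N a normal_inv[OF N v]] by simp
          then show False using s by (simp add: C_def)
        qed
      qed
      then show ?thesis
        using avg_commutator[OF N g Mc[OF s(1)]] by (simp add: c_def)
    qed
    have mu_gen: "r g * x * r (inv g) = smul (\<mu> s) x" if s: "s \<in> C" and x: "x \<in> tensor_line N s" for s x
    proof -
      have sM: "s \<in> M" and gs: "g \<otimes> s \<otimes> inv g \<otimes> inv s \<in> N" using s by (auto simp: C_def)
      note sc = Mc[OF sM]
      let ?d = "tensor_part N s"
      note d = tensor_part[OF N sc]
      have dc: "?d \<in> corner n" using N sc by simp
      have "inv s \<otimes> inv (g \<otimes> s \<otimes> inv g \<otimes> inv s) \<otimes> s \<in> N"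
        by (rule normal_conj'[OF N sc normal_inv[OF N gs]])
      then have "inv (g \<otimes> s \<otimes> inv g) \<otimes> s \<in> N"
        using g sc by (simp add: inv_mult_group m_assoc inv_cancel)
      then have "r g * ?d * r (inv g) \<in> tensor_line N s"
        using tensor_line_coset'[OF N, of "g \<otimes> s \<otimes> inv g" s] tensor_line_conj[OF N g sc d(1)] g sc by simp
      then obtain a where a: "r g * ?d * r (inv g) = smul a ?d" using tensor_line_multiple[OF N sc] by blast
      then have "\<mu> s = a" using d by (simp add: \<mu>_def)
      moreover obtain b where "x = smul b ?d" using tensor_line_multiple[OF N sc x] by blast
      ultimately show ?thesis using a by (simp add: mult.commute)
    qed
    have inside: "t (r g * (r s * c * r (inv s))) = \<mu> s * mean_comm N g" if s: "s \<in> C" for s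
    proof -
      have sM: "s \<in> M" using s by (simp add: C_def)
      note sc = Mc[OF sM]
      let ?d = "tensor_part N s"
      note d = tensor_part[OF N sc]
      have dc [simp]: "?d \<in> corner n" using N sc by simp
      define b where "b = dag ?d * r s"
      have b: "b \<in> spanned N"
        using spanned_dag[OF N tensor_line_memD[OF N sc d(1)]] sc dc by (simp add: b_def dag_mult)
      have bc [simp]: "b \<in> corner n" by (rule spanned_corner[OF N b])
      have rs: "r s = ?d * b" using d sc by (simp add: b_def flip: mult.assoc)
      have "b * r (inv s) = dag ?d" using sc by (simp add: b_def mult.assoc)
      then have "r s * c * r (inv s) = ?d * c * dag ?d"
        using centralizer_spanned_commute[OF N ccent b] by (simp add: rs mult.assoc) (metis mult.assoc)
      then have "r g * (r s * c * r (inv s)) = (r g * ?d * r (inv g)) * (r g * c * dag ?d)"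
        using g cc by (simp add: mult.assoc corner_closed)
      also have "\<dots> = smul (\<mu> s) (?d * (r g * c * dag ?d))"
        by (simp add: mu_gen[OF s d(1)])
      finally have "t (r g * (r s * c * r (inv s))) = \<mu> s * t (r g * c * dag ?d * ?d)"
        by (simp add: t_commute[of ?d])
      then show ?thesis
        using d g cc N by (simp add: mult.assoc mean_comm_eq flip: c_def)
    qed
    have CM: "C \<subseteq> M" by (auto simp: C_def)
    have finC: "finite C" using CM normal_finite[OF M] by (rule finite_subset)
    have C_mult: "s \<otimes> s' \<in> C" if s: "s \<in> C" "s' \<in> C" for s s'
    proof -
      have sM: "s \<in> M" "s' \<in> M" and gs: "g \<otimes> s \<otimes> inv g \<otimes> inv s \<in> N" "g \<otimes> s' \<otimes> inv g \<otimes> inv s' \<in> N"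
        using s by (auto simp: C_def)
      have "g \<otimes> (s \<otimes> s') \<otimes> inv g \<otimes> inv (s \<otimes> s')
          = (g \<otimes> s \<otimes> inv g \<otimes> inv s) \<otimes> (s \<otimes> (g \<otimes> s' \<otimes> inv g \<otimes> inv s') \<otimes> inv s)"
        using g Mc[OF sM(1)] Mc[OF sM(2)] by (simp add: inv_mult_group m_assoc inv_cancel)
      also have "\<dots> \<in> N"
        by (intro normal_mult[OF N] gs normal_conj[OF N] Mc sM)
      finally show ?thesis using normal_mult[OF M sM] by (simp add: C_def)
    qed
    have C_inv: "inv s \<in> C" if s: "s \<in> C" for s
    proof -
      have sM: "s \<in> M" and gs: "g \<otimes> s \<otimes> inv g \<otimes> inv s \<in> N" using s by (auto simp: C_def)
      have "g \<otimes> inv s \<otimes> inv g \<otimes> inv (inv s) = inv s \<otimes> inv (g \<otimes> s \<otimes> inv g \<otimes> inv s) \<otimes> s"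
        using g Mc[OF sM] by (simp add: inv_mult_group m_assoc inv_cancel)
      also have "\<dots> \<in> N" by (rule normal_conj'[OF N Mc[OF sM] normal_inv[OF N gs]])
      finally show ?thesis using normal_inv[OF M sM] by (simp add: C_def)
    qed
    have NC: "N \<subseteq> C"
      using NM N g by (auto simp: C_def intro!: normal_mult normal_conj normal_inv)
    have subC: "subgroup C G"
      using CM Mc C_mult C_inv NC normal_one[OF N] by (intro subgroupI) auto
    obtain v where v: "card C = card N * v"
      using sum_transversal[OF normal_imp_subgroup[OF N] subC NC finC] by blast
    obtain w where w: "card M = card C * w"
      using sum_transversal[OF subC normal_imp_subgroup[OF M] CM normal_finite[OF M]] by blast
    have uvw: "u = v * w" using cN u v w by simp
    have mu_mult: "\<mu> (s \<otimes> s') = \<mu> s * \<mu> s'" if s: "s \<in> C" "s' \<in> C" for s s'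
    proof -
      have sc: "s \<in> carrier G" "s' \<in> carrier G" using s CM Mc by auto
      let ?d = "tensor_part N s" and ?d' = "tensor_part N s'"
      note d = tensor_part[OF N sc(1)] and d' = tensor_part[OF N sc(2)]
      have dc [simp]: "?d \<in> corner n" "?d' \<in> corner n" using N sc by simp_all
      have "smul (\<mu> (s \<otimes> s')) (?d * ?d') = r g * (?d * ?d') * r (inv g)"
        using mu_gen[OF C_mult[OF s] tensor_line_mult[OF N sc d(1) d'(1)]] by simp
      also have "\<dots> = (r g * ?d * r (inv g)) * (r g * ?d' * r (inv g))"
        using g by (simp add: mult.assoc corner_closed)
      also have "\<dots> = smul (\<mu> s * \<mu> s') (?d * ?d')"
        by (simp add: mu_gen[OF s(1) d(1)] mu_gen[OF s(2) d'(1)])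
      finally have eq: "smul (\<mu> (s \<otimes> s')) (?d * ?d') = smul (\<mu> s * \<mu> s') (?d * ?d')" .
      have "?d * ?d' * (dag ?d' * dag ?d) = ?d * (?d' * dag ?d') * dag ?d"
        by (simp only: mult.assoc)
      then have tensor_part_inv: "?d * ?d' * (dag ?d' * dag ?d) = e" using d d' by simp
      have "smul (\<mu> (s \<otimes> s')) e = smul (\<mu> s * \<mu> s') e"
        using arg_cong[OF eq, of "\<lambda>z. z * (dag ?d' * dag ?d)"]
        by (simp only: smul_mult_left tensor_part_inv)
      then show ?thesis by (simp add: e_neq_0)
    qed
    have sum_mu: "sum \<mu> C = 0 \<or> sum \<mu> C = of_nat (card C)"
    proof (cases "\<forall>s\<in>C. \<mu> s = 1")
      case True
      then show ?thesis by simp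
    next
      case False
      then obtain s where s: "s \<in> C" "\<mu> s \<noteq> 1" by blast
      have sc: "s \<in> carrier G" using s CM Mc by auto
      have "sum \<mu> C = (\<Sum>x\<in>C. \<mu> (s \<otimes> x))"
        by (rule sum.reindex_bij_witness[of _ "\<lambda>x. s \<otimes> x" "\<lambda>x. inv s \<otimes> x"])
          (use s sc CM Mc C_mult C_inv in \<open>auto simp: inv_cancel subset_iff\<close>)
      also have "\<dots> = \<mu> s * sum \<mu> C"
        using s by (simp add: mu_mult sum_distrib_left)
      finally show ?thesis using s(2) by auto
    qed
    have "(\<Sum>s\<in>M. t (r g * (r s * c * r (inv s)))) = (\<Sum>s\<in>C. \<mu> s * mean_comm N g)"
      using normal_finite[OF M] CM outside inside by (intro sum.mono_neutral_cong_right) auto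
    then have SM: "of_nat (card M) * mean_comm M g = sum \<mu> C * mean_comm N g"
      using cM by (simp add: mean_comm_extend[OF N M NM g] c_def sum_distrib_right)
    from sum_mu show ?thesis
    proof
      assume "sum \<mu> C = 0"
      then show ?thesis using SM cM by simp
    next
      assume "sum \<mu> C = of_nat (card C)"
      then have "of_nat u * mean_comm M g = of_nat v * mean_comm N g"
        using SM cN by (simp add: u v)
      then have eq: "of_nat (\<kappa> * u) * mean_comm M g = of_nat v * (of_nat \<kappa> * mean_comm N g)"
        by simp
      from SN[OF g] show ?thesis
      proof
        assume "mean_comm N g = 0"
        then show ?thesis using eq \<kappa> u_pos by simp
      next
        assume "\<exists>k. k dvd \<kappa> \<and> of_nat \<kappa> * mean_comm N g = of_nat k"
        then obtain k where k: "k dvd \<kappa>" "of_nat \<kappa> * mean_comm N g = of_nat k" by blast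
        have "v * k dvd \<kappa> * u" using k(1) by (simp add: uvw mult.commute[of \<kappa>] mult.assoc mult_dvd_mono)
        moreover have "of_nat (\<kappa> * u) * mean_comm M g = of_nat (v * k)" using eq k by simp
        ultimately show ?thesis by blast
      qed
    qed
  qed
  then show ?thesis
    unfolding divisible_means_def using \<kappa>(1) u_pos mM by (intro exI[of _ "\<kappa> * u"]) auto
qed

end

section \<open>The values of a quasi-primitive character\<close>

context qp_rep
begin

text \<open>
  A largest normal subgroup with the divisibility property must be \<open>G\<close>, because each of the two extension steps
  would enlarge it.
\<close>

theorem divisible_means_carrier_G:
  assumes solv: "\<And>p. p \<in> prime_factors n \<Longrightarrow> p_solvable p G"
  shows "divisible_means (carrier G)"
proof -
  define P where "P N \<longleftrightarrow> N \<lhd> G \<and> divisible_means N" for N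
  have "P {\<one>}" using one_is_normal divisible_means_trivial by (simp add: P_def)
  moreover have "card N \<le> card (carrier G)" if "P N" for N
    using that fin by (auto simp: P_def intro!: card_mono)
  then have "\<forall>N. P N \<longrightarrow> card N < Suc (card (carrier G))" by (simp add: less_Suc_eq_le)
  ultimately obtain N where PN: "P N" and greatest: "\<And>M. P M \<Longrightarrow> card M \<le> card N"
    using ex_has_greatest_nat[of P "{\<one>}" card] by blast
  have N: "N \<lhd> G" and gN: "divisible_means N" using PN by (auto simp: P_def)
  have no_bigger: False if "P M" "N \<subset> M" for M
    using greatest[OF that(1)] psubset_card_mono[OF normal_finite that(2)] that(1) by (auto simp: P_def)
  define K where "K = {s \<in> carrier G. r s \<in> spanned N}"
  have K: "K \<lhd> G"
  proof (rule normal_invI)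
    show "subgroup K G"
    proof (rule subgroupI)
      show "K \<noteq> {}" using e_spanned[OF N] by (auto simp: K_def intro!: exI[of _ \<one>])
      show "inv s \<in> K" if "s \<in> K" for s
        using that spanned_dag[OF N, of "r s"] by (simp add: K_def)
      show "s \<otimes> s' \<in> K" if "s \<in> K" "s' \<in> K" for s s'
        using that spanned_mult[OF N] by (simp add: K_def r_mult)
    qed (auto simp: K_def)
    fix g s assume g: "g \<in> carrier G" and s: "s \<in> K"
    then show "g \<otimes> s \<otimes> inv g \<in> K"
      using spanned_conj[OF N, of "r s" g] by (simp add: K_def r_mult)
  qed
  have NK: "N \<subseteq> K" using N by (auto simp: K_def r_spanned)
  have "divisible_means K" by (rule divisible_means_extend_span[OF N K NK _ gN]) (simp add: K_def)
  then have KN: "K = N" using no_bigger[of K] K NK by (auto simp: P_def)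
  then have in_N: "s \<in> N" if "s \<in> carrier G" "r s \<in> spanned N" for s
    using that by (auto simp: K_def)
  have "N = carrier G"
  proof (rule ccontr)
    assume "N \<noteq> carrier G"
    then obtain M where M: "M \<lhd> G" "N \<subset> M"
      and cases: "coprime (card M div card N) n \<or> (\<forall>a\<in>M. \<forall>b\<in>M. a \<otimes> b \<otimes> inv a \<otimes> inv b \<in> N)"
      using chief_factor_coprime_or_abelian[OF fin N _ n_pos solv] by blast
    from cases show False
    proof
      assume "coprime (card M div card N) n"
      then have "M \<subseteq> N"
        using coprime_factor_spanned[OF N M(1)] M in_N by (meson normal_carrier psubsetE subsetI)
      then show False using M by blast
    next
      assume "\<forall>a\<in>M. \<forall>b\<in>M. a \<otimes> b \<otimes> inv a \<otimes> inv b \<in> N"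
      then have "divisible_means M"
        using M in_N by (intro divisible_means_extend_ramified[OF N M(1) _ _ _ gN]) auto
      then show False using no_bigger[of M] M by (simp add: P_def)
    qed
  qed
  then show ?thesis using gN by simp
qed

end

theorem theoremB:
  fixes G :: "('g, 'r) monoid_scheme" and \<chi> :: "'g \<Rightarrow> complex"
  assumes "group G" and "finite (carrier G)"
    and "\<chi> \<in> Irr G"
    and "quasi_primitive G \<chi>"
    and "pi_solvable (prime_factors (char_degree G \<chi>)) G"
  shows "\<forall>x \<in> carrier G.
    (cmod (\<chi> x))\<^sup>2 = 0 \<or>
    (\<exists>k::nat. k > 0 \<and> (cmod (\<chi> x))\<^sup>2 = of_nat k \<and> k dvd (char_degree G \<chi>)\<^sup>2)"
proof -
  obtain n \<rho> where \<chi>: "\<chi> = (\<lambda>g\<in>carrier G. mat_trace (\<rho> g))" and irr: "irreducible_rep G n \<rho>"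
    using assms(3) by (auto simp: Irr_def)
  define r where "r g = embed n (\<rho> g)" for g
  interpret F: fin_rep G n r
    unfolding r_def by (rule irreducible_rep_fin_rep[OF assms(1,2) irr])
  have mat_tr: "tr (embed k (\<sigma> x)) = mat_trace (\<sigma> x)"
    if "irreducible_rep H k \<sigma>" "x \<in> carrier H" for H :: "('g, 'r) monoid_scheme" and k \<sigma> x
    using that by (intro tr_embed) (auto simp: irreducible_rep_def hom_def intro!: GL_carrier)
  have \<chi>_tr: "\<chi> x = tr (r x)" if "x \<in> carrier G" for x
    using that mat_tr[OF irr that] by (simp add: \<chi> r_def)
  have deg: "char_degree G \<chi> = n"
  proof -
    have "of_nat (char_degree G \<chi>) = \<chi> \<one>\<^bsub>G\<^esub>"
      using char_degree_eq[OF assms(1,3)] by simp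
    also have "\<dots> = of_nat n" using \<chi>_tr[OF F.one_closed] by simp
    finally show ?thesis by (simp only: of_nat_eq_iff)
  qed
  interpret Q: qp_rep G n r
  proof unfold_locales
    show "(\<Sum>g\<in>carrier G. F.t (r g) * F.t (r (inv\<^bsub>G\<^esub> g))) = of_nat (card (carrier G)) / (of_nat n)\<^sup>2"
      using irreducible_rep_orthogonality[OF assms(1,2) irr]
      by (simp add: F.t_def r_def power2_eq_square flip: sum_divide_distrib)
    fix N y assume N: "N \<lhd> G" and y: "y \<in> N"
    obtain \<theta> m where \<theta>: "\<theta> \<in> Irr (G\<lparr>carrier := N\<rparr>)" "restrict \<chi> N = (\<lambda>x\<in>N. of_nat m * \<theta> x)"
      using assms(4) N by (auto simp: quasi_primitive_def)
    then obtain k \<sigma> where \<sigma>: "\<theta> = (\<lambda>g\<in>N. mat_trace (\<sigma> g))" "irreducible_rep (G\<lparr>carrier := N\<rparr>) k \<sigma>"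
      by (auto simp: Irr_def)
    show "(\<Sum>j\<in>N. r (j \<otimes>\<^bsub>G\<^esub> y \<otimes>\<^bsub>G\<^esub> inv\<^bsub>G\<^esub> j)) = smul (of_nat (card N) * F.t (r y)) (unit_mat n)"
    proof (rule F.class_sum_scalar[OF N y \<sigma>(2)])
      fix x assume x: "x \<in> N"
      then have xc: "x \<in> carrier G" using subgroup.mem_carrier[OF normal_imp_subgroup[OF N]] by blast
      have "\<chi> x = of_nat m * \<theta> x" using fun_cong[OF \<theta>(2), of x] x by simp
      then show "tr (r x) = of_nat m * tr (embed k (\<sigma> x))"
        using x xc mat_tr[OF \<sigma>(2), of x] by (simp add: \<chi>_tr \<sigma>(1))
    qed
  qed
  have "Q.divisible_means (carrier G)"
    using assms(5) by (intro Q.divisible_means_carrier_G) (simp add: pi_solvable_def deg)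
  then show ?thesis
    using Q.divisible_means_carrier by (simp add: \<chi>_tr deg)
qed

end
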